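(* Assume the smoothness assumption, that $R$ is convex, the sparse minimizer assumption and the non-degeneracy assumption (all stated in the context). Let $J_0>J^\star$ and $\kappa_0>0$ be the constants provided by the sharpness inequality recalled in the context, and let $\mathrm{Ret}$ be a retraction compatible with the cone structure. Then there exists $\eta_{\max}>0$ such that for any projected gradient descent sequence $(\nu_k)_{k\ge0}$ for $J$ with step-sizes $\alpha,\beta>0$, if $J(\nu_0)\le J_0$ and $\max\{\alpha,\beta\}\le\eta_{\max}$, then for all $k\ge 0$ $$J(\nu_k)-J^\star\ \le\ (J(\nu_0)-J^\star)\,\big(1-\kappa_0\min\{\alpha,\beta\}\big)^k .$$
   Context: Smoothness assumption: $\Theta$ is a compact $d$-dimensional Riemannian manifold without boundary, $\mathcal F$ is a Hilbert space, $\lambda>0$; $\phi:\Theta\to\mathcal F$ and $R:\mathcal F\to\mathbb R_+$ are twice Fréchet differentiable with locally Lipschitz second-order derivatives, and $\nabla R$ is bounded on sublevel sets of $R$. $\mathcal M_+(\Theta)$ is the set of finite nonnegative Borel measures on $\Theta$. For $\nu\in\mathcal M_+(\Theta)$, $$J(\nu)=R\Big(\int_\Theta\phi\,d\nu\Big)+\lambda\,\nu(\Theta),\qquad J^\star=\inf_{\mathcal M_+(\Theta)}J,\qquad J'_\nu(\theta)=\Big\langle\phi(\theta),\nabla R\Big(\int_\Theta\phi\,d\nu\Big)\Big\rangle_{\mathcal F}+\lambda .$$ Sparse minimizer assumption: $J$ has a unique minimizer on $\mathcal M_+(\Theta)$, of the form $\nu^\star=\sum_{i=1}^{m^\star}r_i^2\delta_{\theta_i}$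 with $\nu^\star(\Theta)>0$, $r_i>0$ and the $\theta_i$ distinct. Write $f^\star=\int\phi\,d\nu^\star$. Non-degeneracy assumption: fix normal coordinates around each $\theta_i$. For $\alpha,\beta>0$ put $\bar\nabla\phi=(2\alpha\phi,\beta\nabla\phi)$, with components $\bar\nabla_0\phi=2\alpha\phi$ and $\bar\nabla_j\phi=\beta\,\partial_j\phi$ for $1\le j\le d$. Let $K$ be the matrix indexed by $\{1,\dots,m^\star\}\times\{0,\dots,d\}$, $$K_{(i,j),(i',j')}=\big\langle r_i\bar\nabla_j\phi(\theta_i),\ \nabla^2R(f^\star)\,r_{i'}\bar\nabla_{j'}\phi(\theta_{i'})\big\rangle_{\mathcal F},$$ and $H_i=\beta^2\nabla^2J'_{\nu^\star}(\theta_i)$. Assume: $\nabla^2R(f^\star)$ is positive definite; $\sigma_{\min}(K)>0$; $\min_i\sigma_{\min}(H_i)>0$; and the only points where $J'_{\nu^\star}$ vanishes are $\theta_1,\dots,\theta_{m^\star}$. (The validity of these conditions does not depend on the choice of $\alpha,\beta>0$.) Sharpness inequality: under these assumptions there exist $J_0>J^\star$ and $\kappa_0>0$ such that for all $\nu\in\mathcal M_+(\Theta)$ with $J(\nu)\le J_0$ and all $\alpha,\beta>0$, $$\frac12\int_\Theta\big(4\alpha|J'_\nu|^2+\beta\|\nabla J'_\nu\|_\theta^2\big)\,d\nu\ \ge\ \kappa_0\min\{\alpha,\beta\}(J(\nu)-J^\star).$$ Let $\Omega=\mathbb R_+\times\Theta$, $\Omega^*=\mathbb R_+^*\times\Theta$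 with $\mathbb R_+^*=(0,\infty)$. $\mathcal P_2(\Omega)$ is the set of Borel probability measures $\mu$ on $\Omega$ with $\int r^2\,d\mu<\infty$, and $\mathsf h:\mathcal P_2(\Omega)\to\mathcal M_+(\Theta)$ is defined by $\int_\Theta\varphi\,d(\mathsf h\mu)=\int_\Omega r^2\varphi(\theta)\,d\mu(r,\theta)$ for continuous $\varphi$. Retraction compatible with the cone structure: a map $\mathrm{Ret}:\Omega\times(\mathbb R\times T\Theta)\to\Omega$ such that (i) on $\Omega^*$ it is a retraction in the usual sense (smooth, $\mathrm{Ret}_x(0)=x$, $d\,\mathrm{Ret}_x(0)=\mathrm{id}$); it need not be defined everywhere, but there is $C>0$ such that $\mathrm{Ret}_{(r,\theta)}(\delta r,\delta\theta)$ is defined whenever $\max\{|\delta r|/r,\|\delta\theta\|_\theta\}<C$; (ii) $\mathrm{Ret}_{(0,\theta)}(\delta r,\delta\theta)=(0,f(\theta,\delta\theta))$ for some arbitrary measurable $f$; (iii) for $r,\tilde r>0$, $\theta\in\Theta$, $\delta r\in\mathbb R$, $\delta\theta\in T_\theta\Theta$ with $\max\{|\delta r|,\|\delta\theta\|_\theta\}<C$, if $(r_1,\theta_1)=\mathrm{Ret}_{(r,\theta)}(r\delta r,\delta\theta)$ and $(r_2,\theta_2)=\mathrm{Ret}_{(\tilde r,\theta)}(\tilde r\delta r,\delta\theta)$, then $\theta_1=\theta_2$ and $\tilde r\,r_1=r\,r_2$. Projected gradient descent with step-sizes $\alpha,\beta>0$: $\nu_k=\mathsf h\mu_k$, where $\mu_0\in\mathcal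 P_2(\Omega)$ and $\mu_{k+1}=(T_k)_\#\mu_k$ with $T_k(r,\theta)=\mathrm{Ret}_{(r,\theta)}\big(-2\alpha rJ'_{\nu_k}(\theta),-\beta\nabla J'_{\nu_k}(\theta)\big)$ ($\#$ is the pushforward). *)

theory Defs
  imports "HOL-Probability.Probability"
begin

section \<open>Smooth maps on open subsets of normed spaces\<close>

text \<open>\<open>S\<close> is meant to be open and the domain finite-dimensional, so that continuity of all
  directional derivatives is continuity of the derivative.\<close>

primrec Ck_on :: "nat \<Rightarrow> 'a::real_normed_vector set \<Rightarrow> ('a \<Rightarrow> 'b::real_normed_vector) \<Rightarrow> bool" where
  "Ck_on 0 S f \<longleftrightarrow> continuous_on S f"
| "Ck_on (Suc k) S f \<longleftrightarrow>
     (\<forall>x\<in>S. f differentiable (at x)) \<and> (\<forall>v. Ck_on k S (\<lambda>x. frechet_derivative f (at x) v))"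

definition smooth_on :: "'a::real_normed_vector set \<Rightarrow> ('a \<Rightarrow> 'b::real_normed_vector) \<Rightarrow> bool" where
  "smooth_on S f \<longleftrightarrow> (\<forall>k. Ck_on k S f)"

text \<open>Twice Frechet differentiable with locally Lipschitz second derivative (in operator norm).\<close>

definition C2_loc_lipschitz_on ::
    "'a::real_normed_vector set \<Rightarrow> ('a \<Rightarrow> 'b::real_normed_vector) \<Rightarrow> bool" where
  "C2_loc_lipschitz_on S f \<longleftrightarrow>
     (\<exists>(D1 :: 'a \<Rightarrow> 'a \<Rightarrow>\<^sub>L 'b) (D2 :: 'a \<Rightarrow> 'a \<Rightarrow>\<^sub>L 'a \<Rightarrow>\<^sub>L 'b).
        (\<forall>x\<in>S. (f has_derivative blinfun_apply (D1 x)) (at x)) \<and>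
        (\<forall>x\<in>S. (D1 has_derivative blinfun_apply (D2 x)) (at x)) \<and>
        (\<forall>x\<in>S. \<exists>e>0. \<exists>L. L-lipschitz_on (ball x e \<inter> S) D2))"


section \<open>Riemannian manifolds\<close>

text \<open>The manifold is the whole (topological) type \<open>'p\<close>; a chart is an open set together with a
  coordinate map, whose values outside of that set are irrelevant.\<close>

type_synonym ('p, 'e) chart = "'p set \<times> ('p \<Rightarrow> 'e)"

definition chart_inv :: "('p, 'e) chart \<Rightarrow> 'e \<Rightarrow> 'p" where
  "chart_inv c = inv_into (fst c) (snd c)"

definition chart_range :: "('p, 'e) chart \<Rightarrow> 'e set" where
  "chart_range c = snd c ` fst c"

definition is_chart :: "('p::topological_space, 'e::euclidean_space) chart \<Rightarrow> bool" where
  "is_chart c \<longleftrightarrow> open (fst c) \<and> open (chart_range c) \<and>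
     homeomorphism (fst c) (chart_range c) (snd c) (chart_inv c)"

definition smooth_compatible ::
    "('p, 'e::euclidean_space) chart \<Rightarrow> ('p, 'e) chart \<Rightarrow> bool" where
  "smooth_compatible c c' \<longleftrightarrow>
     smooth_on (snd c ` (fst c \<inter> fst c')) (snd c' \<circ> chart_inv c) \<and>
     smooth_on (snd c' ` (fst c \<inter> fst c')) (snd c \<circ> chart_inv c')"

definition smooth_atlas :: "('p::topological_space, 'e::euclidean_space) chart set \<Rightarrow> bool" where
  "smooth_atlas A \<longleftrightarrow> (\<forall>c\<in>A. is_chart c) \<and> (\<Union>c\<in>A. fst c) = UNIV \<and>
     (\<forall>c\<in>A. \<forall>c'\<in>A. smooth_compatible c c')"

text \<open>A tangent vector at \<open>p\<close> is the family of its coordinate representations in all the charts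
  of the atlas around \<open>p\<close> (and \<open>0\<close> for the other indices), related by the derivatives of the
  transition maps.\<close>

type_synonym ('p, 'e) tvec = "('p, 'e) chart \<Rightarrow> 'e"

definition tangent_space ::
    "('p, 'e::euclidean_space) chart set \<Rightarrow> 'p \<Rightarrow> ('p, 'e) tvec set" where
  "tangent_space A p = {X.
     (\<forall>c. \<not> (c \<in> A \<and> p \<in> fst c) \<longrightarrow> X c = 0) \<and>
     (\<forall>c\<in>A. \<forall>c'\<in>A. p \<in> fst c \<and> p \<in> fst c' \<longrightarrow>
        X c' = frechet_derivative (snd c' \<circ> chart_inv c) (at (snd c p)) (X c))}"

text \<open>The tangent vector at \<open>p\<close> with coordinates \<open>v\<close> in the chart \<open>c\<close>; here \<open>c\<close> only needs to be
  smoothly compatible with the atlas.\<close>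

definition tvec_of ::
    "('p, 'e::euclidean_space) chart set \<Rightarrow> ('p, 'e) chart \<Rightarrow> 'p \<Rightarrow> 'e \<Rightarrow> ('p, 'e) tvec" where
  "tvec_of A c p v = (\<lambda>c'. if c' \<in> A \<and> p \<in> fst c'
     then frechet_derivative (snd c' \<circ> chart_inv c) (at (snd c p)) v else 0)"

definition zero_tvec :: "('p, 'e::euclidean_space) tvec" where
  "zero_tvec = (\<lambda>_. 0)"

definition add_tvec ::
    "('p, 'e::euclidean_space) tvec \<Rightarrow> ('p, 'e) tvec \<Rightarrow> ('p, 'e) tvec" where
  "add_tvec X Y = (\<lambda>c. X c + Y c)"

definition scale_tvec :: "real \<Rightarrow> ('p, 'e::euclidean_space) tvec \<Rightarrow> ('p, 'e) tvec" where
  "scale_tvec a X = (\<lambda>c. a *\<^sub>R X c)"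

type_synonym ('p, 'e) metric_tensor = "'p \<Rightarrow> ('p, 'e) tvec \<Rightarrow> ('p, 'e) tvec \<Rightarrow> real"

definition metric_in ::
    "('p, 'e::euclidean_space) chart set \<Rightarrow> ('p, 'e) metric_tensor \<Rightarrow> ('p, 'e) chart \<Rightarrow>
     'e \<Rightarrow> 'e \<Rightarrow> 'e \<Rightarrow> real" where
  "metric_in A g c x u v =
     g (chart_inv c x) (tvec_of A c (chart_inv c x) u) (tvec_of A c (chart_inv c x) v)"

definition riemannian_metric ::
    "('p, 'e::euclidean_space) chart set \<Rightarrow> ('p, 'e) metric_tensor \<Rightarrow> bool" where
  "riemannian_metric A g \<longleftrightarrow>
     (\<forall>p. \<forall>X\<in>tangent_space A p. \<forall>Y\<in>tangent_space A p. g p X Y = g p Y X) \<and>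
     (\<forall>p. \<forall>X\<in>tangent_space A p. \<forall>Y\<in>tangent_space A p. \<forall>Z\<in>tangent_space A p. \<forall>a.
        g p (add_tvec (scale_tvec a X) Y) Z = a * g p X Z + g p Y Z) \<and>
     (\<forall>p. \<forall>X\<in>tangent_space A p. X \<noteq> zero_tvec \<longrightarrow> g p X X > 0) \<and>
     (\<forall>c\<in>A. \<forall>u v. smooth_on (chart_range c) (\<lambda>x. metric_in A g c x u v))"

definition compact_riemannian_manifold ::
    "('p::{t2_space, second_countable_topology}, 'e::euclidean_space) chart set \<Rightarrow>
     ('p, 'e) metric_tensor \<Rightarrow> bool" where
  "compact_riemannian_manifold A g \<longleftrightarrow>
     compact (UNIV :: 'p set) \<and> smooth_atlas A \<and> riemannian_metric A g"

definition tnorm :: "('p, 'e) metric_tensor \<Rightarrow> 'p \<Rightarrow> ('p, 'e) tvec \<Rightarrow> real" where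
  "tnorm g p X = sqrt (g p X X)"

definition mgrad ::
    "('p, 'e::euclidean_space) chart set \<Rightarrow> ('p, 'e) metric_tensor \<Rightarrow> ('p \<Rightarrow> real) \<Rightarrow>
     'p \<Rightarrow> ('p, 'e) tvec" where
  "mgrad A g u p = (THE X. X \<in> tangent_space A p \<and>
     (\<forall>Y\<in>tangent_space A p. \<forall>c\<in>A. p \<in> fst c \<longrightarrow>
        g p X Y = frechet_derivative (u \<circ> chart_inv c) (at (snd c p)) (Y c)))"

text \<open>The geodesic equation in each chart, with acceleration \<open>a\<close> and velocity \<open>v\<close>, in the
  lowered-index form: with metric coefficients \<open>G\<close>, one requires
  \<open>G(x)(a,w) + DG(x)[v](v,w) - DG(x)[w](v,v) / 2 = 0\<close> for all \<open>w\<close>.\<close>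

definition geodesic_on ::
    "('p::topological_space, 'e::euclidean_space) chart set \<Rightarrow> ('p, 'e) metric_tensor \<Rightarrow>
     real set \<Rightarrow> (real \<Rightarrow> 'p) \<Rightarrow> bool" where
  "geodesic_on A g I \<gamma> \<longleftrightarrow> continuous_on I \<gamma> \<and>
     (\<forall>c\<in>A. \<exists>v a. \<forall>t\<in>I. \<gamma> t \<in> fst c \<longrightarrow>
        ((snd c \<circ> \<gamma>) has_vector_derivative v t) (at t within I) \<and>
        (v has_vector_derivative a t) (at t within I) \<and>
        (\<forall>w. metric_in A g c (snd c (\<gamma> t)) (a t) w
            + frechet_derivative (\<lambda>x. metric_in A g c x (v t) w) (at (snd c (\<gamma> t))) (v t)
            - frechet_derivative (\<lambda>x. metric_in A g c x (v t) (v t)) (at (snd c (\<gamma> t))) w / 2 = 0))"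

text \<open>Normal coordinates at \<open>p\<close>: the inverse of the exponential map, read in an orthonormal basis
  of the tangent space, on a star-shaped neighbourhood of the origin; that is, the coordinate
  frame is orthonormal at \<open>p\<close> and the radial segments are geodesics.\<close>

definition normal_chart ::
    "('p::topological_space, 'e::euclidean_space) chart set \<Rightarrow> ('p, 'e) metric_tensor \<Rightarrow>
     'p \<Rightarrow> ('p, 'e) chart \<Rightarrow> bool" where
  "normal_chart A g p c \<longleftrightarrow>
     is_chart c \<and> (\<forall>c'\<in>A. smooth_compatible c c') \<and> p \<in> fst c \<and> snd c p = 0 \<and>
     (\<forall>x\<in>chart_range c. closed_segment 0 x \<subseteq> chart_range c) \<and>
     (\<forall>u v. metric_in A g c 0 u v = u \<bullet> v) \<and>
     (\<forall>x\<in>chart_range c. geodesic_on A g {0..1} (\<lambda>t. chart_inv c (t *\<^sub>R x)))"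

definition C2_loc_lipschitz_map ::
    "('p, 'e::euclidean_space) chart set \<Rightarrow> ('p \<Rightarrow> 'f::real_normed_vector) \<Rightarrow> bool" where
  "C2_loc_lipschitz_map A \<phi> \<longleftrightarrow>
     (\<forall>c\<in>A. C2_loc_lipschitz_on (chart_range c) (\<phi> \<circ> chart_inv c))"

definition chart_partial ::
    "('p, real^'d) chart \<Rightarrow> ('p \<Rightarrow> 'f::real_normed_vector) \<Rightarrow> 'd \<Rightarrow> 'p \<Rightarrow> 'f" where
  "chart_partial c u j p =
     frechet_derivative (u \<circ> chart_inv c) (at (snd c p)) (axis j 1)"

definition chart_hessian :: "('p, real^'d) chart \<Rightarrow> ('p \<Rightarrow> real) \<Rightarrow> 'p \<Rightarrow> real^'d^'d" where
  "chart_hessian c u p = (\<chi> j k. chart_partial c (chart_partial c u k) j p)"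


section \<open>The objective\<close>

definition hgrad :: "('f::real_inner \<Rightarrow> real) \<Rightarrow> 'f \<Rightarrow> 'f" where
  "hgrad R f = (THE g. GDERIV R f :> g)"

definition hhess :: "('f::real_inner \<Rightarrow> real) \<Rightarrow> 'f \<Rightarrow> 'f \<Rightarrow> 'f" where
  "hhess R f = (THE H. (hgrad R has_derivative H) (at f))"

definition nonneg_measures :: "'p::topological_space measure set" where
  "nonneg_measures = {\<nu>. sets \<nu> = sets borel \<and> finite_measure \<nu>}"

text \<open>The weak integral of a Hilbert-space valued function. The Bochner integral of the library
  would force the Hilbert space to be separable; where it applies, the two agree (see below).\<close>

definition hintegral :: "'p measure \<Rightarrow> ('p \<Rightarrow> 'f::real_inner) \<Rightarrow> 'f" where
  "hintegral \<nu> \<phi> = (THE f. \<forall>h. f \<bullet> h = (\<integral>\<theta>. \<phi> \<theta> \<bullet> h \<partial>\<nu>))"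

lemma hintegral_eq_integral:
  fixes \<phi> :: "'p \<Rightarrow> 'f::{real_inner, banach, second_countable_topology}"
  assumes "integrable \<nu> \<phi>"
  shows "hintegral \<nu> \<phi> = integral\<^sup>L \<nu> \<phi>"
  unfolding hintegral_def
proof (rule the_equality)
  show "\<forall>h. integral\<^sup>L \<nu> \<phi> \<bullet> h = (\<integral>\<theta>. \<phi> \<theta> \<bullet> h \<partial>\<nu>)"
    using assms by simp
next
  fix f assume "\<forall>h. f \<bullet> h = (\<integral>\<theta>. \<phi> \<theta> \<bullet> h \<partial>\<nu>)"
  then have "\<forall>h. f \<bullet> h = integral\<^sup>L \<nu> \<phi> \<bullet> h"
    using assms by simp
  then show "f = integral\<^sup>L \<nu> \<phi>"
    using vector_eq_rdot by blast
qed

definition J :: "('p \<Rightarrow> 'f::real_inner) \<Rightarrow> ('f \<Rightarrow> real) \<Rightarrow> real \<Rightarrow> 'p measure \<Rightarrow> real" where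
  "J \<phi> R lam \<nu> = R (hintegral \<nu> \<phi>) + lam * measure \<nu> (space \<nu>)"

definition Jstar ::
    "('p::topological_space \<Rightarrow> 'f::real_inner) \<Rightarrow> ('f \<Rightarrow> real) \<Rightarrow> real \<Rightarrow> real" where
  "Jstar \<phi> R lam = (INF \<nu>\<in>nonneg_measures. J \<phi> R lam \<nu>)"

definition J' ::
    "('p \<Rightarrow> 'f::real_inner) \<Rightarrow> ('f \<Rightarrow> real) \<Rightarrow> real \<Rightarrow> 'p measure \<Rightarrow> 'p \<Rightarrow> real" where
  "J' \<phi> R lam \<nu> \<theta> = \<phi> \<theta> \<bullet> hgrad R (hintegral \<nu> \<phi>) + lam"

definition smoothness_assumption ::
    "('p::{t2_space, second_countable_topology}, 'e::euclidean_space) chart set \<Rightarrow>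
     ('p, 'e) metric_tensor \<Rightarrow> ('p \<Rightarrow> 'f::{real_inner, banach}) \<Rightarrow> ('f \<Rightarrow> real) \<Rightarrow> real \<Rightarrow> bool"
  where
  "smoothness_assumption A g \<phi> R lam \<longleftrightarrow>
     compact_riemannian_manifold A g \<and> lam > 0 \<and> (\<forall>f. R f \<ge> 0) \<and>
     C2_loc_lipschitz_map A \<phi> \<and> C2_loc_lipschitz_on UNIV R \<and>
     (\<forall>b. bounded (hgrad R ` {f. R f \<le> b}))"

definition atomic_measure :: "('m::finite \<Rightarrow> real) \<Rightarrow> ('m \<Rightarrow> 'p::topological_space) \<Rightarrow> 'p measure" where
  "atomic_measure w \<theta> = distr (point_measure UNIV (\<lambda>i. ennreal (w i))) borel \<theta>"

lemma emeasure_atomic_measure: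
  assumes "B \<in> sets borel"
  shows "emeasure (atomic_measure w \<theta>) B = (\<Sum>i\<in>UNIV. ennreal (w i) * indicator B (\<theta> i))"
proof -
  have "emeasure (atomic_measure w \<theta>) B
      = emeasure (point_measure UNIV (\<lambda>i. ennreal (w i))) (\<theta> -` B)"
    unfolding atomic_measure_def
    by (subst emeasure_distr)
      (use assms in \<open>auto simp: space_point_measure measurable_def sets_point_measure\<close>)
  also have "\<dots> = (\<Sum>i\<in>\<theta> -` B. ennreal (w i))"
    by (rule emeasure_point_measure_finite) auto
  also have "\<dots> = (\<Sum>i\<in>UNIV. ennreal (w i) * indicator B (\<theta> i))"
    by (rule sum.mono_neutral_cong_left) (auto simp: indicator_def)
  finally show ?thesis .
qed

text \<open>The atoms are indexed by a finite (nonempty) type \<open>'m\<close>.\<close>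

definition sparse_minimizer ::
    "('p::topological_space \<Rightarrow> 'f::real_inner) \<Rightarrow> ('f \<Rightarrow> real) \<Rightarrow> real \<Rightarrow>
     ('m::finite \<Rightarrow> real) \<Rightarrow> ('m \<Rightarrow> 'p) \<Rightarrow> 'p measure \<Rightarrow> bool" where
  "sparse_minimizer \<phi> R lam r \<theta> \<nu>s \<longleftrightarrow>
     \<nu>s \<in> nonneg_measures \<and>
     (\<forall>\<nu>\<in>nonneg_measures. J \<phi> R lam \<nu>s \<le> J \<phi> R lam \<nu>) \<and>
     (\<forall>\<nu>\<in>nonneg_measures. J \<phi> R lam \<nu> = J \<phi> R lam \<nu>s \<longrightarrow> \<nu> = \<nu>s) \<and>
     \<nu>s = atomic_measure (\<lambda>i. (r i)\<^sup>2) \<theta> \<and>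
     measure \<nu>s (space \<nu>s) > 0 \<and> (\<forall>i. r i > 0) \<and> inj \<theta>"

definition sigma_min :: "real^'n^'n \<Rightarrow> real" where
  "sigma_min M = Min {s. s \<ge> 0 \<and> (\<exists>v. v \<noteq> 0 \<and> (transpose M ** M) *v v = s\<^sup>2 *\<^sub>R v)}"

text \<open>The index set \<open>{0..d}\<close> is \<open>'d option\<close>, with \<open>None\<close> in the role of \<open>0\<close>.\<close>

primrec nabla_bar ::
    "real \<Rightarrow> real \<Rightarrow> ('p \<Rightarrow> 'f::real_inner) \<Rightarrow> ('p, real^'d) chart \<Rightarrow> 'p \<Rightarrow> 'd option \<Rightarrow> 'f" where
  "nabla_bar a b \<phi> c p None = (2 * a) *\<^sub>R \<phi> p"
| "nabla_bar a b \<phi> c p (Some j) = b *\<^sub>R chart_partial c \<phi> j p"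

definition K_matrix ::
    "real \<Rightarrow> real \<Rightarrow> ('p \<Rightarrow> 'f::real_inner) \<Rightarrow> ('f \<Rightarrow> real) \<Rightarrow> 'f \<Rightarrow>
     ('m::finite \<Rightarrow> real) \<Rightarrow> ('m \<Rightarrow> 'p) \<Rightarrow> ('m \<Rightarrow> ('p, real^'d) chart) \<Rightarrow>
     real^('m \<times> 'd option)^('m \<times> 'd option)" where
  "K_matrix a b \<phi> R fs r \<theta> nc =
     (\<chi> ij ij'. (r (fst ij) *\<^sub>R nabla_bar a b \<phi> (nc (fst ij)) (\<theta> (fst ij)) (snd ij)) \<bullet>
        hhess R fs
          (r (fst ij') *\<^sub>R nabla_bar a b \<phi> (nc (fst ij')) (\<theta> (fst ij')) (snd ij')))"

definition H_matrix ::
    "real \<Rightarrow> ('p \<Rightarrow> 'f::real_inner) \<Rightarrow> ('f \<Rightarrow> real) \<Rightarrow> real \<Rightarrow> 'p measure \<Rightarrow>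
     ('p, real^'d) chart \<Rightarrow> 'p \<Rightarrow> real^'d^'d" where
  "H_matrix b \<phi> R lam \<nu>s c p = b\<^sup>2 *\<^sub>R chart_hessian c (J' \<phi> R lam \<nu>s) p"

definition nondegenerate ::
    "real \<Rightarrow> real \<Rightarrow> ('p \<Rightarrow> 'f::real_inner) \<Rightarrow> ('f \<Rightarrow> real) \<Rightarrow> real \<Rightarrow>
     ('m::finite \<Rightarrow> real) \<Rightarrow> ('m \<Rightarrow> 'p) \<Rightarrow> ('m \<Rightarrow> ('p, real^'d) chart) \<Rightarrow> 'p measure \<Rightarrow> bool" where
  "nondegenerate a b \<phi> R lam r \<theta> nc \<nu>s \<longleftrightarrow>
     (\<forall>h. h \<noteq> 0 \<longrightarrow> h \<bullet> hhess R (hintegral \<nu>s \<phi>) h > 0) \<and>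
     sigma_min (K_matrix a b \<phi> R (hintegral \<nu>s \<phi>) r \<theta> nc) > 0 \<and>
     (MIN i. sigma_min (H_matrix b \<phi> R lam \<nu>s (nc i) (\<theta> i))) > 0 \<and>
     {p. J' \<phi> R lam \<nu>s p = 0} = range \<theta>"

definition sharpness ::
    "('p::topological_space, 'e::euclidean_space) chart set \<Rightarrow> ('p, 'e) metric_tensor \<Rightarrow>
     ('p \<Rightarrow> 'f::real_inner) \<Rightarrow> ('f \<Rightarrow> real) \<Rightarrow> real \<Rightarrow> real \<Rightarrow> real \<Rightarrow> bool" where
  "sharpness A g \<phi> R lam J0 \<kappa>0 \<longleftrightarrow>
     (\<forall>\<nu>\<in>nonneg_measures. J \<phi> R lam \<nu> \<le> J0 \<longrightarrow> (\<forall>\<alpha>>0. \<forall>\<beta>>0.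
        1/2 * (\<integral>\<theta>. (4 * \<alpha> * \<bar>J' \<phi> R lam \<nu> \<theta>\<bar>\<^sup>2
                    + \<beta> * (tnorm g \<theta> (mgrad A g (J' \<phi> R lam \<nu>) \<theta>))\<^sup>2) \<partial>\<nu>)
        \<ge> \<kappa>0 * min \<alpha> \<beta> * (J \<phi> R lam \<nu> - Jstar \<phi> R lam)))"


section \<open>Projected gradient descent\<close>

definition Omega :: "(real \<times> 'p::topological_space) measure" where
  "Omega = restrict_space borel ({0..} \<times> UNIV)"

definition P2 :: "(real \<times> 'p::topological_space) measure set" where
  "P2 = {\<mu>. sets \<mu> = sets Omega \<and> prob_space \<mu> \<and> integrable \<mu> (\<lambda>(r, \<theta>). r\<^sup>2)}"

text \<open>The projection \<open>h\<close> as a relation: \<open>\<nu>\<close> is the (unique) finite Borel measure that represents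
  the functional \<open>f \<mapsto> \<integral> r\<^sup>2 f(\<theta>) d\<mu>(r,\<theta>)\<close> on continuous functions.\<close>

definition is_projection ::
    "(real \<times> 'p::topological_space) measure \<Rightarrow> 'p measure \<Rightarrow> bool" where
  "is_projection \<mu> \<nu> \<longleftrightarrow> \<nu> \<in> nonneg_measures \<and>
     (\<forall>f :: 'p \<Rightarrow> real. continuous_on UNIV f \<longrightarrow>
        (\<integral>\<theta>. f \<theta> \<partial>\<nu>) = (\<integral>(r, \<theta>). r\<^sup>2 * f \<theta> \<partial>\<mu>))"

lemma is_projection_exists:
  fixes \<mu> :: "(real \<times> 'p::{t2_space, second_countable_topology}) measure"
  assumes "\<mu> \<in> P2"
  shows "is_projection \<mu> (distr (density \<mu> (\<lambda>(r, \<theta>). ennreal (r\<^sup>2))) borel snd)"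
proof -
  have sets: "sets \<mu> = sets Omega" and int: "integrable \<mu> (\<lambda>(r, \<theta>). r\<^sup>2)"
    using assms by (auto simp: P2_def)
  have m: "F \<in> \<mu> \<rightarrow>\<^sub>M borel" if "continuous_on UNIV F" for F :: "real \<times> 'p \<Rightarrow> 'b::topological_space"
  proof -
    have "F \<in> Omega \<rightarrow>\<^sub>M borel"
      unfolding Omega_def
      by (intro measurable_restrict_space1 borel_measurable_continuous_onI that)
    then show ?thesis
      using measurable_cong_sets[OF sets refl] by blast
  qed
  have snd_m: "snd \<in> \<mu> \<rightarrow>\<^sub>M (borel :: 'p measure)"
    by (intro m continuous_on_snd continuous_on_id)
  have w_m: "(\<lambda>(r, \<theta>). r\<^sup>2) \<in> \<mu> \<rightarrow>\<^sub>M (borel :: real measure)"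
    using int by (rule borel_measurable_integrable)
  have we: "(\<lambda>(r, \<theta>). ennreal (r\<^sup>2)) = (\<lambda>x. ennreal (case x of (r, \<theta>) \<Rightarrow> r\<^sup>2))"
    by (auto simp: fun_eq_iff)
  have snd_d: "snd \<in> density \<mu> (\<lambda>(r, \<theta>). ennreal (r\<^sup>2)) \<rightarrow>\<^sub>M (borel :: 'p measure)"
    using snd_m by simp
  have "emeasure (density \<mu> (\<lambda>(r, \<theta>). ennreal (r\<^sup>2))) (space \<mu>)
      = (\<integral>\<^sup>+x. ennreal (case x of (r, \<theta>) \<Rightarrow> r\<^sup>2) \<partial>\<mu>)"
    unfolding we using w_m
    by (subst emeasure_density) (auto intro!: nn_integral_cong simp: indicator_def)
  also have "\<dots> < \<infinity>"
    using int by (subst nn_integral_eq_integral) auto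
  finally have "finite_measure (density \<mu> (\<lambda>(r, \<theta>). ennreal (r\<^sup>2)))"
    by (intro finite_measureI) simp
  then have "finite_measure (distr (density \<mu> (\<lambda>(r, \<theta>). ennreal (r\<^sup>2))) borel (snd :: _ \<Rightarrow> 'p))"
    by (rule finite_measure.finite_measure_distr[OF _ snd_d])
  moreover have "(\<integral>\<theta>. f \<theta> \<partial>distr (density \<mu> (\<lambda>(r, \<theta>). ennreal (r\<^sup>2))) borel snd)
      = (\<integral>(r, \<theta>). r\<^sup>2 * f \<theta> \<partial>\<mu>)" if f: "continuous_on UNIV f" for f :: "'p \<Rightarrow> real"
  proof -
    have fm: "f \<in> borel_measurable borel"
      using f by (rule borel_measurable_continuous_onI)
    have "(\<integral>\<theta>. f \<theta> \<partial>distr (density \<mu> (\<lambda>(r, \<theta>). ennreal (r\<^sup>2))) borel snd)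
        = (\<integral>x. f (snd x) \<partial>density \<mu> (\<lambda>x. ennreal (case x of (r, \<theta>) \<Rightarrow> r\<^sup>2)))"
      using integral_distr[OF snd_d fm] by (simp add: we)
    also have "\<dots> = (\<integral>x. (case x of (r, \<theta>) \<Rightarrow> r\<^sup>2) *\<^sub>R f (snd x) \<partial>\<mu>)"
      by (rule integral_density[OF measurable_compose[OF snd_m fm] w_m]) auto
    also have "\<dots> = (\<integral>(r, \<theta>). r\<^sup>2 * f \<theta> \<partial>\<mu>)"
      by (intro Bochner_Integration.integral_cong) auto
    finally show ?thesis .
  qed
  ultimately show ?thesis
    by (auto simp: is_projection_def nonneg_measures_def)
qed

text \<open>Borel measurability of a map on the tangent bundle, expressed in the local trivialisations.\<close>

definition tangent_bundle_measurable ::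
    "('p::topological_space, 'e::euclidean_space) chart set \<Rightarrow>
     ('p \<Rightarrow> ('p, 'e) tvec \<Rightarrow> 'p) \<Rightarrow> bool" where
  "tangent_bundle_measurable A f \<longleftrightarrow>
     (\<forall>c\<in>A. (\<lambda>(p, v). f p (tvec_of A c p v)) \<in>
        restrict_space borel (fst c \<times> UNIV) \<rightarrow>\<^sub>M borel)"

text \<open>\<open>Ret (r, \<theta>) (s, X)\<close> stands for the retraction at \<open>(r, \<theta>)\<close> of \<open>(s, X)\<close>, with \<open>X\<close> tangent at
  \<open>\<theta>\<close>. Partiality of the retraction is rendered by leaving its values unconstrained outside of
  \<open>ret_domain\<close> (for positive \<open>r\<close>).\<close>

type_synonym ('p, 'e) cone_map = "real \<times> 'p \<Rightarrow> real \<times> ('p, 'e) tvec \<Rightarrow> real \<times> 'p"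

definition ret_domain ::
    "('p, 'e::euclidean_space) chart set \<Rightarrow> ('p, 'e) metric_tensor \<Rightarrow> real \<Rightarrow>
     real \<Rightarrow> 'p \<Rightarrow> real \<Rightarrow> ('p, 'e) tvec \<Rightarrow> bool" where
  "ret_domain A g C r \<theta> s X \<longleftrightarrow>
     r > 0 \<and> X \<in> tangent_space A \<theta> \<and> max (\<bar>s\<bar> / r) (tnorm g \<theta> X) < C"

text \<open>Smoothness on \<open>ret_domain\<close>, jointly in the base point and in the tangent vector: local
  representations are smooth on open sets. The chart \<open>c\<close> is used around the base point and \<open>c'\<close>
  around its image.\<close>

definition ret_local_domain ::
    "('p, 'e::euclidean_space) chart set \<Rightarrow> ('p, 'e) metric_tensor \<Rightarrow> real \<Rightarrow> ('p, 'e) cone_map \<Rightarrow>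
     ('p, 'e) chart \<Rightarrow> ('p, 'e) chart \<Rightarrow> (real \<times> 'e \<times> real \<times> 'e) set" where
  "ret_local_domain A g C Ret c c' = {(r, x, s, v). x \<in> chart_range c \<and>
     (let \<theta> = chart_inv c x; X = tvec_of A c \<theta> v in
        ret_domain A g C r \<theta> s X \<and> snd (Ret (r, \<theta>) (s, X)) \<in> fst c')}"

definition ret_local_rep ::
    "('p, 'e::euclidean_space) chart set \<Rightarrow> ('p, 'e) cone_map \<Rightarrow>
     ('p, 'e) chart \<Rightarrow> ('p, 'e) chart \<Rightarrow> real \<times> 'e \<times> real \<times> 'e \<Rightarrow> real \<times> 'e" where
  "ret_local_rep A Ret c c' = (\<lambda>(r, x, s, v).
     let \<theta> = chart_inv c x; y = Ret (r, \<theta>) (s, tvec_of A c \<theta> v) in (fst y, snd c' (snd y)))"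

definition ret_smooth ::
    "('p, 'e::euclidean_space) chart set \<Rightarrow> ('p, 'e) metric_tensor \<Rightarrow> real \<Rightarrow>
     ('p, 'e) cone_map \<Rightarrow> bool" where
  "ret_smooth A g C Ret \<longleftrightarrow> (\<forall>c\<in>A. \<forall>c'\<in>A.
     open (ret_local_domain A g C Ret c c') \<and>
     smooth_on (ret_local_domain A g C Ret c c') (ret_local_rep A Ret c c'))"

definition cone_retraction ::
    "('p::topological_space, 'e::euclidean_space) chart set \<Rightarrow> ('p, 'e) metric_tensor \<Rightarrow>
     ('p, 'e) cone_map \<Rightarrow> bool" where
  "cone_retraction A g Ret \<longleftrightarrow> (\<exists>C>0.
     (\<forall>r \<theta> s X. ret_domain A g C r \<theta> s X \<longrightarrow> fst (Ret (r, \<theta>) (s, X)) > 0) \<and>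
     ret_smooth A g C Ret \<and>
     (\<forall>r>0. \<forall>\<theta>. Ret (r, \<theta>) (0, zero_tvec) = (r, \<theta>)) \<and>
     (\<forall>r>0. \<forall>\<theta>. \<forall>c\<in>A. \<theta> \<in> fst c \<longrightarrow>
        ((\<lambda>(s, v). let y = Ret (r, \<theta>) (s, tvec_of A c \<theta> v) in (fst y, snd c (snd y)))
          has_derivative (\<lambda>w. w)) (at (0, 0))) \<and>
     (\<exists>f. tangent_bundle_measurable A f \<and>
        (\<forall>\<theta>. \<forall>s. \<forall>X\<in>tangent_space A \<theta>. Ret (0, \<theta>) (s, X) = (0, f \<theta> X))) \<and>
     (\<forall>r>0. \<forall>r'>0. \<forall>\<theta>. \<forall>s. \<forall>X\<in>tangent_space A \<theta>. max \<bar>s\<bar> (tnorm g \<theta> X) < C \<longrightarrow>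
        (let y1 = Ret (r, \<theta>) (r * s, X); y2 = Ret (r', \<theta>) (r' * s, X)
         in snd y1 = snd y2 \<and> r' * fst y1 = r * fst y2)))"

definition pgd_step ::
    "('p, 'e::euclidean_space) chart set \<Rightarrow> ('p, 'e) metric_tensor \<Rightarrow>
     ('p \<Rightarrow> 'f::real_inner) \<Rightarrow> ('f \<Rightarrow> real) \<Rightarrow> real \<Rightarrow> ('p, 'e) cone_map \<Rightarrow>
     real \<Rightarrow> real \<Rightarrow> 'p measure \<Rightarrow> real \<times> 'p \<Rightarrow> real \<times> 'p" where
  "pgd_step A g \<phi> R lam Ret \<alpha> \<beta> \<nu> = (\<lambda>(r, \<theta>).
     Ret (r, \<theta>) (- 2 * \<alpha> * r * J' \<phi> R lam \<nu> \<theta>,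
                 scale_tvec (- \<beta>) (mgrad A g (J' \<phi> R lam \<nu>) \<theta>)))"

definition pgd_sequence ::
    "('p::topological_space, 'e::euclidean_space) chart set \<Rightarrow> ('p, 'e) metric_tensor \<Rightarrow>
     ('p \<Rightarrow> 'f::real_inner) \<Rightarrow> ('f \<Rightarrow> real) \<Rightarrow> real \<Rightarrow> ('p, 'e) cone_map \<Rightarrow>
     real \<Rightarrow> real \<Rightarrow> (nat \<Rightarrow> (real \<times> 'p) measure) \<Rightarrow> (nat \<Rightarrow> 'p measure) \<Rightarrow> bool" where
  "pgd_sequence A g \<phi> R lam Ret \<alpha> \<beta> \<mu> \<nu> \<longleftrightarrow>
     \<mu> 0 \<in> P2 \<and> (\<forall>k. is_projection (\<mu> k) (\<nu> k)) \<and>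
     (\<forall>k. \<mu> (Suc k) = distr (\<mu> k) Omega (pgd_step A g \<phi> R lam Ret \<alpha> \<beta> (\<nu> k)))"

end

(* With rho, S the radius and angle components of Ret_(1,theta), homogeneity turns one step into the
   reweighting  int f dnu' = int rho^2 f(S) dnu  for continuous f. Since Ret has derivative id at 0 and is smooth,
   compactness of the manifold gives, uniformly in theta,
   rho^2 phi(S) = phi + 2 s phi + D phi(X) + O(s^2 + |X|^2), and rho^2 = 1 + 2 s + O(s^2 + |X|^2);
   with s = -2 alpha J' and X = -beta grad J' the linear term of J(nu') - J(nu) is
   -int (4 alpha |J'|^2 + beta |grad J'|^2) dnu. The integrals int phi dnu with nu(Theta) bounded stay
   in a compact convex set (Mazur), on which the second derivative of R is bounded although the Hilbert
   space may be infinite-dimensional; hence for small steps all quadratic terms absorb at most half of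
   the linear decrease, and the sharpness inequality turns the decrease into the geometric rate. *)
theory Submission
  imports Defs
begin

section \<open>Hilbert-space valued integrals\<close>

text \<open>Two features of the setting shape the proof. The Hilbert space need not be separable, so
  int phi dnu exists only weakly, through its inner products: existence rests on the Riesz theorem,
  and norm estimates on such integrals are obtained by pairing a vector with itself. Moreover, the
  projection of a measure is specified by its action on continuous functions alone. Integrands that
  are moved between measures must therefore be continuous in theta, although the step may send the
  apex r = 0 to an arbitrary measurable point; the weight r^2 makes that discontinuity invisible.
  The constants depend only on J0 and the data: where J is at most J0, the mass is at most J0 / lam
  because R is nonnegative, and R itself is at most J0, so that the gradient of R, J' and the
  gradient of J' are bounded. Since each step decreases J, the iterates never leave this set, and
  one bound on the step-sizes serves all k.\<close>

lemma Riesz_representation_bounded_linear: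
  fixes f :: "'a::{real_inner,banach} \<Rightarrow> real"
  assumes "bounded_linear f"
  shows "\<exists>y. \<forall>h. f h = h \<bullet> y"
proof -
  interpret bounded_linear f by fact
  obtain K where K: "\<And>x. norm (f x) \<le> norm x * K" using bounded by blast
  \<comment> \<open>A minimiser of this quadratic represents \<open>f\<close>: its first variation
    at \<open>y\<close> in direction \<open>h\<close> is twice
    \<open>y \<bullet> h - f h\<close>.\<close>
  define N where "N x = x \<bullet> x - 2 * f x" for x
  have low: "- K\<^sup>2 \<le> N x" for x
  proof -
    have "f x \<le> norm x * K" using K[of x] by auto
    moreover have "0 \<le> (norm x - K)\<^sup>2" by simp
    ultimately show ?thesis unfolding N_def
      by (simp add: power2_diff dot_square_norm algebra_simps)
  qed
  define m where "m = Inf (range N)"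
  have bdd: "bdd_below (range N)" using low by (auto intro!: bdd_belowI)
  have m_le: "m \<le> N x" for x unfolding m_def by (rule cInf_lower) (auto intro: bdd)
  define d where "d n = 1 / real (Suc n)" for n
  have "\<exists>x. N x < m + d n" for n
    using cInf_lessD[of "range N" "m + d n"] by (auto simp: m_def d_def)
  then obtain X where X: "\<And>n. N (X n) < m + d n" by metis
  \<comment> \<open>Parallelogram identity at the midpoint, where \<open>N\<close> cannot fall below
    the infimum \<open>m\<close>; it makes the minimising sequence Cauchy.\<close>
  have par: "(norm (x - y))\<^sup>2 \<le> 2 * (N x + N y) - 4 * m" for x y
  proof -
    have "N ((1/2) *\<^sub>R (x + y)) = (N x + N y) / 2 - (norm (x - y))\<^sup>2 / 4"
      unfolding N_def power2_norm_eq_inner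
      by (simp add: add scale diff inner_add_left inner_add_right inner_diff_left inner_diff_right
          inner_commute field_simps)
    then show ?thesis using m_le[of "(1/2) *\<^sub>R (x + y)"] by (simp add: field_simps)
  qed
  have "Cauchy X"
    unfolding Cauchy_def
  proof (intro allI impI)
    fix e :: real assume "e > 0"
    then obtain M where M: "d M < e\<^sup>2 / 4"
      using nat_approx_posE[of "e\<^sup>2/4"] unfolding d_def by auto
    have "dist (X i) (X j) < e" if "i \<ge> M" "j \<ge> M" for i j
    proof -
      have "d i \<le> d M" "d j \<le> d M"
        using that by (auto simp: d_def field_simps)
      then have "(norm (X i - X j))\<^sup>2 < e\<^sup>2"
        using par[of "X i" "X j"] X[of i] X[of j] M by argo
      then show ?thesis using \<open>e > 0\<close> by (simp add: dist_norm power2_less_imp_less)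
    qed
    then show "\<exists>M. \<forall>i\<ge>M. \<forall>j\<ge>M. dist (X i) (X j) < e" by blast
  qed
  then obtain y where y: "X \<longlonglongrightarrow> y" by (meson Cauchy_convergent_iff convergent_def)
  have "(\<lambda>n. N (X n)) \<longlonglongrightarrow> N y"
    unfolding N_def by (intro tendsto_intros y tendsto)
  moreover have "(\<lambda>n. m + d n) \<longlonglongrightarrow> m + 0"
    unfolding d_def by (intro tendsto_add tendsto_const LIMSEQ_Suc[OF lim_1_over_n])
  ultimately have Ny: "N y \<le> m"
    using X by (intro LIMSEQ_le[of "\<lambda>n. N (X n)" _ "\<lambda>n. m + d n"]) (auto intro: less_imp_le)
  have "f h = h \<bullet> y" for h
  proof -
    define d where "d = y \<bullet> h - f h"
    \<comment> \<open>This \<open>t\<close> minimises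
      \<open>t\<^sup>2 * (h \<bullet> h + 1) + 2 * t * d\<close>; the added 1 keeps the denominator
      positive when \<open>h = 0\<close>.\<close>
    define t where "t = - d / (h \<bullet> h + 1)"
    have hh: "h \<bullet> h + 1 > 0" by (simp add: add_nonneg_pos)
    have "N y \<le> N (y + t *\<^sub>R h)" using Ny m_le order_trans by blast
    then have "0 \<le> t\<^sup>2 * (h \<bullet> h) + 2 * t * d"
      unfolding N_def d_def
      by (simp add: add scale inner_add_left inner_add_right inner_commute power2_eq_square algebra_simps)
    also have "\<dots> \<le> t\<^sup>2 * (h \<bullet> h + 1) + 2 * t * d" by (simp add: algebra_simps)
    also have "\<dots> = - d\<^sup>2 / (h \<bullet> h + 1)"
      using hh unfolding t_def by (simp add: power2_eq_square divide_simps)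
    finally have "d\<^sup>2 \<le> 0" using hh by (simp add: field_simps)
    then show ?thesis unfolding d_def by (simp add: inner_commute)
  qed
  then show ?thesis by blast
qed

text \<open>Mazur's theorem. A finite e/3-net \<open>K\<close> of \<open>S\<close> yields the convex
  set \<open>T\<close>, the hull of \<open>K\<close> thickened by e/3, which contains
  \<open>S\<close> and hence its hull. The hull of a finite set is compact and has a finite e/3-net
  \<open>L\<close>; the last third pays for the closure.\<close>

lemma compact_closure_convex_hull:
  fixes S :: "'a::banach set"
  assumes "compact S"
  shows "compact (closure (convex hull S))"
  unfolding compact_eq_totally_bounded
proof (intro conjI allI impI)
  show "Topological_Spaces.complete (closure (convex hull S))" by (simp add: complete_eq_closed)
  fix e :: real assume "e > 0"
  then have e: "e / 3 > 0" by simp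
  obtain K where K: "finite K" "S \<subseteq> (\<Union>x\<in>K. ball x (e/3))"
    using assms e unfolding compact_eq_totally_bounded by meson
  have "compact (convex hull K)" using K by (intro finite_imp_compact_convex_hull)
  then obtain L where L: "finite L" "convex hull K \<subseteq> (\<Union>x\<in>L. ball x (e/3))"
    using e unfolding compact_eq_totally_bounded by meson
  define T where "T = (\<Union>x\<in>convex hull K. \<Union>y\<in>ball 0 (e/3). {x + y})"
  have "convex T" unfolding T_def by (intro convex_sums convex_convex_hull convex_ball)
  moreover have "S \<subseteq> T"
  proof
    fix x assume "x \<in> S"
    then obtain k where k: "k \<in> K" "dist k x < e / 3" using K by auto
    then have "k \<in> convex hull K" "x - k \<in> ball 0 (e/3)" "x = k + (x - k)"
      by (auto simp: hull_inc dist_norm norm_minus_commute)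
    then show "x \<in> T" unfolding T_def by blast
  qed
  ultimately have T: "convex hull S \<subseteq> T" by (intro hull_minimal)
  have "closure (convex hull S) \<subseteq> (\<Union>x\<in>L. ball x e)"
  proof
    fix z assume "z \<in> closure (convex hull S)"
    then obtain w where w: "w \<in> convex hull S" "dist w z < e / 3"
      using e unfolding closure_approachable by blast
    then obtain x y where xy: "x \<in> convex hull K" "norm y < e / 3" "w = x + y"
      using T unfolding T_def by auto
    then obtain l where l: "l \<in> L" "dist l x < e / 3" using L by auto
    have "dist x w < e / 3" using xy by (simp add: dist_norm)
    then have "dist l z < e" using l w dist_triangle[of l z x] dist_triangle[of x z w] by linarith
    then show "z \<in> (\<Union>x\<in>L. ball x e)" using l by auto
  qed
  then show "\<exists>k. finite k \<and> closure (convex hull S) \<subseteq> (\<Union>x\<in>k. ball x e)" using L by blast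
qed

text \<open>The missing weight \<open>1 - sum c I\<close> is placed on 0. In this way one convex set
  covers measures of every mass up to a given bound.\<close>

lemma convex_sum_le_1:
  fixes C :: "'a::real_vector set"
  assumes "finite I" "convex C" "0 \<in> C" "\<And>i. i \<in> I \<Longrightarrow> c i \<ge> 0" "sum c I \<le> 1"
    and "\<And>i. i \<in> I \<Longrightarrow> y i \<in> C"
  shows "(\<Sum>i\<in>I. c i *\<^sub>R y i) \<in> C"
proof (cases "sum c I = 0")
  case True
  then have "\<forall>i\<in>I. c i = 0" using assms sum_nonneg_eq_0_iff by blast
  then show ?thesis using assms by simp
next
  case False
  let ?t = "sum c I"
  have t: "?t > 0" using False assms by (metis less_eq_real_def sum_nonneg)
  have "(\<Sum>i\<in>I. (c i / ?t) *\<^sub>R y i) \<in> C"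
    using assms t by (intro convex_sum) (auto simp: sum_divide_distrib[symmetric])
  then have "(1 - ?t) *\<^sub>R 0 + ?t *\<^sub>R (\<Sum>i\<in>I. (c i / ?t) *\<^sub>R y i) \<in> C"
    using assms t by (intro convexD) auto
  then show ?thesis using t by (simp add: scaleR_right.sum)
qed

lemma integrable_continuous_compact_space:
  fixes f :: "'p::topological_space \<Rightarrow> real"
  assumes "\<nu> \<in> nonneg_measures" "compact (UNIV :: 'p set)" "continuous_on UNIV f"
  shows "integrable \<nu> f"
proof -
  interpret finite_measure \<nu> using assms by (auto simp: nonneg_measures_def)
  have "compact (range f)" using assms by (intro compact_continuous_image)
  then obtain B where B: "\<And>x. norm (f x) \<le> B" using compact_imp_bounded bounded_iff by (metis rangeI)
  have "f \<in> borel_measurable borel" using assms by (intro borel_measurable_continuous_onI)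
  then have "f \<in> borel_measurable \<nu>"
    using assms measurable_cong_sets[of \<nu> borel] by (auto simp: nonneg_measures_def)
  then show ?thesis using B by (intro integrable_const_bound[where B = B]) auto
qed

text \<open>\<open>hintegral\<close> is a definite description and says nothing until a representing
  vector is known. Compactness bounds \<open>\<phi>\<close>, so the functional is bounded; Riesz
  supplies the vector, and its inner products determine it.\<close>

lemma hintegral_inner:
  fixes \<phi> :: "'p::topological_space \<Rightarrow> 'f::{real_inner,banach}"
  assumes "\<nu> \<in> nonneg_measures" "compact (UNIV :: 'p set)" "continuous_on UNIV \<phi>"
  shows "hintegral \<nu> \<phi> \<bullet> h = (\<integral>\<theta>. \<phi> \<theta> \<bullet> h \<partial>\<nu>)"
proof -
  interpret finite_measure \<nu> using assms by (auto simp: nonneg_measures_def)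
  have int: "integrable \<nu> (\<lambda>\<theta>. \<phi> \<theta> \<bullet> h)" for h
    using assms by (intro integrable_continuous_compact_space) (auto intro: continuous_intros)
  have "compact (range \<phi>)" using assms by (intro compact_continuous_image)
  then obtain B where B: "\<And>x. norm (\<phi> x) \<le> B" using compact_imp_bounded bounded_iff by (metis rangeI)
  have "bounded_linear (\<lambda>h. \<integral>\<theta>. \<phi> \<theta> \<bullet> h \<partial>\<nu>)"
  proof (rule bounded_linear_intro[where K = "B * measure \<nu> (space \<nu>)"])
    fix h
    have "\<bar>\<phi> \<theta> \<bullet> h\<bar> \<le> B * norm h" for \<theta>
      using Cauchy_Schwarz_ineq2[of "\<phi> \<theta>" h] mult_right_mono[OF B[of \<theta>], of "norm h"] by simp
    then have "norm (\<integral>\<theta>. \<phi> \<theta> \<bullet> h \<partial>\<nu>) \<le> (\<integral>\<theta>. B * norm h \<partial>\<nu>)"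
      by (intro order_trans[OF integral_norm_bound] integral_mono) (auto simp: int)
    then show "norm (\<integral>\<theta>. \<phi> \<theta> \<bullet> h \<partial>\<nu>) \<le> norm h * (B * measure \<nu> (space \<nu>))"
      by (simp add: algebra_simps)
  qed (auto simp: inner_add_right int)
  then obtain y where y: "\<forall>h. (\<integral>\<theta>. \<phi> \<theta> \<bullet> h \<partial>\<nu>) = h \<bullet> y"
    using Riesz_representation_bounded_linear by blast
  have "hintegral \<nu> \<phi> = y"
    unfolding hintegral_def
  proof (rule the_equality)
    fix f assume "\<forall>h. f \<bullet> h = (\<integral>\<theta>. \<phi> \<theta> \<bullet> h \<partial>\<nu>)"
    then show "f = y" using y vector_eq_rdot[of f y] by (simp add: inner_commute)
  qed (use y in \<open>auto simp: inner_commute\<close>)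
  then show ?thesis using y by (simp add: inner_commute)
qed

text \<open>The integral is approximated by a finite combination of values of \<open>\<phi>\<close>:
  wherever \<open>p x\<close> is nonzero, \<open>\<phi>\<close> is within \<open>e\<close> of
  \<open>x\<close>, so replacing it by \<open>x\<close> costs at most \<open>e * M\<close> in total.
  With Mazur's theorem, integrals against measures of bounded mass lie in one compact convex
  set.\<close>

lemma hintegral_in_closure_convex_hull:
  fixes \<phi> :: "'p::topological_space \<Rightarrow> 'f::{real_inner,banach}"
  assumes \<nu>: "\<nu> \<in> nonneg_measures" and cpt: "compact (UNIV :: 'p set)" and cont: "continuous_on UNIV \<phi>"
    and M: "measure \<nu> (space \<nu>) \<le> M" "M > 0"
  shows "hintegral \<nu> \<phi> \<in> closure (convex hull (insert 0 ((*\<^sub>R) M ` range \<phi>)))"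
  unfolding closure_approachable
proof (intro allI impI)
  interpret finite_measure \<nu> using \<nu> by (auto simp: nonneg_measures_def)
  let ?C = "convex hull (insert 0 ((*\<^sub>R) M ` range \<phi>))"
  fix e' :: real assume "e' > 0"
  define e where "e = e' / (M + 1)"
  have e: "e > 0" "e * M < e'" using \<open>e' > 0\<close> M by (auto simp: e_def field_simps)
  have "compact (range \<phi>)" using cpt cont by (intro compact_continuous_image)
  then obtain K where K: "finite K" "K \<subseteq> range \<phi>" "range \<phi> \<subseteq> (\<Union>x\<in>K. ball x e)"
    using e by (elim compactE_image[of "range \<phi>" "range \<phi>" "\<lambda>x. ball x e"]) auto
  \<comment> \<open>a partition of unity, so that everything stays continuous\<close>
  define w where "w x \<theta> = max 0 (e - dist x (\<phi> \<theta>))" for x \<theta>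
  define W where "W \<theta> = (\<Sum>x\<in>K. w x \<theta>)" for \<theta>
  define p where "p x \<theta> = w x \<theta> / W \<theta>" for x \<theta>
  have w0: "w x \<theta> \<ge> 0" for x \<theta> by (simp add: w_def)
  have W: "W \<theta> > 0" for \<theta>
  proof -
    obtain x where "x \<in> K" "dist x (\<phi> \<theta>) < e" using K by fastforce
    then show ?thesis unfolding W_def using K w0 by (intro sum_pos2[of _ x]) (auto simp: w_def)
  qed
  have p0: "p x \<theta> \<ge> 0" for x \<theta> using w0 W[of \<theta>] by (simp add: p_def)
  have p1: "(\<Sum>x\<in>K. p x \<theta>) = 1" for \<theta>
    using W[of \<theta>] by (simp add: p_def sum_divide_distrib[symmetric] W_def)
  have pc: "continuous_on UNIV (p x)" for x
  proof -
    have wc: "continuous_on UNIV (w x)" for x unfolding w_def by (intro continuous_intros cont)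
    have "continuous_on UNIV W" unfolding W_def by (intro continuous_intros wc)
    then show ?thesis unfolding p_def using wc W by (intro continuous_on_divide) (auto simp: less_imp_neq[symmetric])
  qed
  have int: "integrable \<nu> (p x)" for x by (rule integrable_continuous_compact_space[OF \<nu> cpt pc])
  define F where "F = (\<Sum>x\<in>K. (\<integral>\<theta>. p x \<theta> \<partial>\<nu>) *\<^sub>R x)"
  have "(\<Sum>x\<in>K. (\<integral>\<theta>. p x \<theta> \<partial>\<nu>)) = measure \<nu> (space \<nu>)"
    using int by (simp add: Bochner_Integration.integral_sum[symmetric] p1)
  then have "(\<Sum>x\<in>K. ((\<integral>\<theta>. p x \<theta> \<partial>\<nu>) / M) *\<^sub>R (M *\<^sub>R x)) \<in> ?C"
    using K p0 M
    by (intro convex_sum_le_1) (auto simp: sum_divide_distrib[symmetric] intro!: hull_inc integral_nonneg)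
  then have FC: "F \<in> ?C" using M by (simp add: F_def)
  have "(norm (hintegral \<nu> \<phi> - F))\<^sup>2 \<le> e * M * norm (hintegral \<nu> \<phi> - F)"
  proof -
    \<comment> \<open>The weak integral is known only through inner products, so the difference is
      tested against itself.\<close>
    define h where "h = hintegral \<nu> \<phi> - F"
    have int2: "integrable \<nu> (\<lambda>\<theta>. p x \<theta> * ((\<phi> \<theta> - x) \<bullet> h))" for x
      by (intro integrable_continuous_compact_space[OF \<nu> cpt] continuous_intros pc cont)
    have int3: "integrable \<nu> (\<lambda>\<theta>. \<phi> \<theta> \<bullet> h)"
      by (intro integrable_continuous_compact_space[OF \<nu> cpt] continuous_intros cont)
    have "h \<bullet> h = (\<integral>\<theta>. \<phi> \<theta> \<bullet> h \<partial>\<nu>) - (\<Sum>x\<in>K. (\<integral>\<theta>. p x \<theta> \<partial>\<nu>) * (x \<bullet> h))"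
      by (subst h_def) (simp add: inner_diff_left hintegral_inner[OF \<nu> cpt cont] F_def inner_sum_left)
    also have "\<dots> = (\<integral>\<theta>. \<phi> \<theta> \<bullet> h - (\<Sum>x\<in>K. p x \<theta> * (x \<bullet> h)) \<partial>\<nu>)"
      using int int3 by (subst Bochner_Integration.integral_diff) (auto simp: Bochner_Integration.integral_sum)
    also have "\<dots> = (\<integral>\<theta>. (\<Sum>x\<in>K. p x \<theta> * ((\<phi> \<theta> - x) \<bullet> h)) \<partial>\<nu>)"
      by (intro Bochner_Integration.integral_cong refl)
        (simp add: inner_diff_left right_diff_distrib sum_subtractf sum_distrib_right[symmetric] p1)
    also have "\<dots> \<le> (\<integral>\<theta>. e * norm h \<partial>\<nu>)"
    proof (intro integral_mono Bochner_Integration.integrable_sum int2)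
      fix \<theta>
      have "p x \<theta> * ((\<phi> \<theta> - x) \<bullet> h) \<le> p x \<theta> * (e * norm h)" for x
      proof (cases "p x \<theta> = 0")
        case False
        then have "dist x (\<phi> \<theta>) < e" by (auto simp: p_def w_def max_def split: if_splits)
        then have "(\<phi> \<theta> - x) \<bullet> h \<le> e * norm h"
          using norm_cauchy_schwarz[of "\<phi> \<theta> - x" h] mult_right_mono[of "norm (\<phi> \<theta> - x)" e "norm h"]
          by (simp add: dist_norm norm_minus_commute)
        then show ?thesis using p0 by (rule mult_left_mono)
      qed simp
      then have "(\<Sum>x\<in>K. p x \<theta> * ((\<phi> \<theta> - x) \<bullet> h)) \<le> (\<Sum>x\<in>K. p x \<theta> * (e * norm h))" by (rule sum_mono)
      then show "(\<Sum>x\<in>K. p x \<theta> * ((\<phi> \<theta> - x) \<bullet> h)) \<le> e * norm h"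
        by (simp add: sum_distrib_right[symmetric] p1)
    qed simp
    also have "\<dots> = measure \<nu> (space \<nu>) * (e * norm h)" by simp
    also have "\<dots> \<le> M * (e * norm h)" using M e by (intro mult_right_mono) auto
    finally show ?thesis by (simp add: h_def power2_norm_eq_inner mult_ac)
  qed
  then have "norm (hintegral \<nu> \<phi> - F) \<le> e * M"
    using e M by (cases "norm (hintegral \<nu> \<phi> - F) = 0") (auto simp: power2_eq_square)
  then show "\<exists>y\<in>?C. dist y (hintegral \<nu> \<phi>) < e'"
    using FC e by (intro bexI[of _ F]) (auto simp: dist_norm norm_minus_commute)
qed

section \<open>Second-order calculus in normed spaces\<close>

lemma C2_loc_lipschitz_on_derivs:
  assumes "C2_loc_lipschitz_on S f"
  shows "\<exists>D1 D2. (\<forall>x\<in>S. (f has_derivative blinfun_apply (D1 x)) (at x)) \<and>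
    (\<forall>x\<in>S. (D1 has_derivative blinfun_apply (D2 x)) (at x)) \<and> continuous_on S D2"
proof -
  obtain D1 D2 where D: "\<And>x. x \<in> S \<Longrightarrow> (f has_derivative blinfun_apply (D1 x)) (at x)"
    "\<And>x. x \<in> S \<Longrightarrow> (D1 has_derivative blinfun_apply (D2 x)) (at x)"
    and L: "\<And>x. x \<in> S \<Longrightarrow> \<exists>e>0. \<exists>L. L-lipschitz_on (ball x e \<inter> S) D2"
    using assms unfolding C2_loc_lipschitz_on_def by blast
  have "continuous_on S D2"
    unfolding continuous_on_eq_continuous_within
  proof
    fix x assume x: "x \<in> S"
    then obtain e L where eL: "e > 0" "L-lipschitz_on (ball x e \<inter> S) D2" using L by blast
    have "continuous (at x within ball x e \<inter> S) D2"
      using lipschitz_on_continuous_within[OF eL(2)] x eL by auto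
    moreover have "at x within ball x e \<inter> S = at x within S"
      using eL by (intro at_within_nhd[of x "ball x e"]) auto
    ultimately show "continuous (at x within S) D2" by simp
  qed
  then show ?thesis using D by blast
qed

text \<open>Two mean value inequalities: the bound on \<open>D2\<close> makes \<open>D1\<close>
  Lipschitz on \<open>S\<close>, and then \<open>D1\<close> varies by at most
  \<open>B * norm (y - x)\<close> along the segment. This costs a factor 2 against the sharp Taylor
  constant.\<close>

lemma linearization_error_convex:
  fixes f :: "'a::real_normed_vector \<Rightarrow> 'b::real_normed_vector" and D1 :: "'a \<Rightarrow> 'a \<Rightarrow>\<^sub>L 'b"
  assumes "convex S"
    and f: "\<And>x. x \<in> S \<Longrightarrow> (f has_derivative blinfun_apply (D1 x)) (at x)"
    and D: "\<And>x. x \<in> S \<Longrightarrow> (D1 has_derivative blinfun_apply (D2 x)) (at x)"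
    and B: "\<And>x. x \<in> S \<Longrightarrow> norm (D2 x) \<le> B"
    and xy: "x \<in> S" "y \<in> S"
  shows "norm (f y - f x - D1 x (y - x)) \<le> B * (norm (y - x))\<^sup>2"
proof -
  have lip: "norm (D1 z - D1 x) \<le> B * norm (z - x)" if "z \<in> S" for z
    using assms that
    by (intro differentiable_bound[of S D1 "\<lambda>x. blinfun_apply (D2 x)"])
      (auto intro: has_derivative_at_withinI simp: norm_blinfun.rep_eq)
  have seg: "closed_segment x y \<subseteq> S" using assms by (intro closed_segment_subset)
  have B0: "B \<ge> 0" using B[OF xy(1)] norm_ge_zero order_trans by blast
  have "norm (f y - f x - D1 x (y - x)) \<le> norm (y - x) * (B * norm (y - x))"
  proof (rule differentiable_bound_linearization[where S = "closed_segment x y" and f' = "\<lambda>x. blinfun_apply (D1 x)"])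
    show "x + t *\<^sub>R (y - x) \<in> closed_segment x y" if "t \<in> {0..1}" for t
      using that unfolding in_segment by (intro exI[of _ t]) (auto simp: algebra_simps)
    show "(f has_derivative blinfun_apply (D1 z)) (at z within closed_segment x y)"
      if "z \<in> closed_segment x y" for z
      using that seg f by (auto intro: has_derivative_at_withinI)
    show "onorm (blinfun_apply (D1 z) - blinfun_apply (D1 x)) \<le> B * norm (y - x)"
      if "z \<in> closed_segment x y" for z
    proof -
      have "norm (D1 z - D1 x) \<le> B * norm (z - x)" using that seg lip by auto
      also have "\<dots> \<le> B * norm (y - x)"
        using segment_bound(1)[OF that] B0 by (intro mult_left_mono) auto
      finally show ?thesis by (simp add: norm_blinfun.rep_eq minus_blinfun.rep_eq fun_diff_def)
    qed
  qed simp
  then show ?thesis by (simp add: power2_eq_square mult_ac)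
qed

text \<open>\<open>hgrad\<close> is a definite description; Riesz provides the vector that it names,
  and uniqueness of derivatives makes the description unambiguous.\<close>

lemma has_derivative_eq_inner_hgrad:
  fixes R :: "'f::{real_inner,banach} \<Rightarrow> real"
  assumes "(R has_derivative D) (at x)"
  shows "D h = h \<bullet> hgrad R x"
proof -
  obtain y where y: "\<forall>h. D h = h \<bullet> y"
    using Riesz_representation_bounded_linear has_derivative_bounded_linear[OF assms] by blast
  then have "D = (\<lambda>h. h \<bullet> y)" by auto
  then have "GDERIV R x :> y" unfolding gderiv_def using assms by simp
  moreover have "z = y" if "GDERIV R x :> z" for z
  proof -
    have "(\<lambda>h. h \<bullet> z) = D" using that assms unfolding gderiv_def by (rule has_derivative_unique)
    then show ?thesis using y vector_eq_ldot[of z y] by metis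
  qed
  ultimately have "hgrad R x = y" unfolding hgrad_def by (rule the_equality)
  then show ?thesis using y by simp
qed

text \<open>A continuous second derivative need not be bounded on balls in infinite dimension, but
  it is bounded on the compact set \<open>K\<close>; convexity keeps the segment between two points
  of \<open>K\<close> inside \<open>K\<close>.\<close>

lemma C2_quadratic_upper_bound_compact:
  fixes R :: "'f::{real_inner,banach} \<Rightarrow> real"
  assumes "C2_loc_lipschitz_on UNIV R" "compact K" "convex K"
  shows "\<exists>L\<ge>0. \<forall>x\<in>K. \<forall>y\<in>K. R y \<le> R x + (y - x) \<bullet> hgrad R x + L * (norm (y - x))\<^sup>2"
proof -
  obtain D1 D2 where D: "\<And>x. (R has_derivative blinfun_apply (D1 x)) (at x)"
    "\<And>x. (D1 has_derivative blinfun_apply (D2 x)) (at x)" "continuous_on UNIV D2"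
    using C2_loc_lipschitz_on_derivs[OF assms(1)] by auto
  have "compact (D2 ` K)" using D assms by (intro compact_continuous_image) (auto intro: continuous_on_subset)
  then obtain L where L: "L > 0" "\<And>x. x \<in> K \<Longrightarrow> norm (D2 x) \<le> L"
    using compact_imp_bounded bounded_pos by (metis imageI)
  have "R y \<le> R x + (y - x) \<bullet> hgrad R x + L * (norm (y - x))\<^sup>2" if "x \<in> K" "y \<in> K" for x y
  proof -
    have "norm (R y - R x - D1 x (y - x)) \<le> L * (norm (y - x))\<^sup>2"
      using assms D L that by (intro linearization_error_convex[of K R D1 D2]) auto
    then show ?thesis using has_derivative_eq_inner_hgrad[OF D(1)[of x], of "y - x"] by (simp add: abs_le_iff)
  qed
  then show ?thesis using L by (intro exI[of _ L]) auto
qed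

section \<open>Quantitative linearization\<close>

text \<open>\<open>Ck_on\<close> speaks of one direction at a time; summing over a basis turns such
  information into bounds on operator norms.\<close>

lemma norm_bounded_linear_le_Basis:
  fixes f :: "'a::euclidean_space \<Rightarrow> 'b::real_normed_vector"
  assumes "bounded_linear f"
  shows "norm (f v) \<le> (\<Sum>b\<in>Basis. norm (f b)) * norm v"
proof -
  interpret bounded_linear f by fact
  have "f v = (\<Sum>b\<in>Basis. (v \<bullet> b) *\<^sub>R f b)"
    by (subst euclidean_representation[of v, symmetric]) (simp only: sum scaleR)
  also have "norm \<dots> \<le> (\<Sum>b\<in>Basis. norm (f b) * norm v)"
    by (intro order_trans[OF norm_sum] sum_mono)
      (auto simp: mult.commute[of _ "norm v"] intro!: mult_right_mono Basis_le_norm)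
  finally show ?thesis by (simp add: sum_distrib_right)
qed

lemma Ck_on_Suc_has_derivative:
  assumes "Ck_on (Suc k) S f" "x \<in> S"
  shows "(f has_derivative frechet_derivative f (at x)) (at x)"
  using assms by (simp add: frechet_derivative_works)

text \<open>The sum of the norms of the partial derivatives is continuous, hence bounded near
  \<open>x0\<close>, and the mean value inequality applies on a convex ball.\<close>

lemma Ck1_lipschitz_near:
  fixes f :: "'a::euclidean_space \<Rightarrow> 'b::real_normed_vector"
  assumes f: "Ck_on (Suc 0) S f" and S: "open S" "x0 \<in> S"
  shows "\<exists>e>0. \<exists>L\<ge>0. \<forall>x\<in>ball x0 e. \<forall>y\<in>ball x0 e. norm (f x - f y) \<le> L * norm (x - y)"
proof -
  let ?D = "\<lambda>x. frechet_derivative f (at x)"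
  define N where "N x = (\<Sum>b\<in>Basis. norm (?D x b))" for x
  have "continuous_on S N" unfolding N_def using f by (intro continuous_intros) auto
  then have "isCont N x0" using S continuous_on_eq_continuous_at by blast
  then have "\<forall>\<^sub>F x in nhds x0. N x < N x0 + 1"
    using order_tendstoD(2)[of N "N x0" "nhds x0" "N x0 + 1"] by (simp add: isCont_def tendsto_at_iff_tendsto_nhds)
  moreover have "\<forall>\<^sub>F x in nhds x0. x \<in> S" using S eventually_nhds by blast
  ultimately have "\<forall>\<^sub>F x in nhds x0. N x < N x0 + 1 \<and> x \<in> S" by eventually_elim auto
  then obtain e where e: "e > 0" "\<And>x. x \<in> ball x0 e \<Longrightarrow> N x < N x0 + 1 \<and> x \<in> S"
    unfolding eventually_nhds_metric by (auto simp: dist_commute)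
  have N0: "N x \<ge> 0" for x unfolding N_def by (intro sum_nonneg) auto
  have "norm (f x - f y) \<le> (N x0 + 1) * norm (x - y)" if "x \<in> ball x0 e" "y \<in> ball x0 e" for x y
  proof (rule differentiable_bound[OF convex_ball _ _ that])
    fix z assume z: "z \<in> ball x0 e"
    have hd: "(f has_derivative ?D z) (at z)" using e(2)[OF z] f Ck_on_Suc_has_derivative by blast
    then show "(f has_derivative ?D z) (at z within ball x0 e)" by (rule has_derivative_at_withinI)
    have "norm (?D z v) \<le> (N x0 + 1) * norm v" for v
      using norm_bounded_linear_le_Basis[OF has_derivative_bounded_linear[OF hd], of v] e(2)[OF z]
        mult_right_mono[of "N z" "N x0 + 1" "norm v"] unfolding N_def by (auto intro: order_trans)
    then show "onorm (?D z) \<le> N x0 + 1" by (rule onorm_le)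
  qed
  then show ?thesis using e N0[of x0] by (intro exI[of _ e] conjI exI[of _ "N x0 + 1"]) auto
qed

text \<open>Each partial derivative is Lipschitz on a ball of its own. On the smallest of these
  balls the sum of the constants is a Lipschitz constant of the whole derivative in operator norm,
  and the segment argument of \<open>linearization_error_convex\<close> applies.\<close>

lemma Ck2_linearization_error_near:
  fixes f :: "'a::euclidean_space \<Rightarrow> 'b::real_normed_vector"
  assumes f: "Ck_on (Suc (Suc 0)) S f" and S: "open S" "x0 \<in> S"
  shows "\<exists>e>0. \<exists>B\<ge>0. ball x0 e \<subseteq> S \<and> (\<forall>x\<in>ball x0 e. \<forall>y\<in>ball x0 e.
    norm (f y - f x - frechet_derivative f (at x) (y - x)) \<le> B * (norm (y - x))\<^sup>2)"
proof -
  let ?D = "\<lambda>x. frechet_derivative f (at x)"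
  have "\<forall>b\<in>Basis. \<exists>e>0. \<exists>L\<ge>0. \<forall>x\<in>ball x0 e. \<forall>y\<in>ball x0 e. norm (?D x b - ?D y b) \<le> L * norm (x - y)"
    using f S by (intro ballI Ck1_lipschitz_near[of S]) auto
  then obtain e where e: "\<forall>b\<in>Basis. e b > 0 \<and> (\<exists>L\<ge>0. \<forall>x\<in>ball x0 (e b). \<forall>y\<in>ball x0 (e b). norm (?D x b - ?D y b) \<le> L * norm (x - y))"
    by metis
  then obtain L where L: "\<forall>b\<in>Basis. L b \<ge> 0 \<and> (\<forall>x\<in>ball x0 (e b). \<forall>y\<in>ball x0 (e b). norm (?D x b - ?D y b) \<le> L b * norm (x - y))"
    by metis
  obtain e0 where e0: "e0 > 0" "ball x0 e0 \<subseteq> S" using S open_contains_ball by blast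
  define r where "r = Min (insert e0 (e ` Basis))"
  have r: "r > 0" "r \<le> e0" "\<And>b. b \<in> Basis \<Longrightarrow> r \<le> e b" unfolding r_def using e e0 by (auto simp: min_le_iff_disj)
  define B where "B = (\<Sum>b\<in>Basis. L b)"
  have B0: "B \<ge> 0" unfolding B_def using L by (intro sum_nonneg) auto
  have hd: "(f has_derivative ?D z) (at z)" if "z \<in> ball x0 r" for z
    using that e0 r by (intro Ck_on_Suc_has_derivative[OF f]) auto
  have "norm (f y - f x - ?D x (y - x)) \<le> B * (norm (y - x))\<^sup>2"
    if xy: "x \<in> ball x0 r" "y \<in> ball x0 r" for x y
  proof -
    have seg: "closed_segment x y \<subseteq> ball x0 r" using xy by (intro closed_segment_subset) auto
    have "norm (f y - f x - ?D x (y - x)) \<le> norm (y - x) * (B * norm (y - x))"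
    proof (rule differentiable_bound_linearization[where S = "closed_segment x y"])
      show "x + t *\<^sub>R (y - x) \<in> closed_segment x y" if "t \<in> {0..1}" for t
        using that unfolding in_segment by (intro exI[of _ t]) (auto simp: algebra_simps)
      show "(f has_derivative ?D z) (at z within closed_segment x y)" if "z \<in> closed_segment x y" for z
        using that seg by (intro has_derivative_at_withinI[OF hd]) auto
      show "onorm (?D z - ?D x) \<le> B * norm (y - x)" if z: "z \<in> closed_segment x y" for z
      proof (rule onorm_le)
        fix v
        have zr: "z \<in> ball x0 r" using z seg by auto
        have "bounded_linear (\<lambda>v. ?D z v - ?D x v)"
          using hd[OF zr] hd[OF xy(1)] by (intro bounded_linear_sub has_derivative_bounded_linear)
        then have "norm (?D z v - ?D x v) \<le> (\<Sum>b\<in>Basis. norm (?D z b - ?D x b)) * norm v"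
          by (rule norm_bounded_linear_le_Basis)
        also have "\<dots> \<le> (\<Sum>b\<in>Basis. L b * norm (z - x)) * norm v"
        proof (intro mult_right_mono sum_mono)
          fix b :: 'a assume b: "b \<in> Basis"
          then have "z \<in> ball x0 (e b)" "x \<in> ball x0 (e b)" using r(3)[OF b] zr xy(1) by auto
          then show "norm (?D z b - ?D x b) \<le> L b * norm (z - x)" using L b by blast
        qed simp
        also have "\<dots> = B * norm (z - x) * norm v" by (simp add: B_def sum_distrib_right)
        also have "\<dots> \<le> B * norm (y - x) * norm v"
          using segment_bound(1)[OF z] B0 by (intro mult_right_mono mult_left_mono) auto
        finally show "norm ((?D z - ?D x) v) \<le> B * norm (y - x) * norm v" by simp
      qed
    qed simp
    then show ?thesis by (simp add: power2_eq_square mult_ac)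
  qed
  then show ?thesis using r e0 B0 by (intro exI[of _ r] conjI exI[of _ B]) auto
qed

lemma C2_loc_lipschitz_on_has_derivative:
  assumes "C2_loc_lipschitz_on S f" "x \<in> S"
  shows "(f has_derivative frechet_derivative f (at x)) (at x)"
proof -
  obtain D1 D2 where D: "\<And>x. x \<in> S \<Longrightarrow> (f has_derivative blinfun_apply (D1 x)) (at x)"
    "\<And>x. x \<in> S \<Longrightarrow> (D1 has_derivative blinfun_apply (D2 x)) (at x)" "continuous_on S D2"
    using C2_loc_lipschitz_on_derivs[OF assms(1)] by auto
  then show ?thesis using assms(2) differentiableI frechet_derivative_works by blast
qed

lemma C2_loc_lipschitz_on_continuous_derivative:
  assumes "C2_loc_lipschitz_on S f"
  shows "continuous_on S (\<lambda>x. frechet_derivative f (at x) v)"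
proof -
  obtain D1 D2 where D: "\<And>x. x \<in> S \<Longrightarrow> (f has_derivative blinfun_apply (D1 x)) (at x)"
    "\<And>x. x \<in> S \<Longrightarrow> (D1 has_derivative blinfun_apply (D2 x)) (at x)" "continuous_on S D2"
    using C2_loc_lipschitz_on_derivs[OF assms] by auto
  have "continuous_on S D1"
    using D(2) has_derivative_continuous continuous_at_imp_continuous_on by blast
  then have "continuous_on S (\<lambda>x. D1 x v)" by (intro continuous_intros)
  moreover have "frechet_derivative f (at x) v = D1 x v" if "x \<in> S" for x
    using frechet_derivative_at[OF D(1)[OF that]] by simp
  ultimately show ?thesis by (simp cong: continuous_on_cong)
qed

lemma C2_loc_lipschitz_on_bounds_near:
  assumes f: "C2_loc_lipschitz_on S f" and S: "open S" "x0 \<in> S"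
  shows "\<exists>e>0. \<exists>B\<ge>0. ball x0 e \<subseteq> S \<and>
    (\<forall>x\<in>ball x0 e. norm (f x) \<le> B \<and> (\<forall>v. norm (frechet_derivative f (at x) v) \<le> B * norm v)) \<and>
    (\<forall>x\<in>ball x0 e. \<forall>y\<in>ball x0 e.
      norm (f y - f x - frechet_derivative f (at x) (y - x)) \<le> B * (norm (y - x))\<^sup>2)"
proof -
  obtain D1 D2 where D: "\<And>x. x \<in> S \<Longrightarrow> (f has_derivative blinfun_apply (D1 x)) (at x)"
    "\<And>x. x \<in> S \<Longrightarrow> (D1 has_derivative blinfun_apply (D2 x)) (at x)" "continuous_on S D2"
    using C2_loc_lipschitz_on_derivs[OF f] by auto
  have eq: "frechet_derivative f (at x) = blinfun_apply (D1 x)" if "x \<in> S" for x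
    using frechet_derivative_at[OF D(1)[OF that]] by simp
  have ev: "\<forall>\<^sub>F x in nhds x0. norm (h x) < norm (h x0) + 1" if "isCont h x0" for h :: "'a \<Rightarrow> 'c::real_normed_vector"
    using order_tendstoD(2)[OF tendsto_norm[of h "h x0" "nhds x0"], of "norm (h x0) + 1"] that
    by (simp add: isCont_def tendsto_at_iff_tendsto_nhds)
  have c: "isCont f x0" "isCont D1 x0" "isCont D2 x0"
    using D S has_derivative_continuous continuous_on_eq_continuous_at by blast+
  define B where "B = norm (f x0) + norm (D1 x0) + norm (D2 x0) + 1"
  have B0: "B \<ge> 0" unfolding B_def by (auto intro!: add_nonneg_nonneg)
  have "\<forall>\<^sub>F x in nhds x0. x \<in> S" using S eventually_nhds by blast
  with ev[OF c(1)] ev[OF c(2)] ev[OF c(3)]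
  have "\<forall>\<^sub>F x in nhds x0. x \<in> S \<and> norm (f x) \<le> B \<and> norm (D1 x) \<le> B \<and> norm (D2 x) \<le> B"
    by eventually_elim (auto simp: B_def intro: add_nonneg_nonneg order_trans[OF less_imp_le])
  then obtain e where e: "e > 0"
    "\<And>x. x \<in> ball x0 e \<Longrightarrow> x \<in> S \<and> norm (f x) \<le> B \<and> norm (D1 x) \<le> B \<and> norm (D2 x) \<le> B"
    unfolding eventually_nhds_metric by (auto simp: dist_commute)
  have 1: "norm (D1 x v) \<le> B * norm v" if "x \<in> ball x0 e" for x v
    using norm_blinfun[of "D1 x" v] e(2)[OF that] mult_right_mono[of "norm (D1 x)" B "norm v"] by auto
  have 2: "norm (f y - f x - D1 x (y - x)) \<le> B * (norm (y - x))\<^sup>2"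
    if "x \<in> ball x0 e" "y \<in> ball x0 e" for x y
    using D e that by (intro linearization_error_convex[of "ball x0 e" f D1 D2]) auto
  show ?thesis
    using e B0 1 2 eq by (intro exI[of _ e] exI[of _ B]) auto
qed

section \<open>Charts, tangent vectors and gradients\<close>

lemma smooth_on_imp_continuous_on: "smooth_on S f \<Longrightarrow> continuous_on S f"
  unfolding smooth_on_def using Ck_on.simps(1) by blast

lemma smooth_on_imp_differentiable: "smooth_on S f \<Longrightarrow> x \<in> S \<Longrightarrow> f differentiable (at x)"
  unfolding smooth_on_def using Ck_on.simps(2) by blast

locale riemannian =
  fixes A :: "('p::{t2_space,second_countable_topology}, 'e::euclidean_space) chart set"
    and g :: "('p, 'e) metric_tensor"
  assumes manifold: "compact_riemannian_manifold A g"
begin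

lemma compact_UNIV: "compact (UNIV :: 'p set)"
  using manifold by (simp add: compact_riemannian_manifold_def)

lemma is_chart: "c \<in> A \<Longrightarrow> is_chart c"
  using manifold by (simp add: compact_riemannian_manifold_def smooth_atlas_def)

lemma chart_exists: "\<exists>c\<in>A. p \<in> fst c"
  using manifold by (auto simp: compact_riemannian_manifold_def smooth_atlas_def)

lemma riemannian_metric: "riemannian_metric A g"
  using manifold by (simp add: compact_riemannian_manifold_def)

lemma open_chart: "c \<in> A \<Longrightarrow> open (fst c)" and open_chart_range: "c \<in> A \<Longrightarrow> open (chart_range c)"
  using is_chart by (auto simp: is_chart_def)

lemma homeomorphism_chart:
  "c \<in> A \<Longrightarrow> homeomorphism (fst c) (chart_range c) (snd c) (chart_inv c)"
  using is_chart by (auto simp: is_chart_def)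

lemma chart_in_range: "c \<in> A \<Longrightarrow> p \<in> fst c \<Longrightarrow> snd c p \<in> chart_range c"
  by (simp add: chart_range_def)

lemma chart_inv_in: "c \<in> A \<Longrightarrow> x \<in> chart_range c \<Longrightarrow> chart_inv c x \<in> fst c"
  using homeomorphism_chart homeomorphism_image2 by blast

lemma chart_inv_chart [simp]: "c \<in> A \<Longrightarrow> p \<in> fst c \<Longrightarrow> chart_inv c (snd c p) = p"
  using homeomorphism_chart homeomorphism_apply1 by blast

lemma chart_chart_inv [simp]: "c \<in> A \<Longrightarrow> x \<in> chart_range c \<Longrightarrow> snd c (chart_inv c x) = x"
  using homeomorphism_chart homeomorphism_apply2 by blast

lemma continuous_on_chart: "c \<in> A \<Longrightarrow> continuous_on (fst c) (snd c)"
  and continuous_on_chart_inv: "c \<in> A \<Longrightarrow> continuous_on (chart_range c) (chart_inv c)"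
  using homeomorphism_chart homeomorphism_cont1 homeomorphism_cont2 by blast+

lemma open_chart_preimage:
  assumes "c \<in> A" "open U" shows "open {x \<in> chart_range c. chart_inv c x \<in> U}"
proof -
  have "{x \<in> chart_range c. chart_inv c x \<in> U} = chart_range c \<inter> chart_inv c -` U" by auto
  then show ?thesis
    using continuous_on_chart_inv[OF assms(1)] open_chart_range[OF assms(1)] assms(2)
    by (simp add: continuous_on_open_vimage Int_commute)
qed

lemma open_coordinate_preimage:
  assumes "c \<in> A" "open U" shows "open {p \<in> fst c. snd c p \<in> U}"
proof -
  have "{p \<in> fst c. snd c p \<in> U} = fst c \<inter> snd c -` U" by auto
  then show ?thesis
    using continuous_on_chart[OF assms(1)] open_chart[OF assms(1)] assms(2)
    by (simp add: continuous_on_open_vimage Int_commute)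
qed

abbreviation "chart_deriv c \<psi> p \<equiv> frechet_derivative (\<psi> \<circ> chart_inv c) (at (snd c p))"

abbreviation "transition_deriv c c' p \<equiv> chart_deriv c (snd c') p"

lemma transition_has_derivative:
  assumes "c \<in> A" "c' \<in> A" "p \<in> fst c" "p \<in> fst c'"
  shows "((snd c' \<circ> chart_inv c) has_derivative transition_deriv c c' p) (at (snd c p))"
proof -
  have "smooth_compatible c c'"
    using manifold assms by (simp add: compact_riemannian_manifold_def smooth_atlas_def)
  then have "(snd c' \<circ> chart_inv c) differentiable (at (snd c p))"
    using assms unfolding smooth_compatible_def by (blast intro: smooth_on_imp_differentiable)
  then show ?thesis by (simp add: frechet_derivative_works)
qed

text \<open>Factoring through a transition map is valid only where both charts are defined. That
  overlap is open in coordinates, and derivatives are local.\<close>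

lemma chart_has_derivative_chain:
  fixes \<psi> :: "'p \<Rightarrow> 'b::real_normed_vector"
  assumes c: "c \<in> A" "c' \<in> A" "p \<in> fst c" "p \<in> fst c'"
    and d: "(\<psi> \<circ> chart_inv c') differentiable (at (snd c' p))"
  shows "((\<psi> \<circ> chart_inv c) has_derivative (\<lambda>v. chart_deriv c' \<psi> p (transition_deriv c c' p v))) (at (snd c p))"
proof -
  have "((\<psi> \<circ> chart_inv c') has_derivative chart_deriv c' \<psi> p) (at ((snd c' \<circ> chart_inv c) (snd c p)))"
    using d c by (simp add: frechet_derivative_works)
  from diff_chain_at[OF transition_has_derivative[OF c] this]
  have "((\<psi> \<circ> chart_inv c') \<circ> (snd c' \<circ> chart_inv c) has_derivative
      chart_deriv c' \<psi> p \<circ> transition_deriv c c' p) (at (snd c p))" .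
  moreover have "open {x \<in> chart_range c. chart_inv c x \<in> fst c'}"
    using c by (intro open_chart_preimage open_chart)
  ultimately have "(\<psi> \<circ> chart_inv c has_derivative chart_deriv c' \<psi> p \<circ> transition_deriv c c' p) (at (snd c p))"
    by (rule has_derivative_transform_within_open) (use c chart_in_range in auto)
  then show ?thesis by (simp add: comp_def)
qed

lemma chart_deriv_chain:
  fixes \<psi> :: "'p \<Rightarrow> 'b::real_normed_vector"
  assumes "c \<in> A" "c' \<in> A" "p \<in> fst c" "p \<in> fst c'"
    and "(\<psi> \<circ> chart_inv c') differentiable (at (snd c' p))"
  shows "chart_deriv c \<psi> p v = chart_deriv c' \<psi> p (transition_deriv c c' p v)"
  using frechet_derivative_at[OF chart_has_derivative_chain[OF assms]] by metis

text \<open>The chain rule for the coordinate map of \<open>c''\<close>. It is what makes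
  \<open>tvec_of\<close> a family compatible with all transitions.\<close>

lemma transition_cocycle:
  assumes "c \<in> A" "c' \<in> A" "c'' \<in> A" "p \<in> fst c" "p \<in> fst c'" "p \<in> fst c''"
  shows "transition_deriv c c'' p v = transition_deriv c' c'' p (transition_deriv c c' p v)"
  using assms transition_has_derivative[of c' c'' p]
  by (intro chart_deriv_chain) (auto intro: differentiableI)

lemma transition_self:
  assumes c: "c \<in> A" "p \<in> fst c"
  shows "transition_deriv c c p v = v"
proof -
  have "((snd c \<circ> chart_inv c) has_derivative (\<lambda>v. v)) (at (snd c p))"
    by (rule has_derivative_transform_within_open[OF has_derivative_ident open_chart_range[OF c(1)]])
      (use c chart_in_range in auto)
  then show ?thesis using frechet_derivative_at by metis
qed

lemma linear_transition:
  "c \<in> A \<Longrightarrow> c' \<in> A \<Longrightarrow> p \<in> fst c \<Longrightarrow> p \<in> fst c' \<Longrightarrow> linear (transition_deriv c c' p)"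
  using transition_has_derivative has_derivative_linear by blast

lemma tvec_of_in_tangent_space [simp]:
  assumes "c \<in> A" "p \<in> fst c" shows "tvec_of A c p v \<in> tangent_space A p"
  unfolding tangent_space_def
proof (intro CollectI conjI allI ballI impI)
  fix c' c'' assume "c' \<in> A" "c'' \<in> A" "p \<in> fst c' \<and> p \<in> fst c''"
  then show "tvec_of A c p v c'' = transition_deriv c' c'' p (tvec_of A c p v c')"
    using assms transition_cocycle[of c c' c'' p v] by (simp add: tvec_of_def)
qed (auto simp: tvec_of_def)

lemma tvec_of_apply [simp]:
  assumes "c \<in> A" "p \<in> fst c" shows "tvec_of A c p v c = v"
  using assms by (simp add: tvec_of_def transition_self)

lemma tangent_space_transition:
  assumes "X \<in> tangent_space A p" "c \<in> A" "c' \<in> A" "p \<in> fst c" "p \<in> fst c'"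
  shows "transition_deriv c c' p (X c) = X c'"
proof -
  have "\<forall>c\<in>A. \<forall>c'\<in>A. p \<in> fst c \<and> p \<in> fst c' \<longrightarrow> X c' = transition_deriv c c' p (X c)"
    using assms(1) unfolding tangent_space_def mem_Collect_eq by (rule conjunct2)
  from this[rule_format, OF assms(2,3) conjI[OF assms(4,5)]] show ?thesis by (rule sym)
qed

text \<open>Together with \<open>tvec_of_apply\<close> this identifies the tangent space with the
  coordinate space of any single chart around \<open>p\<close>, so that computations can be done in
  one chart.\<close>

lemma tvec_of_tangent [simp]:
  assumes "c \<in> A" "p \<in> fst c" "X \<in> tangent_space A p" shows "tvec_of A c p (X c) = X"
proof
  fix c' show "tvec_of A c p (X c) c' = X c'"
  proof (cases "c' \<in> A \<and> p \<in> fst c'")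
    case True
    then have "transition_deriv c c' p (X c) = X c'" using assms True by (intro tangent_space_transition) auto
    then show ?thesis using True by (simp add: tvec_of_def)
  next
    case False
    then have "X c' = 0" using assms unfolding tangent_space_def by blast
    then show ?thesis using False by (simp only: tvec_of_def if_False)
  qed
qed

lemma tvec_of_lin:
  assumes "c \<in> A" "p \<in> fst c"
  shows "tvec_of A c p (a *\<^sub>R v + w) = add_tvec (scale_tvec a (tvec_of A c p v)) (tvec_of A c p w)"
  using assms linear_transition[of c _ p]
  by (auto intro!: ext simp: tvec_of_def add_tvec_def scale_tvec_def linear_add linear_scale)

lemma tvec_of_zero [simp]:
  assumes "c \<in> A" "p \<in> fst c" shows "tvec_of A c p 0 = zero_tvec"
  using assms linear_transition[of c _ p]
  by (auto intro!: ext simp: tvec_of_def zero_tvec_def linear_0)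

lemma scale_tvec_of:
  assumes "c \<in> A" "p \<in> fst c"
  shows "scale_tvec a (tvec_of A c p v) = tvec_of A c p (a *\<^sub>R v)"
  using assms linear_transition[of c _ p]
  by (auto intro!: ext simp: tvec_of_def scale_tvec_def linear_scale)

lemma scale_tvec_in_tangent_space:
  assumes "X \<in> tangent_space A p" shows "scale_tvec a X \<in> tangent_space A p"
proof -
  obtain c where c: "c \<in> A" "p \<in> fst c" using chart_exists by blast
  then show ?thesis using assms scale_tvec_of[OF c, of a "X c"] by simp
qed

lemma metric_in_chart:
  assumes "c \<in> A" "p \<in> fst c"
  shows "metric_in A g c (snd c p) v w = g p (tvec_of A c p v) (tvec_of A c p w)"
  using assms by (simp add: metric_in_def)

lemma bilinear_metric_in:
  assumes "c \<in> A" "x \<in> chart_range c"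
  shows "linear (metric_in A g c x v)" "linear (\<lambda>u. metric_in A g c x u v)"
    "metric_in A g c x v w = metric_in A g c x w v"
proof -
  let ?p = "chart_inv c x"
  have p: "?p \<in> fst c" using assms by (rule chart_inv_in)
  note T = tvec_of_in_tangent_space[OF assms(1) p]
  have sym: "metric_in A g c x v w = metric_in A g c x w v" for v w
    using riemannian_metric T unfolding riemannian_metric_def metric_in_def by blast
  have lin: "metric_in A g c x (a *\<^sub>R v + w) u = a * metric_in A g c x v u + metric_in A g c x w u" for a v w u
    using riemannian_metric T unfolding riemannian_metric_def metric_in_def tvec_of_lin[OF assms(1) p] by blast
  have z: "metric_in A g c x 0 u = 0" for u using lin[of 1 0 0 u] by simp
  show "linear (\<lambda>u. metric_in A g c x u v)" for v
    using lin[of 1 _ _ v] lin[of _ _ 0 v] z by (intro linearI) auto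
  moreover have "metric_in A g c x v = (\<lambda>u. metric_in A g c x u v)" using sym by auto
  ultimately show "linear (metric_in A g c x v)" by metis
  show "metric_in A g c x v w = metric_in A g c x w v" by (rule sym)
qed

lemma metric_in_pos:
  assumes "c \<in> A" "x \<in> chart_range c" "v \<noteq> 0"
  shows "metric_in A g c x v v > 0"
proof -
  let ?p = "chart_inv c x"
  have p: "?p \<in> fst c" using assms chart_inv_in by blast
  have "tvec_of A c ?p v \<noteq> zero_tvec"
    using assms tvec_of_apply[OF assms(1) p, of v] by (auto simp: zero_tvec_def)
  then show ?thesis
    using riemannian_metric tvec_of_in_tangent_space[OF assms(1) p]
    unfolding riemannian_metric_def metric_in_def by blast
qed

lemma continuous_on_metric_in:
  "c \<in> A \<Longrightarrow> continuous_on (chart_range c) (\<lambda>x. metric_in A g c x v w)"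
  using riemannian_metric unfolding riemannian_metric_def by (blast intro: smooth_on_imp_continuous_on)

text \<open>Smoothness of the metric is given for fixed coordinate vectors; expanding in the basis
  leads to joint continuity in the point and both vectors.\<close>

lemma metric_in_Basis:
  assumes "c \<in> A" "x \<in> chart_range c"
  shows "metric_in A g c x v w = (\<Sum>i\<in>Basis. \<Sum>j\<in>Basis. (v \<bullet> i) * (w \<bullet> j) * metric_in A g c x i j)"
proof -
  have "metric_in A g c x v w = metric_in A g c x (\<Sum>i\<in>Basis. (v \<bullet> i) *\<^sub>R i) w" by (simp add: euclidean_representation)
  also have "\<dots> = (\<Sum>i\<in>Basis. (v \<bullet> i) * metric_in A g c x i w)"
    by (simp add: linear_sum[OF bilinear_metric_in(2)[OF assms]] linear_scale[OF bilinear_metric_in(2)[OF assms]])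
  also have "\<dots> = (\<Sum>i\<in>Basis. (v \<bullet> i) * metric_in A g c x i (\<Sum>j\<in>Basis. (w \<bullet> j) *\<^sub>R j))" by (simp add: euclidean_representation)
  also have "\<dots> = (\<Sum>i\<in>Basis. (v \<bullet> i) * (\<Sum>j\<in>Basis. (w \<bullet> j) * metric_in A g c x i j))"
    by (simp only: linear_sum[OF bilinear_metric_in(1)[OF assms]] linear_scale[OF bilinear_metric_in(1)[OF assms]] real_scaleR_def)
  finally show ?thesis by (simp add: sum_distrib_left mult.assoc)
qed

lemma continuous_on_metric_in_compose:
  assumes "c \<in> A" "continuous_on S a" "continuous_on S v" "continuous_on S w"
    and "a ` S \<subseteq> chart_range c"
  shows "continuous_on S (\<lambda>z. metric_in A g c (a z) (v z) (w z))"
proof -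
  have "continuous_on S (\<lambda>z. metric_in A g c (a z) i j)" for i j
    using continuous_on_compose2[OF continuous_on_metric_in[OF assms(1)] assms(2) assms(5)] .
  then have "continuous_on S (\<lambda>z. \<Sum>i\<in>Basis. \<Sum>j\<in>Basis. (v z \<bullet> i) * (w z \<bullet> j) * metric_in A g c (a z) i j)"
    using assms by (intro continuous_intros)
  moreover have "metric_in A g c (a z) (v z) (w z) = (\<Sum>i\<in>Basis. \<Sum>j\<in>Basis. (v z \<bullet> i) * (w z \<bullet> j) * metric_in A g c (a z) i j)" if "z \<in> S" for z
    using assms that by (intro metric_in_Basis) auto
  ultimately show ?thesis by (simp cong: continuous_on_cong)
qed

text \<open>The minimum of the form over a compact neighbourhood times the unit sphere is attained,
  hence positive; homogeneity extends the bound from unit vectors to all vectors.\<close>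

lemma metric_in_coercive_near:
  assumes c: "c \<in> A" and x0: "x0 \<in> chart_range c"
  shows "\<exists>e>0. \<exists>k>0. ball x0 e \<subseteq> chart_range c \<and> (\<forall>x\<in>ball x0 e. \<forall>v. k * (norm v)\<^sup>2 \<le> metric_in A g c x v v)"
proof -
  obtain e where e: "e > 0" "cball x0 e \<subseteq> chart_range c"
    using open_chart_range[OF c] x0 open_contains_cball by blast
  let ?K = "cball x0 e \<times> sphere (0::'e) 1"
  obtain b :: 'e where b: "b \<in> Basis" using nonempty_Basis by blast
  have "continuous_on ?K (\<lambda>z. metric_in A g c (fst z) (snd z) (snd z))"
    using e by (intro continuous_on_metric_in_compose[OF c] continuous_intros) auto
  moreover have "compact ?K" by (intro compact_Times) auto
  moreover have "(x0, b) \<in> ?K" using e b by auto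
  ultimately obtain z where z: "z \<in> ?K"
    "\<And>y. y \<in> ?K \<Longrightarrow> metric_in A g c (fst z) (snd z) (snd z) \<le> metric_in A g c (fst y) (snd y) (snd y)"
    using continuous_attains_inf[of ?K "\<lambda>z. metric_in A g c (fst z) (snd z) (snd z)"] by blast
  define k where "k = metric_in A g c (fst z) (snd z) (snd z)"
  have k: "k > 0" unfolding k_def using z e by (intro metric_in_pos[OF c]) auto
  have "k * (norm v)\<^sup>2 \<le> metric_in A g c x v v" if x: "x \<in> ball x0 e" for x v
  proof (cases "v = 0")
    case True
    have "x \<in> chart_range c" using x e by auto
    then show ?thesis using linear_0[OF bilinear_metric_in(1)[OF c]] True by simp
  next
    case False
    have xr: "x \<in> chart_range c" using x e by auto
    note lin = linear_scale[OF bilinear_metric_in(1)[OF c xr]] linear_scale[OF bilinear_metric_in(2)[OF c xr]]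
    have "k \<le> metric_in A g c x ((1 / norm v) *\<^sub>R v) ((1 / norm v) *\<^sub>R v)"
      using z(2)[of "(x, (1 / norm v) *\<^sub>R v)"] x False by (simp add: k_def)
    also have "\<dots> = metric_in A g c x v v / (norm v)\<^sup>2"
      unfolding lin by (simp add: power2_eq_square)
    finally show ?thesis using False by (simp add: field_simps)
  qed
  then show ?thesis using e k by (intro exI[of _ e] conjI exI[of _ k]) auto
qed

text \<open>Lowering the index with the metric is injective by positive definiteness, hence
  surjective in finite dimension, so the differential of \<open>u\<close> has a representing vector.
  It is constructed in one chart, and the chain rule carries the identity to all others. This is
  what gives the definite description \<open>mgrad\<close> a meaning.\<close>

lemma mgrad_exists:
  assumes u: "\<And>c x. c \<in> A \<Longrightarrow> x \<in> chart_range c \<Longrightarrow> (u \<circ> chart_inv c) differentiable (at x)"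
  shows "mgrad A g u p \<in> tangent_space A p \<and>
    (\<forall>Y\<in>tangent_space A p. \<forall>c\<in>A. p \<in> fst c \<longrightarrow> g p (mgrad A g u p) Y = chart_deriv c u p (Y c))"
proof -
  obtain c where c: "c \<in> A" "p \<in> fst c" using chart_exists by blast
  let ?x = "snd c p" and ?m = "metric_in A g c (snd c p)"
  have x: "?x \<in> chart_range c" using c chart_in_range by blast
  note lin = bilinear_metric_in[OF c(1) x]
  have "linear (\<lambda>v. \<Sum>b\<in>Basis. ?m v b *\<^sub>R b)" (is "linear ?G")
    by (intro linearI) (simp_all add: linear_add[OF lin(2)] linear_scale[OF lin(2)]
        scaleR_left_distrib sum.distrib scaleR_sum_right)
  moreover have "inj ?G"
  proof (subst linear_injective_0[OF calculation], intro allI impI)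
    fix v assume "?G v = 0"
    then have "?m v b = 0" if "b \<in> Basis" for b
      using inner_sum_left_Basis[OF that, of "?m v"] by simp
    then have "?m v v = 0" using linear_eq_0_on_span by (subst euclidean_representation[of v, symmetric], subst linear_sum[OF lin(1)]) (auto simp: linear_scale[OF lin(1)])
    then show "v = 0" using metric_in_pos[OF c(1) x, of v] by fastforce
  qed
  ultimately have "surj ?G" by (rule linear_inj_imp_surj)
  have hd: "(u \<circ> chart_inv c has_derivative chart_deriv c u p) (at ?x)"
    using u[OF c(1) x] by (simp add: frechet_derivative_works)
  obtain v where v: "(\<Sum>b\<in>Basis. chart_deriv c u p b *\<^sub>R b) = ?G v"
    using surjD[OF \<open>surj ?G\<close>] by (rule exE)
  have vb: "?m v b = chart_deriv c u p b" if "b \<in> Basis" for b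
    using v inner_sum_left_Basis[OF that, of "?m v"] inner_sum_left_Basis[OF that, of "chart_deriv c u p"] by simp
  have vw: "?m v w = chart_deriv c u p w" for w
    using linear_eq_stdbasis[OF lin(1) has_derivative_linear[OF hd] vb] by metis
  define X where "X = tvec_of A c p v"
  have X: "X \<in> tangent_space A p" using c by (simp add: X_def)
  have gX: "g p X Y = chart_deriv c' u p (Y c')"
    if Y: "Y \<in> tangent_space A p" and c': "c' \<in> A" "p \<in> fst c'" for Y c'
  proof -
    have "g p X Y = ?m v (Y c)" using c Y by (simp add: metric_in_chart X_def)
    also have "\<dots> = chart_deriv c' u p (transition_deriv c c' p (Y c))"
      unfolding vw using c c' u chart_in_range by (intro chart_deriv_chain) auto
    also have "transition_deriv c c' p (Y c) = Y c'"
      using Y c c' by (intro tangent_space_transition)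
    finally show ?thesis .
  qed
  have "\<exists>!X. X \<in> tangent_space A p \<and>
    (\<forall>Y\<in>tangent_space A p. \<forall>c\<in>A. p \<in> fst c \<longrightarrow> g p X Y = chart_deriv c u p (Y c))"
  proof (rule ex1I[of _ X])
    show "X \<in> tangent_space A p \<and>
      (\<forall>Y\<in>tangent_space A p. \<forall>c\<in>A. p \<in> fst c \<longrightarrow> g p X Y = chart_deriv c u p (Y c))"
      using X gX by blast
  next
    fix Z assume Z: "Z \<in> tangent_space A p \<and>
      (\<forall>Y\<in>tangent_space A p. \<forall>c\<in>A. p \<in> fst c \<longrightarrow> g p Z Y = chart_deriv c u p (Y c))"
    have eq: "?m (Z c) w = ?m v w" for w
    proof -
      have "?m (Z c) w = g p Z (tvec_of A c p w)" using c Z by (simp add: metric_in_chart)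
      also have "\<dots> = ?m v w" using Z c by (simp add: vw)
      finally show ?thesis .
    qed
    have "?m (Z c - v) (Z c - v) = 0" using eq[of "Z c - v"] by (simp add: linear_diff[OF lin(2)])
    then have "Z c = v" using metric_in_pos[OF c(1) x, of "Z c - v"] by fastforce
    then show "Z = X" using Z c by (auto simp: X_def)
  qed
  then show ?thesis unfolding mgrad_def by (rule theI')
qed

end

section \<open>Metric norms and continuity of the gradient\<close>

context riemannian
begin

lemma metric_tangent:
  assumes "c \<in> A" "p \<in> fst c" "X \<in> tangent_space A p" "Y \<in> tangent_space A p"
  shows "g p X Y = metric_in A g c (snd c p) (X c) (Y c)"
  using assms by (simp add: metric_in_chart)

lemma metric_in_nonneg:
  assumes "c \<in> A" "x \<in> chart_range c" shows "metric_in A g c x v v \<ge> 0"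
  using metric_in_pos[OF assms, of v] linear_0[OF bilinear_metric_in(1)[OF assms]] by (cases "v = 0") auto

lemma metric_nonneg:
  assumes "X \<in> tangent_space A p" shows "g p X X \<ge> 0"
proof -
  obtain c where c: "c \<in> A" "p \<in> fst c" using chart_exists by blast
  then show ?thesis using metric_tangent[OF c assms assms] metric_in_nonneg[OF c(1)] chart_in_range by metis
qed

lemma tnorm_nonneg: "X \<in> tangent_space A p \<Longrightarrow> tnorm g p X \<ge> 0"
  by (simp add: tnorm_def metric_nonneg)

lemma tnorm_square: "X \<in> tangent_space A p \<Longrightarrow> (tnorm g p X)\<^sup>2 = g p X X"
  by (simp add: tnorm_def metric_nonneg)

lemma metric_scale:
  assumes "X \<in> tangent_space A p" "Y \<in> tangent_space A p"
  shows "g p (scale_tvec a X) Y = a * g p X Y" "g p X (scale_tvec a Y) = a * g p X Y"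
proof -
  obtain c where c: "c \<in> A" "p \<in> fst c" using chart_exists by blast
  have x: "snd c p \<in> chart_range c" using c chart_in_range by blast
  note s = scale_tvec_in_tangent_space[OF assms(1), of a] scale_tvec_in_tangent_space[OF assms(2), of a]
  note lin = linear_scale[OF bilinear_metric_in(1)[OF c(1) x]] linear_scale[OF bilinear_metric_in(2)[OF c(1) x]]
  show "g p (scale_tvec a X) Y = a * g p X Y" "g p X (scale_tvec a Y) = a * g p X Y"
    using metric_tangent[OF c] s assms by (simp_all add: lin scale_tvec_def)
qed

lemma tnorm_scale:
  assumes "X \<in> tangent_space A p" shows "tnorm g p (scale_tvec a X) = \<bar>a\<bar> * tnorm g p X"
  using assms scale_tvec_in_tangent_space[OF assms, of a]
  by (simp add: tnorm_def metric_scale real_sqrt_mult mult.assoc[symmetric])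

lemma zero_tvec_in_tangent_space: "zero_tvec \<in> tangent_space A p"
  using chart_exists[of p] tvec_of_in_tangent_space tvec_of_zero by metis

lemma tnorm_zero [simp]: "tnorm g p zero_tvec = 0"
proof -
  have "scale_tvec 0 zero_tvec = (zero_tvec :: ('p,'e) tvec)" by (simp add: scale_tvec_def zero_tvec_def)
  then show ?thesis using tnorm_scale[OF zero_tvec_in_tangent_space, of p 0] by simp
qed

text \<open>Displacements are small in the metric norm, while Taylor expansions are taken in
  coordinates; coercivity lets the former control the latter uniformly in the base point.\<close>

lemma coords_le_tnorm_near:
  assumes c: "c \<in> A" "p \<in> fst c"
  shows "\<exists>U k. open U \<and> p \<in> U \<and> U \<subseteq> fst c \<and> k > 0 \<and>
    (\<forall>q\<in>U. \<forall>X\<in>tangent_space A q. norm (X c) \<le> k * tnorm g q X)"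
proof -
  obtain e k where ek: "e > 0" "k > 0" "ball (snd c p) e \<subseteq> chart_range c"
    "\<And>x v. x \<in> ball (snd c p) e \<Longrightarrow> k * (norm v)\<^sup>2 \<le> metric_in A g c x v v"
    using metric_in_coercive_near[OF c(1) chart_in_range[OF c]] by blast
  define U where "U = {q \<in> fst c. snd c q \<in> ball (snd c p) e}"
  have "norm (X c) \<le> (1 / sqrt k) * tnorm g q X" if q: "q \<in> U" and X: "X \<in> tangent_space A q" for q X
  proof -
    have "k * (norm (X c))\<^sup>2 \<le> (tnorm g q X)\<^sup>2"
      using ek(4)[of "snd c q" "X c"] q c metric_tangent[OF c(1) _ X X] by (simp add: tnorm_square[OF X] U_def)
    then have "sqrt (k * (norm (X c))\<^sup>2) \<le> sqrt ((tnorm g q X)\<^sup>2)" by (rule real_sqrt_le_mono)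
    then have "sqrt k * norm (X c) \<le> tnorm g q X" using tnorm_nonneg[OF X] by (simp add: real_sqrt_mult)
    then show ?thesis using ek by (simp add: field_simps)
  qed
  moreover have "open U" unfolding U_def using c by (intro open_coordinate_preimage) auto
  moreover have "p \<in> U" using c ek by (simp add: U_def)
  moreover have "U \<subseteq> fst c" by (auto simp: U_def)
  ultimately show ?thesis using ek by (intro exI[of _ U] exI[of _ "1 / sqrt k"]) auto
qed

text \<open>The regularity under which \<open>mgrad\<close> exists and varies continuously.
  Coordinates are finite-dimensional, so continuity direction by direction is enough.\<close>

definition C1_function :: "('p \<Rightarrow> real) \<Rightarrow> bool" where
  "C1_function u \<longleftrightarrow> (\<forall>c\<in>A. \<forall>x\<in>chart_range c. (u \<circ> chart_inv c) differentiable (at x)) \<and>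
    (\<forall>c\<in>A. \<forall>v. continuous_on (chart_range c) (\<lambda>x. frechet_derivative (u \<circ> chart_inv c) (at x) v))"

context
  fixes u assumes u: "C1_function u"
begin

lemma mgrad_in_tangent_space: "mgrad A g u p \<in> tangent_space A p"
  using mgrad_exists[of u p] u by (simp add: C1_function_def)

lemma metric_mgrad:
  assumes "c \<in> A" "p \<in> fst c" "Y \<in> tangent_space A p"
  shows "g p (mgrad A g u p) Y = chart_deriv c u p (Y c)"
  using mgrad_exists[of u p] u assms by (simp add: C1_function_def)

lemma metric_in_mgrad:
  assumes "c \<in> A" "p \<in> fst c"
  shows "metric_in A g c (snd c p) (mgrad A g u p c) w = chart_deriv c u p w"
  using metric_mgrad[OF assms tvec_of_in_tangent_space[OF assms, of w]] assms
    metric_tangent[OF assms mgrad_in_tangent_space tvec_of_in_tangent_space[OF assms, of w]] by simp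

text \<open>Coercivity replaces the inversion of the metric coefficients. Let \<open>d\<close> be
  the change of the gradient coordinates from \<open>x0\<close> to \<open>x\<close>. The form at
  \<open>x\<close> on \<open>d\<close> equals \<open>F d\<close>, the defect with which the gradient
  coordinates at \<open>x0\<close> represent the differential at \<open>x\<close>. This defect is at
  most \<open>E x * norm d\<close>, and \<open>E\<close> is continuous and vanishes at
  \<open>x0\<close>.\<close>

lemma continuous_on_mgrad_coords:
  assumes c: "c \<in> A"
  shows "continuous_on (fst c) (\<lambda>p. mgrad A g u p c)"
proof -
  let ?V = "\<lambda>x. mgrad A g u (chart_inv c x) c"
  let ?D = "\<lambda>x. frechet_derivative (u \<circ> chart_inv c) (at x)"
  let ?m = "metric_in A g c"
  have mV: "?m x (?V x) w = ?D x w" if "x \<in> chart_range c" for x w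
    using metric_in_mgrad[OF c chart_inv_in[OF c that]] c that by simp
  have "isCont ?V x0" if x0: "x0 \<in> chart_range c" for x0
  proof -
    obtain e k where ek: "e > 0" "k > 0" "ball x0 e \<subseteq> chart_range c"
      "\<And>x v. x \<in> ball x0 e \<Longrightarrow> k * (norm v)\<^sup>2 \<le> ?m x v v"
      using metric_in_coercive_near[OF c x0] by blast
    define E where "E x = (\<Sum>b\<in>Basis. \<bar>?D x b - ?m x (?V x0) b\<bar>)" for x
    have "continuous_on (chart_range c) E"
      unfolding E_def using u c by (intro continuous_intros continuous_on_metric_in) (auto simp: C1_function_def)
    then have "isCont E x0" using x0 open_chart_range[OF c] continuous_on_eq_continuous_at by blast
    moreover have "E x0 = 0" using mV[OF x0] by (simp add: E_def)
    ultimately have E: "((\<lambda>x. E x / k) \<longlongrightarrow> 0) (at x0)" using ek by (auto simp: isCont_def intro!: tendsto_eq_intros)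
    have "norm (?V x - ?V x0) \<le> E x / k" if x: "x \<in> ball x0 e" for x
    proof -
      define d where "d = ?V x - ?V x0"
      have xr: "x \<in> chart_range c" using x ek by auto
      note lin = bilinear_metric_in[OF c xr]
      define F where "F w = ?D x w - ?m x (?V x0) w" for w
      have "bounded_linear (?D x)"
        using u c xr by (intro has_derivative_bounded_linear[of "u \<circ> chart_inv c" _ "at x"])
          (auto simp: C1_function_def frechet_derivative_works)
      moreover have "bounded_linear (?m x (?V x0))"
        using lin(1) by (simp add: linear_conv_bounded_linear)
      ultimately have F: "bounded_linear F" unfolding F_def by (rule bounded_linear_sub)
      have "k * (norm d)\<^sup>2 \<le> ?m x d d" by (rule ek(4)[OF x])
      also have "\<dots> = F d" unfolding F_def mV[OF xr, symmetric] using linear_diff[OF lin(2)[where v = d], of "?V x" "?V x0"] by (simp add: d_def[symmetric])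
      also have "\<dots> \<le> E x * norm d"
        using norm_bounded_linear_le_Basis[OF F, of d] by (simp add: E_def F_def)
      finally have "norm d * (k * norm d) \<le> norm d * E x" by (simp add: power2_eq_square mult_ac)
      then have "k * norm d \<le> E x \<or> d = 0" by (auto simp: mult_le_cancel_left)
      moreover have "E x \<ge> 0" unfolding E_def by (intro sum_nonneg) auto
      ultimately show ?thesis using ek by (auto simp: d_def[symmetric] field_simps)
    qed
    then have "\<forall>\<^sub>F x in at x0. norm (?V x - ?V x0) \<le> E x / k"
      using eventually_at_ball[OF ek(1), of x0 UNIV] by (auto elim!: eventually_mono)
    then have "((\<lambda>x. ?V x - ?V x0) \<longlongrightarrow> 0) (at x0)" using E by (rule Lim_null_comparison)
    then show ?thesis by (simp add: isCont_def LIM_zero_iff)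
  qed
  then have "continuous_on (chart_range c) ?V" by (simp add: continuous_at_imp_continuous_on)
  from continuous_on_compose2[OF this continuous_on_chart[OF c]]
  have "continuous_on (fst c) (\<lambda>p. ?V (snd c p))" using c chart_in_range by blast
  then show ?thesis using c by (simp cong: continuous_on_cong)
qed

lemma continuous_on_tnorm_mgrad: "continuous_on UNIV (\<lambda>p. (tnorm g p (mgrad A g u p))\<^sup>2)"
proof (rule continuous_at_imp_continuous_on, rule ballI)
  fix p
  obtain c where c: "c \<in> A" "p \<in> fst c" using chart_exists by blast
  have "continuous_on (fst c) (\<lambda>p. metric_in A g c (snd c p) (mgrad A g u p c) (mgrad A g u p c))"
    using c chart_in_range[OF c(1)]
    by (intro continuous_on_metric_in_compose continuous_on_mgrad_coords continuous_on_chart) auto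
  moreover have "(tnorm g p (mgrad A g u p))\<^sup>2 = metric_in A g c (snd c p) (mgrad A g u p c) (mgrad A g u p c)"
    if "p \<in> fst c" for p
    using metric_tangent[OF c(1) that] mgrad_in_tangent_space by (simp add: tnorm_square[OF mgrad_in_tangent_space])
  ultimately have "continuous_on (fst c) (\<lambda>p. (tnorm g p (mgrad A g u p))\<^sup>2)"
    by (simp cong: continuous_on_cong)
  then show "isCont (\<lambda>p. (tnorm g p (mgrad A g u p))\<^sup>2) p"
    using c open_chart[OF c(1)] by (simp add: continuous_on_eq_continuous_at)
qed

end

end

section \<open>Continuity and local expansion of the retraction at radius 1\<close>

locale cone_retraction_data = riemannian A g
  for A :: "('p::{t2_space,second_countable_topology}, 'e::euclidean_space) chart set"
    and g :: "('p, 'e) metric_tensor" +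
  fixes Ret :: "('p, 'e) cone_map" and C :: real and vertex :: "'p \<Rightarrow> ('p, 'e) tvec \<Rightarrow> 'p"
  assumes C_pos: "C > 0"
    and ret_pos: "\<And>r \<theta> s X. ret_domain A g C r \<theta> s X \<Longrightarrow> fst (Ret (r, \<theta>) (s, X)) > 0"
    and ret_smooth: "ret_smooth A g C Ret"
    and ret_zero: "\<And>r \<theta>. r > 0 \<Longrightarrow> Ret (r, \<theta>) (0, zero_tvec) = (r, \<theta>)"
    and ret_derivative: "\<And>r \<theta> c. r > 0 \<Longrightarrow> c \<in> A \<Longrightarrow> \<theta> \<in> fst c \<Longrightarrow>
      ((\<lambda>(s, v). (fst (Ret (r, \<theta>) (s, tvec_of A c \<theta> v)), snd c (snd (Ret (r, \<theta>) (s, tvec_of A c \<theta> v)))))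
        has_derivative (\<lambda>w. w)) (at (0, 0))"
    and vertex_measurable: "tangent_bundle_measurable A vertex"
    and ret_vertex: "\<And>\<theta> s X. X \<in> tangent_space A \<theta> \<Longrightarrow> Ret (0, \<theta>) (s, X) = (0, vertex \<theta> X)"
    and ret_homogeneous: "\<And>r r' \<theta> s X. r > 0 \<Longrightarrow> r' > 0 \<Longrightarrow> X \<in> tangent_space A \<theta> \<Longrightarrow>
      max \<bar>s\<bar> (tnorm g \<theta> X) < C \<Longrightarrow>
      snd (Ret (r, \<theta>) (r * s, X)) = snd (Ret (r', \<theta>) (r' * s, X)) \<and>
      r' * fst (Ret (r, \<theta>) (r * s, X)) = r * fst (Ret (r', \<theta>) (r' * s, X))"
begin

lemma ret_local:
  assumes "c \<in> A" "c' \<in> A"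
  shows "open (ret_local_domain A g C Ret c c')"
    "smooth_on (ret_local_domain A g C Ret c c') (ret_local_rep A Ret c c')"
  using ret_smooth assms by (auto simp: ret_smooth_def)

text \<open>Smoothness is available only through one chart at the base point and another at the
  image. The set \<open>W\<close> where both charts are valid is the preimage of the open local
  domain under the continuous map \<open>?z\<close>, so it is open before anything is known about
  continuity of the image.\<close>

lemma continuous_on_ret:
  assumes s: "continuous_on UNIV s" "\<And>\<theta>. \<bar>s \<theta>\<bar> < C"
    and X: "\<And>\<theta>. X \<theta> \<in> tangent_space A \<theta>" "\<And>c. c \<in> A \<Longrightarrow> continuous_on (fst c) (\<lambda>\<theta>. X \<theta> c)"
      "\<And>\<theta>. tnorm g \<theta> (X \<theta>) < C"
  shows "continuous_on UNIV (\<lambda>\<theta>. Ret (1, \<theta>) (s \<theta>, X \<theta>))"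
proof (rule continuous_at_imp_continuous_on, rule ballI)
  fix p
  let ?y = "\<lambda>\<theta>. Ret (1, \<theta>) (s \<theta>, X \<theta>)"
  obtain c where c: "c \<in> A" "p \<in> fst c" using chart_exists by blast
  obtain c' where c': "c' \<in> A" "snd (?y p) \<in> fst c'" using chart_exists by blast
  let ?D = "ret_local_domain A g C Ret c c'" and ?Q = "ret_local_rep A Ret c c'"
  let ?z = "\<lambda>\<theta>. (1::real, snd c \<theta>, s \<theta>, X \<theta> c)"
  have D: "?z \<theta> \<in> ?D \<longleftrightarrow> snd (?y \<theta>) \<in> fst c'" if "\<theta> \<in> fst c" for \<theta>
    using c that s X chart_in_range[OF c(1) that] by (simp add: ret_local_domain_def ret_domain_def)
  have zc: "continuous_on (fst c) ?z"
    using c s X by (intro continuous_intros continuous_on_chart) (auto intro: continuous_on_subset)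
  define W where "W = {\<theta> \<in> fst c. ?z \<theta> \<in> ?D}"
  have "W = ?z -` ?D \<inter> fst c" by (auto simp: W_def)
  then have W: "open W"
    using continuous_on_open_vimage[OF open_chart[OF c(1)], THEN iffD1, OF zc] ret_local(1)[OF c(1) c'(1)] by simp
  have pW: "p \<in> W" using c c' D by (simp add: W_def)
  have Qc: "continuous_on W (\<lambda>\<theta>. ?Q (?z \<theta>))"
  proof (rule continuous_on_compose2[OF smooth_on_imp_continuous_on[OF ret_local(2)[OF c(1) c'(1)]]])
    show "continuous_on W ?z" by (rule continuous_on_subset[OF zc]) (auto simp: W_def)
  qed (auto simp: W_def)
  have Q: "?Q (?z \<theta>) = (fst (?y \<theta>), snd c' (snd (?y \<theta>)))" if "\<theta> \<in> fst c" for \<theta>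
    using c that X by (simp add: ret_local_rep_def Let_def)
  have "continuous_on W (\<lambda>\<theta>. (fst (?Q (?z \<theta>)), chart_inv c' (snd (?Q (?z \<theta>)))))"
    using c' D Q
    by (intro continuous_on_Pair continuous_on_fst continuous_on_snd Qc continuous_on_compose2[OF continuous_on_chart_inv[OF c'(1)]])
      (auto simp: W_def chart_in_range)
  moreover have "(fst (?Q (?z \<theta>)), chart_inv c' (snd (?Q (?z \<theta>)))) = ?y \<theta>" if "\<theta> \<in> W" for \<theta>
    using that D Q c' by (auto simp: W_def)
  ultimately have "continuous_on W ?y" by (simp cong: continuous_on_cong)
  then show "isCont ?y p" using W pW by (simp add: continuous_on_eq_continuous_at)
qed

text \<open>Taylor expansion at the points \<open>(1, x, 0, 0)\<close>, where the retraction is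
  trivial. As \<open>x\<close> is itself a variable of the smooth local representative,
  \<open>e\<close> and \<open>B\<close> are uniform over base points near \<open>p\<close>.\<close>

lemma ret_expansion_near:
  assumes c: "c \<in> A" "p \<in> fst c"
  shows "\<exists>e>0. \<exists>B\<ge>0. ball (snd c p) e \<subseteq> chart_range c \<and>
    (\<forall>x\<in>ball (snd c p) e. \<forall>s v. \<bar>s\<bar> < e \<longrightarrow> norm v < e \<longrightarrow>
      (let y = Ret (1, chart_inv c x) (s, tvec_of A c (chart_inv c x) v) in
        snd y \<in> fst c \<and> \<bar>fst y - 1 - s\<bar> \<le> B * (s\<^sup>2 + (norm v)\<^sup>2) \<and>
        norm (snd c (snd y) - x - v) \<le> B * (s\<^sup>2 + (norm v)\<^sup>2)))"
proof -
  let ?D = "ret_local_domain A g C Ret c c" and ?Q = "ret_local_rep A Ret c c"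
  let ?z0 = "(1::real, snd c p, 0::real, 0::'e)"
  have z: "(1, x, 0, 0) \<in> ?D \<and> ?Q (1, x, 0, 0) = (1, x)" if "x \<in> chart_range c" for x
    using c that chart_inv_in[OF c(1) that] C_pos zero_tvec_in_tangent_space
    by (simp add: ret_local_domain_def ret_domain_def ret_local_rep_def ret_zero Let_def)
  have z0: "?z0 \<in> ?D" using z chart_in_range[OF c] by blast
  have Ck: "Ck_on (Suc (Suc 0)) ?D ?Q" using ret_local(2)[OF c(1) c(1)] by (simp add: smooth_on_def del: Ck_on.simps)
  obtain e B where eB: "e > 0" "B \<ge> 0" "ball ?z0 e \<subseteq> ?D"
    "\<And>z z'. z \<in> ball ?z0 e \<Longrightarrow> z' \<in> ball ?z0 e \<Longrightarrow>
      norm (?Q z' - ?Q z - frechet_derivative ?Q (at z) (z' - z)) \<le> B * (norm (z' - z))\<^sup>2"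
    using Ck2_linearization_error_near[OF Ck ret_local(1)[OF c(1) c(1)] z0] by blast
  \<comment> \<open>The norm of a tuple is at most the sum of the norms of its components, and three
    components can differ from those of \<open>?z0\<close>.\<close>
  have in_ball: "(1, x, s, v) \<in> ball ?z0 e" if "x \<in> ball (snd c p) (e/3)" "\<bar>s\<bar> < e/3" "norm v < e/3" for x s v
  proof -
    have "norm ((1, x, s, v) - ?z0) \<le> norm (x - snd c p) + (\<bar>s\<bar> + norm v)"
      using norm_Pair_le[of "0::real" "(x - snd c p, s, v)"] norm_Pair_le[of "x - snd c p" "(s, v)"] norm_Pair_le[of s v]
      by simp
    moreover have "norm (x - snd c p) < e / 3" using that by (simp add: dist_norm norm_minus_commute)
    ultimately have "dist (1, x, s, v) ?z0 < e" using that unfolding dist_norm by linarith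
    then show ?thesis by (simp only: mem_ball dist_commute)
  qed
  have sub: "ball (snd c p) (e/3) \<subseteq> chart_range c"
  proof
    fix x assume "x \<in> ball (snd c p) (e/3)"
    then have "(1, x, 0, 0) \<in> ?D" using in_ball[of x 0 0] eB by auto
    then show "x \<in> chart_range c" by (simp add: ret_local_domain_def)
  qed
  have main: "let y = Ret (1, chart_inv c x) (s, tvec_of A c (chart_inv c x) v) in
        snd y \<in> fst c \<and> \<bar>fst y - 1 - s\<bar> \<le> B * (s\<^sup>2 + (norm v)\<^sup>2) \<and>
        norm (snd c (snd y) - x - v) \<le> B * (s\<^sup>2 + (norm v)\<^sup>2)"
    if x: "x \<in> ball (snd c p) (e/3)" and s: "\<bar>s\<bar> < e/3" and v: "norm v < e/3" for x s v
  proof -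
    define y where "y = Ret (1, chart_inv c x) (s, tvec_of A c (chart_inv c x) v)"
    have xr: "x \<in> chart_range c" using x sub by blast
    note zx = z[OF xr]
    have b0: "(1, x, 0, 0) \<in> ball ?z0 e" using in_ball[OF x, of 0 0] eB by auto
    have b1: "(1, x, s, v) \<in> ball ?z0 e" by (rule in_ball[OF x s v])
    \<comment> \<open>The derivative of \<open>?Q\<close> is known only in the directions
      \<open>(0, 0, s, v)\<close>: composing with the affine inclusion of displacements and
      uniqueness of derivatives show that it acts there as the identity.\<close>
    have "(?Q has_derivative frechet_derivative ?Q (at (1, x, 0, 0))) (at (1, x, 0, 0))"
      using Ck_on_Suc_has_derivative[OF Ck] zx by blast
    moreover have "((\<lambda>w. (1::real, x, w)) has_derivative (\<lambda>w. (0::real, 0::'e, w))) (at (0::real, 0::'e))"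
      by (auto intro!: derivative_eq_intros)
    ultimately have "((\<lambda>w. ?Q ((1::real, x, w))) has_derivative
        (\<lambda>w. frechet_derivative ?Q (at (1, x, 0, 0)) ((0::real, 0::'e, w)))) (at (0::real, 0::'e))"
      by (intro has_derivative_compose[of "\<lambda>w. (1::real, x, w)" _ "(0::real, 0::'e)" UNIV ?Q]) auto
    moreover have "((\<lambda>w. ?Q ((1::real, x, w))) has_derivative (\<lambda>w. w)) (at (0::real, 0::'e))"
      using ret_derivative[of 1 c "chart_inv c x"] c chart_inv_in[OF c(1) xr]
      by (simp add: ret_local_rep_def split_def Let_def)
    ultimately have "(\<lambda>w. frechet_derivative ?Q (at (1, x, 0, 0)) ((0::real, 0::'e, w))) = (\<lambda>w. w)"
      by (rule has_derivative_unique)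
    then have der: "frechet_derivative ?Q (at (1, x, 0, 0)) (0, 0, s, v) = (s, v)" by (metis case_prod_conv)
    have "(1, x, s, v) - (1, x, 0, 0) = (0::real, 0::'e, s, v)" by simp
    then have "norm (?Q (1, x, s, v) - (1, x) - (s, v)) \<le> B * (norm (0::real, 0::'e, s, v))\<^sup>2"
      using eB(4)[OF b0 b1] zx der by simp
    moreover have "?Q (1, x, s, v) = (fst y, snd c (snd y))" by (simp add: ret_local_rep_def y_def Let_def)
    moreover have "(norm (0::real, 0::'e, s, v))\<^sup>2 = s\<^sup>2 + (norm v)\<^sup>2" by (simp add: norm_Pair)
    ultimately have le: "norm (fst y - 1 - s, snd c (snd y) - x - v) \<le> B * (s\<^sup>2 + (norm v)\<^sup>2)" by simp
    have "\<bar>fst y - 1 - s\<bar> \<le> B * (s\<^sup>2 + (norm v)\<^sup>2)"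
      using norm_fst_le[of "fst y - 1 - s" "snd c (snd y) - x - v"] le by simp
    moreover have "norm (snd c (snd y) - x - v) \<le> B * (s\<^sup>2 + (norm v)\<^sup>2)"
      using norm_snd_le[of "snd c (snd y) - x - v" "fst y - 1 - s"] le by simp
    moreover have "snd y \<in> fst c" using b1 eB(3) by (auto simp: ret_local_domain_def y_def Let_def)
    ultimately show ?thesis by (simp add: y_def[symmetric])
  qed
  show ?thesis using eB(1,2) sub main by (intro exI[of _ "e/3"] conjI exI[of _ B]) auto
qed

end

section \<open>Uniform expansion of the retraction\<close>

text \<open>By \<open>anti\<close>, the constants of a finite subcover can all be lowered to their
  minimum.\<close>

lemma compact_space_uniform_constant:
  fixes P :: "real \<Rightarrow> 'p::topological_space \<Rightarrow> bool"
  assumes "compact (UNIV :: 'p set)"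
    and loc: "\<And>p. \<exists>U \<delta>. open U \<and> p \<in> U \<and> \<delta> > 0 \<and> (\<forall>q\<in>U. P \<delta> q)"
    and anti: "\<And>\<delta> \<delta>' q. P \<delta> q \<Longrightarrow> 0 < \<delta>' \<Longrightarrow> \<delta>' \<le> \<delta> \<Longrightarrow> P \<delta>' q"
  shows "\<exists>\<delta>>0. \<forall>q. P \<delta> q"
proof -
  obtain U \<delta> where U: "\<And>p. open (U p) \<and> p \<in> U p \<and> \<delta> p > 0 \<and> (\<forall>q\<in>U p. P (\<delta> p) q)"
    using loc by metis
  obtain K where K: "finite K" "UNIV \<subseteq> (\<Union>p\<in>K. U p)"
    by (rule compactE_image[OF assms(1), of UNIV U]) (use U in auto)
  define d where "d = Min (insert 1 (\<delta> ` K))"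
  have d: "d > 0" "\<And>p. p \<in> K \<Longrightarrow> d \<le> \<delta> p" unfolding d_def using K U by (auto simp: min_le_iff_disj)
  have "P d q" for q
  proof -
    obtain p where "p \<in> K" "q \<in> U p" using K by blast
    then show ?thesis using U[of p] d anti by blast
  qed
  then show ?thesis using d by blast
qed

text \<open>With \<open>a = \<rho> - 1 - s\<close> of order \<open>q\<close>, expanding the square
  leaves only terms of order \<open>q\<close> beyond \<open>1 + 2 * s\<close>. Since
  \<open>q \<le> 2\<close>, squares of \<open>q\<close> are again bounded by multiples of
  \<open>q\<close>, which is where the powers of \<open>B\<close> in the constants come
  from.\<close>

lemma weighted_expansion:
  fixes F :: "'e::real_normed_vector \<Rightarrow> 'b::real_normed_vector"
  assumes q: "q = s\<^sup>2 + (norm v)\<^sup>2" and small: "\<bar>s\<bar> \<le> 1" "norm v \<le> 1" and BP: "B \<ge> 0" "P \<ge> 0"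
    and \<rho>: "\<bar>\<rho> - 1 - s\<bar> \<le> B * q" and y: "norm (y - x - v) \<le> B * q"
    and L: "linear L" "\<And>w. norm (L w) \<le> P * norm w"
    and F: "norm (F y) \<le> P" "norm (F y - F x - L (y - x)) \<le> P * (norm (y - x))\<^sup>2"
  shows "\<bar>\<rho>\<^sup>2 - 1 - 2 * s\<bar> \<le> (1 + 4 * B + 2 * B\<^sup>2) * q"
    and "norm (\<rho>\<^sup>2 *\<^sub>R F y - F x - (2 * s) *\<^sub>R F x - L v) \<le> P * (8 + 7 * B + 14 * B\<^sup>2) * q"
proof -
  have s2: "s\<^sup>2 \<le> 1" "(norm v)\<^sup>2 \<le> 1" using small by (auto simp: abs_square_le_1 power_le_one)
  have q0: "q \<ge> 0" "q \<le> 2" "s\<^sup>2 \<le> q" "(norm v)\<^sup>2 \<le> q" unfolding q using s2 by (auto simp: add_nonneg_nonneg)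
  have Bq2: "(B * q)\<^sup>2 \<le> 2 * B\<^sup>2 * q"
  proof -
    have "B\<^sup>2 * q * q \<le> B\<^sup>2 * q * 2" using q0 by (intro mult_left_mono) auto
    then show ?thesis by (simp add: power_mult_distrib power2_eq_square mult_ac)
  qed
  define a where "a = \<rho> - 1 - s"
  have a: "\<bar>a\<bar> \<le> B * q" using \<rho> by (simp add: a_def)
  have a2: "a\<^sup>2 \<le> 2 * B\<^sup>2 * q" using power_mono[OF a, of 2] Bq2 by simp
  have "\<rho>\<^sup>2 - 1 - 2 * s = s\<^sup>2 + 2 * a * (1 + s) + a\<^sup>2"
    by (simp add: a_def power2_eq_square algebra_simps)
  also have "\<bar>\<dots>\<bar> \<le> s\<^sup>2 + \<bar>2 * a * (1 + s)\<bar> + a\<^sup>2"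
    using abs_triangle_ineq[of "s\<^sup>2 + 2 * a * (1 + s)" "a\<^sup>2"] abs_triangle_ineq[of "s\<^sup>2" "2 * a * (1 + s)"] by simp
  also have "\<bar>2 * a * (1 + s)\<bar> \<le> 4 * (B * q)"
  proof -
    have "\<bar>a\<bar> * \<bar>1 + s\<bar> \<le> B * q * 2" using a small BP q0 by (intro mult_mono) auto
    moreover have "\<bar>2 * a * (1 + s)\<bar> = 2 * (\<bar>a\<bar> * \<bar>1 + s\<bar>)" by (simp add: abs_mult)
    ultimately show ?thesis by linarith
  qed
  finally show 1: "\<bar>\<rho>\<^sup>2 - 1 - 2 * s\<bar> \<le> (1 + 4 * B + 2 * B\<^sup>2) * q"
    using a2 q0 by (simp add: algebra_simps)
  have "norm (y - x) \<le> norm v + B * q" using norm_triangle_ineq[of "y - x - v" v] y by simp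
  then have "(norm (y - x))\<^sup>2 \<le> (norm v + B * q)\<^sup>2" by (rule power_mono) simp
  also have "\<dots> \<le> 2 * (norm v)\<^sup>2 + 2 * (B * q)\<^sup>2"
    using sum_squares_bound[of "norm v" "B * q"] by (simp add: power2_sum)
  also have "\<dots> \<le> (2 + 4 * B\<^sup>2) * q" using Bq2 q0 by (simp add: algebra_simps)
  finally have yx: "(norm (y - x))\<^sup>2 \<le> (2 + 4 * B\<^sup>2) * q" .
  define E where "E = F y - F x - L v"
  have "E = (F y - F x - L (y - x)) + L (y - x - v)" by (simp add: E_def linear_diff[OF L(1)])
  then have "norm E \<le> norm (F y - F x - L (y - x)) + norm (L (y - x - v))" by (simp add: norm_triangle_ineq)
  also have "\<dots> \<le> P * ((2 + 4 * B\<^sup>2) * q) + P * (B * q)"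
    using F(2) L(2)[of "y - x - v"] mult_left_mono[OF yx BP(2)] mult_left_mono[OF y BP(2)] by linarith
  finally have E: "norm E \<le> P * (2 + 4 * B\<^sup>2 + B) * q" by (simp add: algebra_simps)
  \<comment> \<open>Every summand is of second order: the first two by the bounds above, the third
    because \<open>2 * \<bar>s\<bar> * norm v \<le> s\<^sup>2 + (norm v)\<^sup>2\<close>.\<close>
  have eq: "\<rho>\<^sup>2 *\<^sub>R F y - F x - (2 * s) *\<^sub>R F x - L v
      = (\<rho>\<^sup>2 - 1 - 2 * s) *\<^sub>R F y + (1 + 2 * s) *\<^sub>R E + (2 * s) *\<^sub>R L v"
    by (simp add: E_def algebra_simps)
  have "norm (\<rho>\<^sup>2 *\<^sub>R F y - F x - (2 * s) *\<^sub>R F x - L v)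
      \<le> norm ((\<rho>\<^sup>2 - 1 - 2 * s) *\<^sub>R F y) + norm ((1 + 2 * s) *\<^sub>R E) + norm ((2 * s) *\<^sub>R L v)"
    unfolding eq using norm_triangle_ineq[of "(\<rho>\<^sup>2 - 1 - 2 * s) *\<^sub>R F y + (1 + 2 * s) *\<^sub>R E" "(2 * s) *\<^sub>R L v"]
      norm_triangle_ineq[of "(\<rho>\<^sup>2 - 1 - 2 * s) *\<^sub>R F y" "(1 + 2 * s) *\<^sub>R E"] by linarith
  also have "norm ((\<rho>\<^sup>2 - 1 - 2 * s) *\<^sub>R F y) \<le> (1 + 4 * B + 2 * B\<^sup>2) * q * P"
    using mult_mono[OF 1 F(1)] BP q0 by simp
  also have "norm ((1 + 2 * s) *\<^sub>R E) \<le> 3 * (P * (2 + 4 * B\<^sup>2 + B) * q)"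
    using mult_mono[OF _ E, of "\<bar>1 + 2 * s\<bar>" 3] small by simp
  also have "norm ((2 * s) *\<^sub>R L v) \<le> P * q"
  proof -
    have "norm ((2 * s) *\<^sub>R L v) \<le> 2 * \<bar>s\<bar> * (P * norm v)"
      using L(2)[of v] by (simp add: abs_mult mult_left_mono)
    also have "\<dots> = P * (2 * \<bar>s\<bar> * norm v)" by simp
    also have "\<dots> \<le> P * q"
      using sum_squares_bound[of "\<bar>s\<bar>" "norm v"] BP by (intro mult_left_mono) (auto simp: q)
    finally show ?thesis .
  qed
  finally show "norm (\<rho>\<^sup>2 *\<^sub>R F y - F x - (2 * s) *\<^sub>R F x - L v) \<le> P * (8 + 7 * B + 14 * B\<^sup>2) * q"
    by (simp add: algebra_simps)
qed

context cone_retraction_data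
begin

lemma ret_weighted_expansion_near:
  fixes \<psi> :: "'p \<Rightarrow> 'b::real_normed_vector"
  assumes \<psi>: "C2_loc_lipschitz_map A \<psi>" and c: "c \<in> A" "p \<in> fst c"
  shows "\<exists>U \<delta> B. open U \<and> p \<in> U \<and> U \<subseteq> fst c \<and> \<delta> > 0 \<and> B \<ge> 0 \<and> (\<forall>\<theta>\<in>U. norm (\<psi> \<theta>) \<le> B \<and>
    (\<forall>X\<in>tangent_space A \<theta>. norm (chart_deriv c \<psi> \<theta> (X c)) \<le> B * tnorm g \<theta> X \<and>
      (\<forall>s. \<bar>s\<bar> < \<delta> \<longrightarrow> tnorm g \<theta> X < \<delta> \<longrightarrow> (let y = Ret (1, \<theta>) (s, X) in
        \<bar>(fst y)\<^sup>2 - 1 - 2 * s\<bar> \<le> B * (s\<^sup>2 + (tnorm g \<theta> X)\<^sup>2) \<and>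
        norm ((fst y)\<^sup>2 *\<^sub>R \<psi> (snd y) - \<psi> \<theta> - (2 * s) *\<^sub>R \<psi> \<theta> - chart_deriv c \<psi> \<theta> (X c))
          \<le> B * (s\<^sup>2 + (tnorm g \<theta> X)\<^sup>2)))))"
proof -
  let ?F = "\<psi> \<circ> chart_inv c"
  let ?o = "snd c p"
  have C2: "C2_loc_lipschitz_on (chart_range c) ?F" using \<psi> c by (simp add: C2_loc_lipschitz_map_def)
  obtain e1 P where P: "e1 > 0" "P \<ge> 0" "ball ?o e1 \<subseteq> chart_range c"
    "\<And>x. x \<in> ball ?o e1 \<Longrightarrow> norm (?F x) \<le> P"
    "\<And>x v. x \<in> ball ?o e1 \<Longrightarrow> norm (frechet_derivative ?F (at x) v) \<le> P * norm v"
    "\<And>x y. x \<in> ball ?o e1 \<Longrightarrow> y \<in> ball ?o e1 \<Longrightarrow>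
      norm (?F y - ?F x - frechet_derivative ?F (at x) (y - x)) \<le> P * (norm (y - x))\<^sup>2"
    using C2_loc_lipschitz_on_bounds_near[OF C2 open_chart_range[OF c(1)] chart_in_range[OF c]] by blast
  obtain e2 B where eB: "e2 > 0" "B \<ge> 0" "\<And>x s v. x \<in> ball ?o e2 \<Longrightarrow> \<bar>s\<bar> < e2 \<Longrightarrow> norm v < e2 \<Longrightarrow>
      (let y = Ret (1, chart_inv c x) (s, tvec_of A c (chart_inv c x) v) in
        snd y \<in> fst c \<and> \<bar>fst y - 1 - s\<bar> \<le> B * (s\<^sup>2 + (norm v)\<^sup>2) \<and>
        norm (snd c (snd y) - x - v) \<le> B * (s\<^sup>2 + (norm v)\<^sup>2))"
    using ret_expansion_near[OF c] by blast
  obtain V k where V: "open V" "p \<in> V" "V \<subseteq> fst c" "k > 0"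
    "\<And>q X. q \<in> V \<Longrightarrow> X \<in> tangent_space A q \<Longrightarrow> norm (X c) \<le> k * tnorm g q X"
    using coords_le_tnorm_near[OF c] by blast
  \<comment> \<open>The image has coordinates within \<open>norm v + B * q\<close> of those of the
    base point, and \<open>d \<le> 1\<close> gives \<open>q \<le> 2 * d\<close>. So the image stays
    within \<open>(2 + 2 * B) * d\<close> of the centre, inside the ball of radius \<open>e1\<close>
    on which \<open>\<psi>\<close> is controlled.\<close>
  define d where "d = min 1 (min e2 (e1 / (3 + 2 * B)))"
  have "d * (3 + 2 * B) \<le> e1 / (3 + 2 * B) * (3 + 2 * B)"
    using eB by (intro mult_right_mono) (auto simp: d_def)
  then have d: "d > 0" "d \<le> 1" "d \<le> e2" "d * (3 + 2 * B) \<le> e1" using P eB by (auto simp: d_def)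
  define U where "U = V \<inter> {q \<in> fst c. snd c q \<in> ball ?o d}"
  \<comment> \<open>Dividing by \<open>k\<close> turns a metric bound on \<open>X\<close> into the
    coordinate bound \<open>norm (X c) < d\<close>.\<close>
  define \<delta> where "\<delta> = min d (d / k)"
  define B1 where "B1 = (1 + 4 * B + 2 * B\<^sup>2) + P * (8 + 7 * B + 14 * B\<^sup>2)"
  \<comment> \<open>The three summands serve the bound on \<open>\<psi>\<close>, the bound on its
    derivative, and the second-order errors once \<open>norm v\<close> is replaced by
    \<open>k * tnorm g \<theta> X\<close>.\<close>
  define B2 where "B2 = P + P * k + B1 * (1 + k\<^sup>2)"
  have B0: "B1 \<ge> 0" "B2 \<ge> 0" "P \<le> B2" "P * k \<le> B2" "B1 * (1 + k\<^sup>2) \<le> B2"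
    unfolding B1_def B2_def using P eB V by (auto intro!: add_nonneg_nonneg mult_nonneg_nonneg)
  have U: "open U" "p \<in> U" "U \<subseteq> fst c"
    unfolding U_def using V c d open_coordinate_preimage[OF c(1) open_ball, of ?o d] by (auto intro!: open_Int)
  have est: "norm (\<psi> \<theta>) \<le> B2 \<and>
    (\<forall>X\<in>tangent_space A \<theta>. norm (chart_deriv c \<psi> \<theta> (X c)) \<le> B2 * tnorm g \<theta> X \<and>
      (\<forall>s. \<bar>s\<bar> < \<delta> \<longrightarrow> tnorm g \<theta> X < \<delta> \<longrightarrow> (let y = Ret (1, \<theta>) (s, X) in
        \<bar>(fst y)\<^sup>2 - 1 - 2 * s\<bar> \<le> B2 * (s\<^sup>2 + (tnorm g \<theta> X)\<^sup>2) \<and>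
        norm ((fst y)\<^sup>2 *\<^sub>R \<psi> (snd y) - \<psi> \<theta> - (2 * s) *\<^sub>R \<psi> \<theta> - chart_deriv c \<psi> \<theta> (X c))
          \<le> B2 * (s\<^sup>2 + (tnorm g \<theta> X)\<^sup>2))))" if "\<theta> \<in> U" for \<theta>
  proof -
    let ?x = "snd c \<theta>"
    have th: "\<theta> \<in> fst c" "\<theta> \<in> V" "?x \<in> ball ?o d" using that by (simp_all add: U_def)
    have "d * 1 \<le> d * (3 + 2 * B)" using eB(2) by (intro mult_left_mono less_imp_le[OF d(1)]) auto
    then have "d \<le> e1" using d by linarith
    then have xe1: "?x \<in> ball ?o e1" and xe2: "?x \<in> ball ?o e2" using th d by auto
    have t1: "norm (\<psi> \<theta>) \<le> B2" using P(4)[OF xe1] c th B0 by simp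
    have t2: "norm (chart_deriv c \<psi> \<theta> (X c)) \<le> B2 * tnorm g \<theta> X" if X: "X \<in> tangent_space A \<theta>" for X
    proof -
      have "norm (chart_deriv c \<psi> \<theta> (X c)) \<le> P * norm (X c)" by (rule P(5)[OF xe1])
      also have "\<dots> \<le> P * (k * tnorm g \<theta> X)" using V(5)[OF th(2) X] P by (intro mult_left_mono)
      also have "\<dots> \<le> B2 * tnorm g \<theta> X"
        using mult_right_mono[OF B0(4) tnorm_nonneg[OF X]] by (simp add: mult_ac)
      finally show ?thesis .
    qed
    have t3: "let y = Ret (1, \<theta>) (s, X) in
        \<bar>(fst y)\<^sup>2 - 1 - 2 * s\<bar> \<le> B2 * (s\<^sup>2 + (tnorm g \<theta> X)\<^sup>2) \<and>
        norm ((fst y)\<^sup>2 *\<^sub>R \<psi> (snd y) - \<psi> \<theta> - (2 * s) *\<^sub>R \<psi> \<theta> - chart_deriv c \<psi> \<theta> (X c))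
          \<le> B2 * (s\<^sup>2 + (tnorm g \<theta> X)\<^sup>2)"
      if X: "X \<in> tangent_space A \<theta>" and s: "\<bar>s\<bar> < \<delta>" and t: "tnorm g \<theta> X < \<delta>" for X s
    proof -
      define v where "v = X c"
      define y where "y = Ret (1, \<theta>) (s, X)"
      define q where "q = s\<^sup>2 + (norm v)\<^sup>2"
      have vt: "norm v \<le> k * tnorm g \<theta> X" using V(5)[OF th(2) X] by (simp add: v_def)
      also have "\<dots> < d" using t V by (auto simp: \<delta>_def field_simps)
      finally have v: "norm v < d" .
      have s: "\<bar>s\<bar> < d" using s by (simp add: \<delta>_def)
      have "let y = Ret (1, chart_inv c ?x) (s, tvec_of A c (chart_inv c ?x) v) in
        snd y \<in> fst c \<and> \<bar>fst y - 1 - s\<bar> \<le> B * (s\<^sup>2 + (norm v)\<^sup>2) \<and>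
        norm (snd c (snd y) - ?x - v) \<le> B * (s\<^sup>2 + (norm v)\<^sup>2)"
        using v s d by (intro eB(3)[OF xe2]) auto
      then have y: "snd y \<in> fst c" "\<bar>fst y - 1 - s\<bar> \<le> B * q" "norm (snd c (snd y) - ?x - v) \<le> B * q"
        using c th X by (simp_all add: Let_def y_def v_def q_def)
      have "s\<^sup>2 \<le> d\<^sup>2" "(norm v)\<^sup>2 \<le> d\<^sup>2"
        using power_mono[of "\<bar>s\<bar>" d 2] power_mono[of "norm v" d 2] s v by auto
      then have "q \<le> d * d + d * d" by (simp add: q_def power2_eq_square)
      also have "\<dots> \<le> 2 * d" using d mult_left_mono[of d 1 d] by simp
      finally have qd: "B * q \<le> 2 * B * d" using eB mult_left_mono[of q "2 * d" B] by simp
      have "dist (snd c (snd y)) ?o \<le> norm (snd c (snd y) - ?x - v) + (norm v + dist ?x ?o)"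
        using norm_triangle_ineq[of "snd c (snd y) - ?x - v" "v + (?x - ?o)"] norm_triangle_ineq[of v "?x - ?o"]
        by (simp add: dist_norm)
      also have "\<dots> < 2 * B * d + (d + d)" using y qd v th by (simp add: dist_commute)
      also have "\<dots> \<le> e1" using d by (simp add: algebra_simps)
      finally have ye1: "snd c (snd y) \<in> ball ?o e1" by (simp add: dist_commute)
      have "?x \<in> chart_range c" using c th chart_in_range by blast
      then have lin: "linear (chart_deriv c \<psi> \<theta>)"
        using has_derivative_linear[OF C2_loc_lipschitz_on_has_derivative[OF C2]] by blast
      note W = weighted_expansion[OF q_def _ _ eB(2) P(2) y(2,3) lin, of ?F]
      have W1: "\<bar>(fst y)\<^sup>2 - 1 - 2 * s\<bar> \<le> (1 + 4 * B + 2 * B\<^sup>2) * q"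
        using s v d P xe1 ye1 by (intro W(1)) auto
      have W2: "norm ((fst y)\<^sup>2 *\<^sub>R ?F (snd c (snd y)) - ?F ?x - (2 * s) *\<^sub>R ?F ?x - chart_deriv c \<psi> \<theta> v)
          \<le> P * (8 + 7 * B + 14 * B\<^sup>2) * q"
        using s v d P xe1 ye1 by (intro W(2)) auto
      have q0: "q \<ge> 0" by (simp add: q_def)
      have "(norm v)\<^sup>2 \<le> (k * tnorm g \<theta> X)\<^sup>2" using vt by (rule power_mono) simp
      then have "q \<le> (1 + k\<^sup>2) * (s\<^sup>2 + (tnorm g \<theta> X)\<^sup>2)"
        by (simp add: q_def power_mult_distrib algebra_simps add_nonneg_nonneg add_increasing)
      then have "B1 * q \<le> B1 * ((1 + k\<^sup>2) * (s\<^sup>2 + (tnorm g \<theta> X)\<^sup>2))" using B0 by (intro mult_left_mono)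
      also have "\<dots> \<le> B2 * (s\<^sup>2 + (tnorm g \<theta> X)\<^sup>2)"
        using mult_right_mono[OF B0(5), of "s\<^sup>2 + (tnorm g \<theta> X)\<^sup>2"] by (simp add: mult_ac)
      finally have B12: "B1 * q \<le> B2 * (s\<^sup>2 + (tnorm g \<theta> X)\<^sup>2)" .
      have "(1 + 4 * B + 2 * B\<^sup>2) * q \<le> B1 * q" "P * (8 + 7 * B + 14 * B\<^sup>2) * q \<le> B1 * q"
        using P eB q0 unfolding B1_def by (auto intro!: mult_right_mono)
      then show ?thesis using W1 W2 B12 c th y by (auto simp: Let_def y_def[symmetric] v_def[symmetric])
    qed
    show ?thesis using t1 t2 t3 by blast
  qed
  have \<delta>: "\<delta> > 0" using d V by (simp add: \<delta>_def)
  show ?thesis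
    by (intro exI[of _ U] exI[of _ \<delta>] exI[of _ B2],
        rule conjI[OF U(1) conjI[OF U(2) conjI[OF U(3) conjI[OF \<delta> conjI[OF B0(2) ballI[OF est]]]]]])
qed

text \<open>The chart used for the expansion may vary with the point and stays existentially
  quantified, while compactness makes \<open>\<delta>\<close> and \<open>B\<close> uniform.\<close>

lemma ret_weighted_expansion:
  fixes \<psi> :: "'p \<Rightarrow> 'b::real_normed_vector"
  assumes \<psi>: "C2_loc_lipschitz_map A \<psi>"
  shows "\<exists>\<delta>>0. \<exists>B\<ge>0. \<forall>\<theta>. norm (\<psi> \<theta>) \<le> B \<and> (\<exists>c\<in>A. \<theta> \<in> fst c \<and>
    (\<forall>X\<in>tangent_space A \<theta>. norm (chart_deriv c \<psi> \<theta> (X c)) \<le> B * tnorm g \<theta> X \<and>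
      (\<forall>s. \<bar>s\<bar> < \<delta> \<longrightarrow> tnorm g \<theta> X < \<delta> \<longrightarrow> (let y = Ret (1, \<theta>) (s, X) in
        \<bar>(fst y)\<^sup>2 - 1 - 2 * s\<bar> \<le> B * (s\<^sup>2 + (tnorm g \<theta> X)\<^sup>2) \<and>
        norm ((fst y)\<^sup>2 *\<^sub>R \<psi> (snd y) - \<psi> \<theta> - (2 * s) *\<^sub>R \<psi> \<theta> - chart_deriv c \<psi> \<theta> (X c))
          \<le> B * (s\<^sup>2 + (tnorm g \<theta> X)\<^sup>2)))))"
    (is "\<exists>\<delta>>0. \<exists>B\<ge>0. \<forall>\<theta>. ?P \<delta> B \<theta>")
proof -
  have mono: "?P \<delta>' B' \<theta>" if P: "?P \<delta> B \<theta>" and le: "\<delta>' \<le> \<delta>" "B \<le> B'" for \<delta> \<delta>' B B' \<theta>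
  proof -
    obtain c where c: "c \<in> A" "\<theta> \<in> fst c" "\<forall>X\<in>tangent_space A \<theta>. norm (chart_deriv c \<psi> \<theta> (X c)) \<le> B * tnorm g \<theta> X \<and>
      (\<forall>s. \<bar>s\<bar> < \<delta> \<longrightarrow> tnorm g \<theta> X < \<delta> \<longrightarrow> (let y = Ret (1, \<theta>) (s, X) in
        \<bar>(fst y)\<^sup>2 - 1 - 2 * s\<bar> \<le> B * (s\<^sup>2 + (tnorm g \<theta> X)\<^sup>2) \<and>
        norm ((fst y)\<^sup>2 *\<^sub>R \<psi> (snd y) - \<psi> \<theta> - (2 * s) *\<^sub>R \<psi> \<theta> - chart_deriv c \<psi> \<theta> (X c))
          \<le> B * (s\<^sup>2 + (tnorm g \<theta> X)\<^sup>2)))"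
      using P by blast
    have m: "B * a \<le> B' * a" if "a \<ge> 0" for a using le that by (intro mult_right_mono)
    have q: "B * (s\<^sup>2 + t\<^sup>2) \<le> B' * (s\<^sup>2 + t\<^sup>2)" for s t :: real by (intro m) simp
    show ?thesis
    proof (intro conjI bexI[of _ c] ballI allI impI)
      fix X assume X: "X \<in> tangent_space A \<theta>"
      show "norm (chart_deriv c \<psi> \<theta> (X c)) \<le> B' * tnorm g \<theta> X"
        using c(3) X m[OF tnorm_nonneg[OF X]] by force
      fix s assume "\<bar>s\<bar> < \<delta>'" "tnorm g \<theta> X < \<delta>'"
      then have "\<bar>s\<bar> < \<delta>" "tnorm g \<theta> X < \<delta>" using le by auto
      then show "let y = Ret (1, \<theta>) (s, X) in
        \<bar>(fst y)\<^sup>2 - 1 - 2 * s\<bar> \<le> B' * (s\<^sup>2 + (tnorm g \<theta> X)\<^sup>2) \<and>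
        norm ((fst y)\<^sup>2 *\<^sub>R \<psi> (snd y) - \<psi> \<theta> - (2 * s) *\<^sub>R \<psi> \<theta> - chart_deriv c \<psi> \<theta> (X c))
          \<le> B' * (s\<^sup>2 + (tnorm g \<theta> X)\<^sup>2)"
        using c(3)[rule_format, OF X] q[of s "tnorm g \<theta> X"] unfolding Let_def by (meson order_trans)
    qed (use P le c in auto)
  qed
  \<comment> \<open>a single parameter controls both constants, so that the compactness argument applies once\<close>
  have "\<exists>\<delta>>0. \<forall>\<theta>. ?P \<delta> (1 / \<delta>) \<theta>"
  proof (rule compact_space_uniform_constant[OF compact_UNIV])
    fix p
    obtain c where c: "c \<in> A" "p \<in> fst c" using chart_exists by blast
    obtain U \<delta> B where U: "open U" "p \<in> U" "U \<subseteq> fst c" "\<delta> > 0" "B \<ge> 0" "\<forall>\<theta>\<in>U. norm (\<psi> \<theta>) \<le> B \<and>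
      (\<forall>X\<in>tangent_space A \<theta>. norm (chart_deriv c \<psi> \<theta> (X c)) \<le> B * tnorm g \<theta> X \<and>
      (\<forall>s. \<bar>s\<bar> < \<delta> \<longrightarrow> tnorm g \<theta> X < \<delta> \<longrightarrow> (let y = Ret (1, \<theta>) (s, X) in
        \<bar>(fst y)\<^sup>2 - 1 - 2 * s\<bar> \<le> B * (s\<^sup>2 + (tnorm g \<theta> X)\<^sup>2) \<and>
        norm ((fst y)\<^sup>2 *\<^sub>R \<psi> (snd y) - \<psi> \<theta> - (2 * s) *\<^sub>R \<psi> \<theta> - chart_deriv c \<psi> \<theta> (X c))
          \<le> B * (s\<^sup>2 + (tnorm g \<theta> X)\<^sup>2))))"
      using ret_weighted_expansion_near[OF \<psi> c] by metis
    \<comment> \<open>The second bound forces \<open>B \<le> 1 / d\<close>, so that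
      \<open>1 / d\<close> can take the place of \<open>B\<close>.\<close>
    define d where "d = min \<delta> (1 / (B + 1))"
    have d: "d > 0" "d \<le> \<delta>" using U(4,5) by (auto simp: d_def)
    have "d \<le> 1 / (B + 1)" by (simp add: d_def)
    then have "B \<le> 1 / d" using d U(5) by (simp add: field_simps)
    have "?P d (1 / d) \<theta>" if "\<theta> \<in> U" for \<theta>
      by (rule mono[OF _ d(2) \<open>B \<le> 1 / d\<close>]) (use U that c in blast)
    then show "\<exists>U \<delta>. open U \<and> p \<in> U \<and> \<delta> > 0 \<and> (\<forall>q\<in>U. ?P \<delta> (1 / \<delta>) q)" using U d by blast
  next
    fix \<delta> \<delta>' \<theta> assume a: "?P \<delta> (1 / \<delta>) \<theta>" "0 < \<delta>'" "\<delta>' \<le> \<delta>"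
    have "1 / \<delta> \<le> 1 / \<delta>'" using a(2,3) by (intro frac_le) auto
    then show "?P \<delta>' (1 / \<delta>') \<theta>" by (rule mono[OF a(1) a(3)])
  qed
  then obtain \<delta> where d: "\<delta> > 0" "\<forall>\<theta>. ?P \<delta> (1 / \<delta>) \<theta>" by (elim exE conjE)
  have "1 / \<delta> \<ge> 0" using d(1) by simp
  then show ?thesis using d by (intro exI[of _ \<delta>] conjI exI[of _ "1 / \<delta>"])
qed

end

section \<open>Descent of the objective\<close>

text \<open>Cauchy-Schwarz against the constant 1. Integrating the square of
  \<open>?m * f x - ?I\<close> avoids dividing by the mass, which may be zero.\<close>

lemma integral_square_le:
  fixes f :: "'a \<Rightarrow> real"
  assumes "finite_measure \<nu>" "integrable \<nu> f" "integrable \<nu> (\<lambda>x. (f x)\<^sup>2)"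
  shows "(\<integral>x. f x \<partial>\<nu>)\<^sup>2 \<le> measure \<nu> (space \<nu>) * (\<integral>x. (f x)\<^sup>2 \<partial>\<nu>)"
proof -
  interpret finite_measure \<nu> by fact
  let ?m = "measure \<nu> (space \<nu>)" and ?I = "\<integral>x. f x \<partial>\<nu>"
  have "0 \<le> (\<integral>x. (?m * f x - ?I)\<^sup>2 \<partial>\<nu>)" by (intro Bochner_Integration.integral_nonneg) auto
  also have "\<dots> = (\<integral>x. ?m\<^sup>2 * (f x)\<^sup>2 - 2 * ?m * ?I * f x + ?I\<^sup>2 \<partial>\<nu>)"
    by (intro Bochner_Integration.integral_cong refl) (simp add: power2_eq_square algebra_simps)
  also have "\<dots> = ?m\<^sup>2 * (\<integral>x. (f x)\<^sup>2 \<partial>\<nu>) - 2 * ?m * ?I * ?I + ?m * ?I\<^sup>2"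
    using assms by simp
  also have "\<dots> = ?m * (?m * (\<integral>x. (f x)\<^sup>2 \<partial>\<nu>) - ?I\<^sup>2)"
    by (simp add: power2_eq_square algebra_simps)
  finally have *: "0 \<le> ?m * (?m * (\<integral>x. (f x)\<^sup>2 \<partial>\<nu>) - ?I\<^sup>2)" .
  show ?thesis
  proof (cases "?m = 0")
    case True
    then have "AE x in \<nu>. f x = 0"
      using emeasure_eq_measure AE_iff_null_sets null_setsI by (intro AE_I[of _ _ "space \<nu>"]) auto
    then have "?I = 0" using integral_eq_zero_AE by blast
    then show ?thesis by (simp add: True)
  next
    case False
    then have "?m > 0" using measure_nonneg[of \<nu> "space \<nu>"] by linarith
    then show ?thesis using * by (simp add: zero_le_mult_iff)
  qed
qed

text \<open>Here \<open>s\<close> is the relative change of the radius, \<open>t\<close> the length of the angular displacement and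
  \<open>d\<close> the first-order change of \<open>\<phi>\<close> along it; \<open>P\<close> is the resulting rate of decrease.\<close>

lemma J_reweighting_step:
  fixes \<phi> :: "'p::topological_space \<Rightarrow> 'f::{real_inner,banach}"
  assumes cpt: "compact (UNIV :: 'p set)"
    and \<phi>: "continuous_on UNIV \<phi>" "\<And>\<theta>. norm (\<phi> \<theta>) \<le> B"
    and \<nu>: "\<nu> \<in> nonneg_measures" "\<nu>' \<in> nonneg_measures" "measure \<nu> (space \<nu>) \<le> M"
    and w: "continuous_on UNIV w" and S: "continuous_on UNIV S"
    and push: "\<And>f :: 'p \<Rightarrow> real. continuous_on UNIV f \<Longrightarrow> (\<integral>\<theta>. f \<theta> \<partial>\<nu>') = (\<integral>\<theta>. w \<theta> * f (S \<theta>) \<partial>\<nu>)"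
    and s: "continuous_on UNIV s" "\<And>\<theta>. \<bar>s \<theta>\<bar> \<le> 1" and t: "continuous_on UNIV (\<lambda>\<theta>. (t \<theta>)\<^sup>2)" "\<And>\<theta>. 0 \<le> t \<theta>" "\<And>\<theta>. t \<theta> \<le> 1"
    and w1: "\<And>\<theta>. \<bar>w \<theta> - 1 - 2 * s \<theta>\<bar> \<le> B * ((s \<theta>)\<^sup>2 + (t \<theta>)\<^sup>2)"
    and w2: "\<And>\<theta>. norm (w \<theta> *\<^sub>R \<phi> (S \<theta>) - \<phi> \<theta> - (2 * s \<theta>) *\<^sub>R \<phi> \<theta> - d \<theta>) \<le> B * ((s \<theta>)\<^sup>2 + (t \<theta>)\<^sup>2)"
    and d: "\<And>\<theta>. norm (d \<theta>) \<le> B * t \<theta>"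
    and G: "norm (hgrad R (hintegral \<nu> \<phi>)) \<le> G" and lam: "lam \<ge> 0"
    and first: "\<And>\<theta>. 2 * s \<theta> * J' \<phi> R lam \<nu> \<theta> + d \<theta> \<bullet> hgrad R (hintegral \<nu> \<phi>) = - P \<theta>"
    and P: "continuous_on UNIV P"
    and L: "L \<ge> 0" "R (hintegral \<nu>' \<phi>) \<le> R (hintegral \<nu> \<phi>)
      + (hintegral \<nu>' \<phi> - hintegral \<nu> \<phi>) \<bullet> hgrad R (hintegral \<nu> \<phi>)
      + L * (norm (hintegral \<nu>' \<phi> - hintegral \<nu> \<phi>))\<^sup>2"
  shows "J \<phi> R lam \<nu>' \<le> J \<phi> R lam \<nu> - (\<integral>\<theta>. P \<theta> \<partial>\<nu>)
    + (B * (G + lam) + 18 * L * B\<^sup>2 * M) * (\<integral>\<theta>. (s \<theta>)\<^sup>2 + (t \<theta>)\<^sup>2 \<partial>\<nu>)"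
proof -
  interpret finite_measure \<nu> using \<nu> by (simp add: nonneg_measures_def)
  note int = integrable_continuous_compact_space[OF \<nu>(1) cpt]
  let ?F = "hintegral \<nu> \<phi>" and ?F' = "hintegral \<nu>' \<phi>"
  let ?g = "hgrad R ?F" and ?u = "J' \<phi> R lam \<nu>"
  let ?q = "\<lambda>\<theta>. (s \<theta>)\<^sup>2 + (t \<theta>)\<^sup>2"
  have B0: "B \<ge> 0" using \<phi>(2) norm_ge_zero order_trans by blast
  have qc: "continuous_on UNIV ?q" by (rule continuous_on_add[OF continuous_on_power[OF s(1)] t(1)])
  have q0: "?q \<theta> \<ge> 0" for \<theta> by simp
  have S\<phi>: "continuous_on UNIV (\<lambda>\<theta>. \<phi> (S \<theta>))"
    by (rule continuous_on_compose2[OF \<phi>(1) S]) simp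
  have uc: "continuous_on UNIV ?u" unfolding J'_def by (intro continuous_intros \<phi>)
  have uSc: "continuous_on UNIV (\<lambda>\<theta>. ?u (S \<theta>))" by (rule continuous_on_compose2[OF uc S]) simp
  have mass: "measure m (space m) = (\<integral>\<theta>. 1 \<partial>m)" for m :: "'p measure" by simp
  have diffF: "(?F' - ?F) \<bullet> h = (\<integral>\<theta>. (w \<theta> *\<^sub>R \<phi> (S \<theta>) - \<phi> \<theta>) \<bullet> h \<partial>\<nu>)" for h
  proof -
    have "(?F' - ?F) \<bullet> h = (\<integral>\<theta>. w \<theta> * (\<phi> (S \<theta>) \<bullet> h) \<partial>\<nu>) - (\<integral>\<theta>. \<phi> \<theta> \<bullet> h \<partial>\<nu>)"
      by (simp add: inner_diff_left hintegral_inner[OF \<nu>(1) cpt \<phi>(1)] hintegral_inner[OF \<nu>(2) cpt \<phi>(1)]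
          push continuous_on_inner \<phi>(1))
    also have "\<dots> = (\<integral>\<theta>. w \<theta> * (\<phi> (S \<theta>) \<bullet> h) - \<phi> \<theta> \<bullet> h \<partial>\<nu>)"
      by (intro Bochner_Integration.integral_diff[symmetric] int continuous_intros w S\<phi> \<phi>)
    finally show ?thesis by (simp add: inner_diff_left)
  qed
  \<comment> \<open>The linear change of \<open>R\<close> plus the change of mass is the change of
    the integral of \<open>?u\<close>, since \<open>?u\<close> is the pairing of
    \<open>\<phi>\<close> with the gradient plus the constant \<open>lam\<close>.\<close>
  have "(?F' - ?F) \<bullet> ?g + lam * measure \<nu>' (space \<nu>') - lam * measure \<nu> (space \<nu>)
      = (\<integral>\<theta>. w \<theta> * ?u (S \<theta>) \<partial>\<nu>) - (\<integral>\<theta>. ?u \<theta> \<partial>\<nu>)"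
    using push[OF uc] hintegral_inner[OF \<nu>(1) cpt \<phi>(1), of ?g] hintegral_inner[OF \<nu>(2) cpt \<phi>(1), of ?g]
      int[of "\<lambda>\<theta>. \<phi> \<theta> \<bullet> ?g"] integrable_continuous_compact_space[OF \<nu>(2) cpt, of "\<lambda>\<theta>. \<phi> \<theta> \<bullet> ?g"]
      finite_measure.integrable_const[of \<nu>' lam] \<nu>(2) \<phi>
    by (simp add: J'_def inner_diff_left continuous_on_inner nonneg_measures_def mult.commute[of lam])
  also have "\<dots> = (\<integral>\<theta>. w \<theta> * ?u (S \<theta>) - ?u \<theta> \<partial>\<nu>)"
    by (intro Bochner_Integration.integral_diff[symmetric] int continuous_intros w uSc uc)
  also have "\<dots> \<le> (\<integral>\<theta>. - P \<theta> + B * (G + lam) * ?q \<theta> \<partial>\<nu>)"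
  proof (rule integral_mono)
    show "integrable \<nu> (\<lambda>\<theta>. w \<theta> * ?u (S \<theta>) - ?u \<theta>)" by (intro int continuous_intros w uSc uc)
    show "integrable \<nu> (\<lambda>\<theta>. - P \<theta> + B * (G + lam) * ?q \<theta>)"
      by (rule int[OF continuous_on_add[OF continuous_on_minus[OF P] continuous_on_mult[OF continuous_on_const qc]]])
    fix \<theta>
    let ?e = "w \<theta> *\<^sub>R \<phi> (S \<theta>) - \<phi> \<theta> - (2 * s \<theta>) *\<^sub>R \<phi> \<theta> - d \<theta>"
    \<comment> \<open>Three parts: the second-order error in \<open>\<phi>\<close>, the second-order
      error in the mass, and the first-order part, which \<open>first\<close> identifies as
      \<open>- P \<theta>\<close>.\<close>
    have "w \<theta> * ?u (S \<theta>) - ?u \<theta> = ?e \<bullet> ?g + lam * (w \<theta> - 1 - 2 * s \<theta>) + (2 * s \<theta> * ?u \<theta> + d \<theta> \<bullet> ?g)"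
      by (simp add: J'_def inner_diff_left algebra_simps)
    also have "?e \<bullet> ?g \<le> norm ?e * norm ?g" by (rule norm_cauchy_schwarz)
    also have "\<dots> \<le> B * ?q \<theta> * G" using w2 G B0 by (intro mult_mono) auto
    also have "lam * (w \<theta> - 1 - 2 * s \<theta>) \<le> lam * (B * ?q \<theta>)"
      using w1[of \<theta>] lam by (intro mult_left_mono) auto
    finally show "w \<theta> * ?u (S \<theta>) - ?u \<theta> \<le> - P \<theta> + B * (G + lam) * ?q \<theta>"
      unfolding first by (simp add: algebra_simps)
  qed
  also have "\<dots> = - (\<integral>\<theta>. P \<theta> \<partial>\<nu>) + B * (G + lam) * (\<integral>\<theta>. ?q \<theta> \<partial>\<nu>)"
    using int[OF P] int[OF qc] by simp
  finally have lin: "(?F' - ?F) \<bullet> ?g + lam * measure \<nu>' (space \<nu>') - lam * measure \<nu> (space \<nu>)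
      \<le> - (\<integral>\<theta>. P \<theta> \<partial>\<nu>) + B * (G + lam) * (\<integral>\<theta>. ?q \<theta> \<partial>\<nu>)" .
  \<comment> \<open>Continuity is given for the square of \<open>t\<close>; writing \<open>t\<close>
    as a square root makes \<open>T\<close> continuous.\<close>
  define T where "T \<theta> = \<bar>s \<theta>\<bar> + sqrt ((t \<theta>)\<^sup>2)" for \<theta>
  have T: "T \<theta> = \<bar>s \<theta>\<bar> + t \<theta>" for \<theta> using t by (simp add: T_def)
  have Tc: "continuous_on UNIV T" unfolding T_def
    by (rule continuous_on_add[OF continuous_on_rabs[OF s(1)] continuous_on_real_sqrt[OF t(1)]])
  have "norm (w \<theta> *\<^sub>R \<phi> (S \<theta>) - \<phi> \<theta>) \<le> 3 * B * T \<theta>" for \<theta>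
  proof -
    let ?e = "w \<theta> *\<^sub>R \<phi> (S \<theta>) - \<phi> \<theta> - (2 * s \<theta>) *\<^sub>R \<phi> \<theta> - d \<theta>"
    have "w \<theta> *\<^sub>R \<phi> (S \<theta>) - \<phi> \<theta> = ?e + (2 * s \<theta>) *\<^sub>R \<phi> \<theta> + d \<theta>" by simp
    then have "norm (w \<theta> *\<^sub>R \<phi> (S \<theta>) - \<phi> \<theta>) \<le> norm ?e + norm ((2 * s \<theta>) *\<^sub>R \<phi> \<theta>) + norm (d \<theta>)"
      by (metis norm_triangle_ineq norm_triangle_le add_mono order_refl)
    also have "norm ((2 * s \<theta>) *\<^sub>R \<phi> \<theta>) \<le> 2 * (B * \<bar>s \<theta>\<bar>)"
      using mult_right_mono[OF \<phi>(2)[of \<theta>], of "\<bar>s \<theta>\<bar>"] by (simp add: abs_mult mult_ac)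
    also have "norm ?e \<le> B * T \<theta>"
    proof (rule order_trans[OF w2 mult_left_mono[OF _ B0]])
      have "\<bar>s \<theta>\<bar> * \<bar>s \<theta>\<bar> \<le> \<bar>s \<theta>\<bar> * 1" by (intro mult_left_mono s(2)) simp
      moreover have "t \<theta> * t \<theta> \<le> t \<theta> * 1" by (intro mult_left_mono t)
      ultimately show "?q \<theta> \<le> T \<theta>" by (simp add: T power2_eq_square)
    qed
    finally show ?thesis using d[of \<theta>] mult_nonneg_nonneg[OF B0 t(2)[of \<theta>]] by (simp add: T algebra_simps)
  qed
  note wle = this
  have IT0: "0 \<le> (\<integral>\<theta>. T \<theta> \<partial>\<nu>)" using t by (intro Bochner_Integration.integral_nonneg) (auto simp: T)
  define h where "h = ?F' - ?F"
  \<comment> \<open>Pairing \<open>h\<close> with itself turns the scalar identities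
    \<open>diffF\<close> into a bound on its norm.\<close>
  have "h \<bullet> h \<le> (\<integral>\<theta>. norm h * (3 * B) * T \<theta> \<partial>\<nu>)"
    unfolding diffF[of h, folded h_def]
  proof (intro integral_mono int continuous_intros w S\<phi> \<phi> Tc)
    fix \<theta>
    have "(w \<theta> *\<^sub>R \<phi> (S \<theta>) - \<phi> \<theta>) \<bullet> h \<le> norm (w \<theta> *\<^sub>R \<phi> (S \<theta>) - \<phi> \<theta>) * norm h" by (rule norm_cauchy_schwarz)
    also have "\<dots> \<le> 3 * B * T \<theta> * norm h" by (intro mult_right_mono wle) simp
    finally show "(w \<theta> *\<^sub>R \<phi> (S \<theta>) - \<phi> \<theta>) \<bullet> h \<le> norm h * (3 * B) * T \<theta>" by (simp add: mult_ac)
  qed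
  then have "norm h * norm h \<le> norm h * (3 * B * (\<integral>\<theta>. T \<theta> \<partial>\<nu>))"
    by (simp add: power2_norm_eq_inner[symmetric] power2_eq_square[symmetric] mult_ac)
  then have "norm h \<le> 3 * B * (\<integral>\<theta>. T \<theta> \<partial>\<nu>)"
    using B0 IT0 by (cases "norm h = 0") (auto simp: mult_le_cancel_left)
  then have "(norm h)\<^sup>2 \<le> (3 * B * (\<integral>\<theta>. T \<theta> \<partial>\<nu>))\<^sup>2" by (rule power_mono) simp
  also have "\<dots> = 9 * B\<^sup>2 * (\<integral>\<theta>. T \<theta> \<partial>\<nu>)\<^sup>2" by (simp add: power_mult_distrib)
  \<comment> \<open>Cauchy-Schwarz makes the squared first-order change comparable to the integral
    of \<open>?q\<close>. The 18 of the conclusion is 9, from the square of \<open>3 * B\<close>,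
    times 2, from \<open>(T \<theta>)\<^sup>2 \<le> 2 * ?q \<theta>\<close>.\<close>
  also have "\<dots> \<le> 9 * B\<^sup>2 * (M * (2 * (\<integral>\<theta>. ?q \<theta> \<partial>\<nu>)))"
  proof (intro mult_left_mono)
    have "(\<integral>\<theta>. T \<theta> \<partial>\<nu>)\<^sup>2 \<le> measure \<nu> (space \<nu>) * (\<integral>\<theta>. (T \<theta>)\<^sup>2 \<partial>\<nu>)"
      by (intro integral_square_le int continuous_intros Tc) unfold_locales
    also have "\<dots> \<le> M * (\<integral>\<theta>. 2 * ?q \<theta> \<partial>\<nu>)"
    proof (intro mult_mono \<nu>(3) integral_mono)
      show "integrable \<nu> (\<lambda>\<theta>. (T \<theta>)\<^sup>2)" by (rule int[OF continuous_on_power[OF Tc]])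
      show "integrable \<nu> (\<lambda>\<theta>. 2 * ?q \<theta>)" by (rule int[OF continuous_on_mult[OF continuous_on_const qc]])
      show "(T \<theta>)\<^sup>2 \<le> 2 * ?q \<theta>" for \<theta>
        using sum_squares_bound[of "\<bar>s \<theta>\<bar>" "t \<theta>"] by (simp add: T power2_sum)
      show "0 \<le> M" using \<nu>(3) measure_nonneg order_trans by blast
    qed simp
    finally show "(\<integral>\<theta>. T \<theta> \<partial>\<nu>)\<^sup>2 \<le> M * (2 * (\<integral>\<theta>. ?q \<theta> \<partial>\<nu>))"
      by (simp only: integral_mult_right_zero)
  qed simp
  finally have "L * (norm h)\<^sup>2 \<le> L * (9 * B\<^sup>2 * (M * (2 * (\<integral>\<theta>. ?q \<theta> \<partial>\<nu>))))"
    using L(1) by (rule mult_left_mono)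
  with lin L(2) show ?thesis by (simp add: J_def h_def algebra_simps)
qed

section \<open>Regularity of J'\<close>

context riemannian
begin

lemma continuous_on_charts:
  assumes "\<And>c. c \<in> A \<Longrightarrow> continuous_on (fst c) f"
  shows "continuous_on UNIV f"
proof (rule continuous_at_imp_continuous_on, rule ballI)
  fix p
  obtain c where c: "c \<in> A" "p \<in> fst c" using chart_exists by blast
  then show "isCont f p" using assms open_chart by (simp add: continuous_on_eq_continuous_at)
qed

lemma C2_loc_lipschitz_map_continuous:
  assumes "C2_loc_lipschitz_map A \<psi>" shows "continuous_on UNIV \<psi>"
proof (rule continuous_on_charts)
  fix c assume c: "c \<in> A"
  have "C2_loc_lipschitz_on (chart_range c) (\<psi> \<circ> chart_inv c)" using assms c by (simp add: C2_loc_lipschitz_map_def)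
  then have "continuous_on (chart_range c) (\<psi> \<circ> chart_inv c)"
    by (intro continuous_at_imp_continuous_on ballI)
      (rule has_derivative_continuous[OF C2_loc_lipschitz_on_has_derivative])
  then have "continuous_on (fst c) (\<lambda>p. (\<psi> \<circ> chart_inv c) (snd c p))"
    using chart_in_range[OF c] by (intro continuous_on_compose2[OF _ continuous_on_chart[OF c]]) auto
  then show "continuous_on (fst c) \<psi>" using c by (simp cong: continuous_on_cong)
qed

lemma J'_has_derivative:
  assumes "C2_loc_lipschitz_map A \<phi>" "c \<in> A" "x \<in> chart_range c"
  shows "((J' \<phi> R lam \<nu> \<circ> chart_inv c) has_derivative
    (\<lambda>v. frechet_derivative (\<phi> \<circ> chart_inv c) (at x) v \<bullet> hgrad R (hintegral \<nu> \<phi>))) (at x)"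
proof -
  have "((\<phi> \<circ> chart_inv c) has_derivative frechet_derivative (\<phi> \<circ> chart_inv c) (at x)) (at x)"
    using assms C2_loc_lipschitz_on_has_derivative unfolding C2_loc_lipschitz_map_def by blast
  then have "((\<lambda>x. (\<phi> \<circ> chart_inv c) x \<bullet> hgrad R (hintegral \<nu> \<phi>) + lam) has_derivative
    (\<lambda>v. frechet_derivative (\<phi> \<circ> chart_inv c) (at x) v \<bullet> hgrad R (hintegral \<nu> \<phi>) + 0)) (at x)"
    by (intro has_derivative_add has_derivative_const has_derivative_inner_left)
  then show ?thesis by (simp add: J'_def comp_def)
qed

lemma chart_deriv_J':
  assumes "C2_loc_lipschitz_map A \<phi>" "c \<in> A" "\<theta> \<in> fst c"
  shows "chart_deriv c (J' \<phi> R lam \<nu>) \<theta> v = chart_deriv c \<phi> \<theta> v \<bullet> hgrad R (hintegral \<nu> \<phi>)"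
  using frechet_derivative_at[OF J'_has_derivative[OF assms(1,2) chart_in_range[OF assms(2,3)], where R = R and lam = lam and \<nu> = \<nu>]]
  by metis

lemma C1_function_J':
  assumes "C2_loc_lipschitz_map A \<phi>"
  shows "C1_function (J' \<phi> R lam \<nu>)"
  unfolding C1_function_def
proof (intro conjI ballI allI)
  fix c assume c: "c \<in> A"
  note hd = J'_has_derivative[OF assms c, where R = R and lam = lam and \<nu> = \<nu>]
  show "(J' \<phi> R lam \<nu> \<circ> chart_inv c) differentiable (at x)" if "x \<in> chart_range c" for x
    using hd[OF that] by (rule differentiableI)
  have C2: "C2_loc_lipschitz_on (chart_range c) (\<phi> \<circ> chart_inv c)" using assms c by (simp add: C2_loc_lipschitz_map_def)
  fix v
  have "continuous_on (chart_range c) (\<lambda>x. frechet_derivative (\<phi> \<circ> chart_inv c) (at x) v \<bullet> hgrad R (hintegral \<nu> \<phi>))"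
    by (intro continuous_intros C2_loc_lipschitz_on_continuous_derivative[OF C2])
  moreover have "frechet_derivative (J' \<phi> R lam \<nu> \<circ> chart_inv c) (at x) v
      = frechet_derivative (\<phi> \<circ> chart_inv c) (at x) v \<bullet> hgrad R (hintegral \<nu> \<phi>)" if "x \<in> chart_range c" for x
    using fun_cong[OF frechet_derivative_at[OF hd[OF that]], of v] by simp
  ultimately show "continuous_on (chart_range c) (\<lambda>x. frechet_derivative (J' \<phi> R lam \<nu> \<circ> chart_inv c) (at x) v)"
    by (simp cong: continuous_on_cong)
qed

end

section \<open>Pushforward under a homogeneous step on the cone\<close>

lemma borel_measurable_Omega:
  fixes F :: "real \<times> 'p::topological_space \<Rightarrow> 'b::topological_space"
  assumes "continuous_on UNIV F" shows "F \<in> Omega \<rightarrow>\<^sub>M borel"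
  unfolding Omega_def by (intro measurable_restrict_space1 borel_measurable_continuous_onI assms)

lemma space_Omega: "space (Omega :: (real \<times> 'p::topological_space) measure) = {0..} \<times> UNIV"
  by (simp add: Omega_def space_restrict_space)

context cone_retraction_data
begin

context
  fixes s :: "'p \<Rightarrow> real" and X :: "'p \<Rightarrow> ('p, 'e) tvec" and T :: "real \<times> 'p \<Rightarrow> real \<times> 'p"
  assumes s: "continuous_on UNIV s" "\<And>\<theta>. \<bar>s \<theta>\<bar> < C"
    and X: "\<And>\<theta>. X \<theta> \<in> tangent_space A \<theta>" "\<And>c. c \<in> A \<Longrightarrow> continuous_on (fst c) (\<lambda>\<theta>. X \<theta> c)"
      "\<And>\<theta>. tnorm g \<theta> (X \<theta>) < C"
    and T: "\<And>r \<theta>. T (r, \<theta>) = Ret (r, \<theta>) (r * s \<theta>, X \<theta>)"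
begin

text \<open>Homogeneity against the reference radius 1 factors the radius out. The formula for the
  first component also covers \<open>r = 0\<close>, where it gives 0; only the angle needs a case
  distinction.\<close>

lemma cone_step_eq:
  assumes "r \<ge> 0"
  shows "T (r, \<theta>) = (r * fst (Ret (1, \<theta>) (s \<theta>, X \<theta>)),
    if r = 0 then vertex \<theta> (X \<theta>) else snd (Ret (1, \<theta>) (s \<theta>, X \<theta>)))"
proof (cases "r = 0")
  case True
  then show ?thesis using ret_vertex[OF X(1)] by (simp add: T)
next
  case False
  then have "r > 0" using assms by simp
  then show ?thesis
    using ret_homogeneous[of r 1 "X \<theta>" \<theta> "s \<theta>"] s X unfolding T by (simp add: prod_eq_iff)
qed

text \<open>Measurability of the apex map is prescribed chart by chart, and the atlas may be
  uncountable; a finite subcover makes the gluing legitimate.\<close>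

lemma vertex_section_measurable: "(\<lambda>\<theta>. vertex \<theta> (X \<theta>)) \<in> borel \<rightarrow>\<^sub>M borel"
proof -
  obtain K where K: "finite K" "K \<subseteq> A" "UNIV \<subseteq> (\<Union>c\<in>K. fst c)"
    by (rule compactE_image[OF compact_UNIV, of A fst]) (use open_chart chart_exists in auto)
  show ?thesis
  proof (rule measurable_piecewise_restrict[where C = "fst ` K"])
    fix U assume "U \<in> fst ` K"
    then obtain c where c: "c \<in> A" "U = fst c" using K by blast
    show "U \<inter> space borel \<in> sets borel" using c open_chart by auto
    have m: "(\<lambda>(p, v). vertex p (tvec_of A c p v)) \<in> restrict_space borel (fst c \<times> UNIV) \<rightarrow>\<^sub>M borel"
      using vertex_measurable c by (simp add: tangent_bundle_measurable_def)
    have "(\<lambda>\<theta>. (\<theta>, X \<theta> c)) \<in> restrict_space borel (fst c) \<rightarrow>\<^sub>M restrict_space borel (fst c \<times> UNIV)"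
      using c by (intro measurable_restrict_space2 borel_measurable_continuous_on_restrict continuous_intros X)
        (auto simp: space_restrict_space)
    from measurable_compose[OF this m]
    have "(\<lambda>\<theta>. vertex \<theta> (tvec_of A c \<theta> (X \<theta> c))) \<in> restrict_space borel (fst c) \<rightarrow>\<^sub>M borel" by simp
    then show "(\<lambda>\<theta>. vertex \<theta> (X \<theta>)) \<in> restrict_space borel U \<rightarrow>\<^sub>M borel"
      using c X(1) by (subst measurable_cong[where g = "\<lambda>\<theta>. vertex \<theta> (tvec_of A c \<theta> (X \<theta> c))"]) (auto simp: space_restrict_space)
  qed (use K in \<open>auto intro: countable_finite\<close>)
qed

text \<open>This justifies the change of variables under \<open>distr\<close>. The angle is glued
  from a measurable map on \<open>r = 0\<close> and a continuous one elsewhere; positivity of the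
  radial factor keeps the image in \<open>Omega\<close>.\<close>

lemma cone_step_measurable: "T \<in> Omega \<rightarrow>\<^sub>M Omega"
proof -
  let ?y = "\<lambda>\<theta>. Ret (1, \<theta>) (s \<theta>, X \<theta>)"
  have y: "continuous_on UNIV ?y" by (rule continuous_on_ret[OF s X])
  have ypos: "fst (?y \<theta>) > 0" for \<theta>
    using s X by (intro ret_pos) (simp add: ret_domain_def)
  have sndm: "snd \<in> Omega \<rightarrow>\<^sub>M (borel :: 'p measure)"
    by (intro borel_measurable_Omega continuous_on_snd continuous_on_id)
  have fstm: "fst \<in> Omega \<rightarrow>\<^sub>M (borel :: real measure)"
    by (intro borel_measurable_Omega continuous_on_fst continuous_on_id)
  have y1: "continuous_on UNIV (\<lambda>z :: real \<times> 'p. ?y (snd z))"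
    by (rule continuous_on_compose2[OF y continuous_on_snd[OF continuous_on_id]]) simp
  have 1: "(\<lambda>z. fst z * fst (?y (snd z))) \<in> Omega \<rightarrow>\<^sub>M borel"
    by (intro borel_measurable_Omega continuous_on_mult continuous_on_fst continuous_on_id y1)
  have 2: "(\<lambda>z. if fst z = 0 then vertex (snd z) (X (snd z)) else snd (?y (snd z))) \<in> Omega \<rightarrow>\<^sub>M borel"
  proof (intro measurable_If)
    show "(\<lambda>z. vertex (snd z) (X (snd z))) \<in> Omega \<rightarrow>\<^sub>M borel"
      by (rule measurable_compose[OF sndm vertex_section_measurable])
    show "(\<lambda>z. snd (?y (snd z))) \<in> Omega \<rightarrow>\<^sub>M borel"
      by (intro borel_measurable_Omega continuous_on_snd y1)
    show "{z \<in> space Omega. fst z = 0} \<in> sets Omega" using fstm by measurable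
  qed
  have "(\<lambda>z. (fst z * fst (?y (snd z)), if fst z = 0 then vertex (snd z) (X (snd z)) else snd (?y (snd z))))
      \<in> Omega \<rightarrow>\<^sub>M borel"
    using measurable_Pair[OF 1 2] by (simp add: borel_prod)
  then have "(\<lambda>z. (fst z * fst (?y (snd z)), if fst z = 0 then vertex (snd z) (X (snd z)) else snd (?y (snd z))))
      \<in> Omega \<rightarrow>\<^sub>M restrict_space borel ({0..} \<times> UNIV)"
    using ypos by (intro measurable_restrict_space2) (auto simp: space_Omega less_imp_le)
  then show ?thesis
    by (subst measurable_cong[where g = "\<lambda>z. (fst z * fst (?y (snd z)), if fst z = 0 then vertex (snd z) (X (snd z)) else snd (?y (snd z)))"])
      (auto simp: space_Omega cone_step_eq, simp add: Omega_def)
qed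

text \<open>The square of the new radius is \<open>r\<^sup>2\<close> times a continuous function of
  the angle, so the integrand after the step is again of the form to which
  \<open>is_projection \<mu> \<nu>\<close> applies.\<close>

lemma projection_cone_step:
  fixes F :: "'p \<Rightarrow> real"
  assumes "sets \<mu> = sets Omega" "is_projection \<mu> \<nu>" "is_projection (distr \<mu> Omega T) \<nu>'"
    and F: "continuous_on UNIV F"
  shows "(\<integral>\<theta>. F \<theta> \<partial>\<nu>') = (\<integral>\<theta>. (fst (Ret (1, \<theta>) (s \<theta>, X \<theta>)))\<^sup>2 * F (snd (Ret (1, \<theta>) (s \<theta>, X \<theta>))) \<partial>\<nu>)"
proof -
  let ?y = "\<lambda>\<theta>. Ret (1, \<theta>) (s \<theta>, X \<theta>)"
  have y: "continuous_on UNIV ?y" by (rule continuous_on_ret[OF s X])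
  have Tm: "T \<in> \<mu> \<rightarrow>\<^sub>M Omega" using cone_step_measurable measurable_cong_sets[OF assms(1) refl] by blast
  have Fm: "(\<lambda>(r, \<theta>). r\<^sup>2 * F \<theta>) \<in> Omega \<rightarrow>\<^sub>M borel"
    unfolding split_def
    by (intro borel_measurable_Omega continuous_intros continuous_on_compose2[OF F]) auto
  have sp: "space \<mu> = {0..} \<times> UNIV" using sets_eq_imp_space_eq[OF assms(1)] by (simp add: space_Omega)
  have Fy: "continuous_on UNIV (\<lambda>\<theta>. (fst (?y \<theta>))\<^sup>2 * F (snd (?y \<theta>)))"
    by (intro continuous_on_mult continuous_on_power continuous_on_fst y
        continuous_on_compose2[OF F continuous_on_snd[OF y]]) simp
  have "(\<integral>\<theta>. F \<theta> \<partial>\<nu>') = (\<integral>(r, \<theta>). r\<^sup>2 * F \<theta> \<partial>distr \<mu> Omega T)"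
    using assms by (simp add: is_projection_def)
  also have "\<dots> = (\<integral>z. (case T z of (r, \<theta>) \<Rightarrow> r\<^sup>2 * F \<theta>) \<partial>\<mu>)" by (rule integral_distr[OF Tm Fm])
  \<comment> \<open>At \<open>r = 0\<close> both integrands vanish with \<open>r\<^sup>2\<close>,
    whatever the apex map does to the angle.\<close>
  also have "\<dots> = (\<integral>(r, \<theta>). r\<^sup>2 * ((fst (?y \<theta>))\<^sup>2 * F (snd (?y \<theta>))) \<partial>\<mu>)"
    by (intro Bochner_Integration.integral_cong refl) (auto simp: sp cone_step_eq power_mult_distrib)
  also have "\<dots> = (\<integral>\<theta>. (fst (?y \<theta>))\<^sup>2 * F (snd (?y \<theta>)) \<partial>\<nu>)"
    using assms Fy by (simp add: is_projection_def)
  finally show ?thesis .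
qed

end

text \<open>\<open>\<eta>\<close> is fixed before the measures, since all bounds are uniform over
  the sublevel set of \<open>J0\<close>. The half of the linear decrease that survives is exactly
  the left-hand side of the sharpness inequality.\<close>

lemma pgd_descent:
  fixes \<phi> :: "'p \<Rightarrow> 'f::{real_inner,banach}"
  assumes \<phi>: "C2_loc_lipschitz_map A \<phi>" and lam: "lam > 0" and R0: "\<And>f. R f \<ge> 0"
    and R: "C2_loc_lipschitz_on UNIV R" "\<And>b. bounded (hgrad R ` {f. R f \<le> b})"
  shows "\<exists>\<eta>>0. \<forall>\<alpha> \<beta> \<mu> \<nu> \<nu>'. 0 < \<alpha> \<longrightarrow> \<alpha> \<le> \<eta> \<longrightarrow> 0 < \<beta> \<longrightarrow> \<beta> \<le> \<eta> \<longrightarrow> sets \<mu> = sets Omega \<longrightarrow>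
    is_projection \<mu> \<nu> \<longrightarrow> is_projection (distr \<mu> Omega (pgd_step A g \<phi> R lam Ret \<alpha> \<beta> \<nu>)) \<nu>' \<longrightarrow>
    J \<phi> R lam \<nu> \<le> J0 \<longrightarrow>
    J \<phi> R lam \<nu>' \<le> J \<phi> R lam \<nu> - 1/2 * (\<integral>\<theta>. (4 * \<alpha> * \<bar>J' \<phi> R lam \<nu> \<theta>\<bar>\<^sup>2
      + \<beta> * (tnorm g \<theta> (mgrad A g (J' \<phi> R lam \<nu>) \<theta>))\<^sup>2) \<partial>\<nu>)"
proof -
  have \<phi>c: "continuous_on UNIV \<phi>" using \<phi> by (rule C2_loc_lipschitz_map_continuous)
  obtain \<delta> B where \<delta>: "\<delta> > 0" "B \<ge> 0" and exp: "\<forall>\<theta>. norm (\<phi> \<theta>) \<le> B \<and> (\<exists>c\<in>A. \<theta> \<in> fst c \<and>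
    (\<forall>X\<in>tangent_space A \<theta>. norm (chart_deriv c \<phi> \<theta> (X c)) \<le> B * tnorm g \<theta> X \<and>
      (\<forall>s. \<bar>s\<bar> < \<delta> \<longrightarrow> tnorm g \<theta> X < \<delta> \<longrightarrow> (let y = Ret (1, \<theta>) (s, X) in
        \<bar>(fst y)\<^sup>2 - 1 - 2 * s\<bar> \<le> B * (s\<^sup>2 + (tnorm g \<theta> X)\<^sup>2) \<and>
        norm ((fst y)\<^sup>2 *\<^sub>R \<phi> (snd y) - \<phi> \<theta> - (2 * s) *\<^sub>R \<phi> \<theta> - chart_deriv c \<phi> \<theta> (X c))
          \<le> B * (s\<^sup>2 + (tnorm g \<theta> X)\<^sup>2)))))"
    using ret_weighted_expansion[OF \<phi>] by (elim exE conjE)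
  obtain ch where ch: "\<And>\<theta>. ch \<theta> \<in> A" "\<And>\<theta>. \<theta> \<in> fst (ch \<theta>)"
    "\<And>\<theta> X. X \<in> tangent_space A \<theta> \<Longrightarrow> norm (chart_deriv (ch \<theta>) \<phi> \<theta> (X (ch \<theta>))) \<le> B * tnorm g \<theta> X"
    "\<And>\<theta> X s. X \<in> tangent_space A \<theta> \<Longrightarrow> \<bar>s\<bar> < \<delta> \<Longrightarrow> tnorm g \<theta> X < \<delta> \<Longrightarrow>
      \<bar>(fst (Ret (1, \<theta>) (s, X)))\<^sup>2 - 1 - 2 * s\<bar> \<le> B * (s\<^sup>2 + (tnorm g \<theta> X)\<^sup>2) \<and>
      norm ((fst (Ret (1, \<theta>) (s, X)))\<^sup>2 *\<^sub>R \<phi> (snd (Ret (1, \<theta>) (s, X))) - \<phi> \<theta> - (2 * s) *\<^sub>R \<phi> \<theta>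
        - chart_deriv (ch \<theta>) \<phi> \<theta> (X (ch \<theta>))) \<le> B * (s\<^sup>2 + (tnorm g \<theta> X)\<^sup>2)"
    using exp unfolding Let_def by metis
  have \<phi>B: "norm (\<phi> \<theta>) \<le> B" for \<theta> using exp by blast
  obtain G where G: "G > 0" "\<And>f. R f \<le> J0 \<Longrightarrow> norm (hgrad R f) \<le> G"
    using R(2)[of J0] unfolding bounded_pos by blast
  \<comment> \<open>Nonnegativity of \<open>R\<close> bounds the mass by
    \<open>\<bar>J0\<bar> / lam\<close>; the added 1 makes \<open>M\<close> positive. For
    displacements of size at most 1 the squared radial factor is at most \<open>3 + 2 * B\<close>,
    so \<open>M1\<close> bounds the mass after the step and both integrals of \<open>\<phi>\<close>
    lie in \<open>K\<close>.\<close>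
  define M where "M = \<bar>J0\<bar> / lam + 1"
  define M1 where "M1 = (3 + 2 * B) * M"
  have M: "M > 0" using lam by (simp add: M_def add_nonneg_pos)
  have M1: "M1 > 0" "M \<le> M1" unfolding M1_def using M \<delta> by (auto intro: add_pos_nonneg)
  define K where "K = closure (convex hull (insert 0 ((*\<^sub>R) M1 ` range \<phi>)))"
  have "compact K" unfolding K_def
    by (intro compact_closure_convex_hull compact_insert compact_scaling compact_continuous_image \<phi>c compact_UNIV)
  moreover have "convex K" unfolding K_def by (intro convex_closure convex_convex_hull)
  ultimately obtain L where L: "L \<ge> 0" "\<And>x y. x \<in> K \<Longrightarrow> y \<in> K \<Longrightarrow>
      R y \<le> R x + (y - x) \<bullet> hgrad R x + L * (norm (y - x))\<^sup>2"
    using C2_quadratic_upper_bound_compact[OF R(1)] by meson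
  \<comment> \<open>\<open>U\<close> bounds both \<open>J'\<close> and the norm of its gradient.
    Displacements below \<open>D\<close> respect the range of the expansion
    (\<open>\<delta>\<close>), the domain of the retraction (\<open>C\<close>) and the size limit of
    \<open>J_reweighting_step\<close> (1).\<close>
  define U where "U = B * G + lam"
  define D where "D = min \<delta> (min C 1)"
  \<comment> \<open>The coefficient of the quadratic term in \<open>J_reweighting_step\<close>. The
    two parts of \<open>\<eta>\<close> below keep displacements under \<open>D\<close> and ensure
    \<open>\<eta> * Q \<le> 1 / 2\<close>.\<close>
  define Q where "Q = B * (G + lam) + 18 * L * B\<^sup>2 * M"
  define \<eta> where "\<eta> = min (D / (2 * U + 1)) (1 / (2 * Q + 1))"
  have U: "U > 0" "B * G \<le> U" unfolding U_def using \<delta> G lam by (auto intro: add_nonneg_pos)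
  have D: "D > 0" "D \<le> \<delta>" "D \<le> C" "D \<le> 1" unfolding D_def using \<delta> C_pos by auto
  have Q: "Q \<ge> 0" unfolding Q_def using \<delta> G lam L M by (auto intro!: add_nonneg_nonneg)
  have \<eta>0: "\<eta> > 0" unfolding \<eta>_def using U D Q by simp
  have "\<eta> * (2 * U + 1) \<le> D / (2 * U + 1) * (2 * U + 1)"
    using U by (intro mult_right_mono) (simp_all add: \<eta>_def)
  moreover have "\<eta> * (2 * Q + 1) \<le> 1 / (2 * Q + 1) * (2 * Q + 1)"
    using Q by (intro mult_right_mono) (simp_all add: \<eta>_def)
  ultimately have "\<eta> * (2 * U + 1) \<le> D" "\<eta> * (2 * Q + 1) \<le> 1" using U Q by auto
  then have \<eta>: "\<eta> * (2 * U) < D" "\<eta> * Q \<le> 1 / 2" using \<eta>0 by (auto simp: algebra_simps)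
  have "J \<phi> R lam \<nu>' \<le> J \<phi> R lam \<nu> - 1/2 * (\<integral>\<theta>. (4 * \<alpha> * \<bar>J' \<phi> R lam \<nu> \<theta>\<bar>\<^sup>2
      + \<beta> * (tnorm g \<theta> (mgrad A g (J' \<phi> R lam \<nu>) \<theta>))\<^sup>2) \<partial>\<nu>)"
    if \<alpha>: "0 < \<alpha>" "\<alpha> \<le> \<eta>" and \<beta>: "0 < \<beta>" "\<beta> \<le> \<eta>" and \<mu>: "sets \<mu> = sets Omega"
      and pr: "is_projection \<mu> \<nu>" "is_projection (distr \<mu> Omega (pgd_step A g \<phi> R lam Ret \<alpha> \<beta> \<nu>)) \<nu>'"
      and J: "J \<phi> R lam \<nu> \<le> J0" for \<alpha> \<beta> \<mu> \<nu> \<nu>'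
  proof -
    have \<nu>: "\<nu> \<in> nonneg_measures" "\<nu>' \<in> nonneg_measures" using pr by (auto simp: is_projection_def)
    interpret finite_measure \<nu> using \<nu> by (simp add: nonneg_measures_def)
    note int = integrable_continuous_compact_space[OF \<nu>(1) compact_UNIV]
    let ?f = "hintegral \<nu> \<phi>"
    define u where "u = J' \<phi> R lam \<nu>"
    define N where "N \<theta> = tnorm g \<theta> (mgrad A g u \<theta>)" for \<theta>
    define s where "s \<theta> = - 2 * \<alpha> * u \<theta>" for \<theta>
    define X where "X \<theta> = scale_tvec (- \<beta>) (mgrad A g u \<theta>)" for \<theta>
    have C1: "C1_function u" unfolding u_def by (rule C1_function_J'[OF \<phi>])
    note tan = mgrad_in_tangent_space[OF C1]
    have Rf: "R ?f \<le> J0" using J lam by (simp add: J_def) (smt (verit) mult_nonneg_nonneg measure_nonneg)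
    have g: "norm (hgrad R ?f) \<le> G" by (rule G(2)[OF Rf])
    have mass: "measure \<nu> (space \<nu>) \<le> M"
    proof -
      have "lam * measure \<nu> (space \<nu>) \<le> \<bar>J0\<bar>" using J R0[of ?f] by (simp add: J_def)
      then show ?thesis using lam by (simp add: M_def field_simps)
    qed
    have uU: "\<bar>u \<theta>\<bar> \<le> U" for \<theta>
    proof -
      have "\<bar>\<phi> \<theta> \<bullet> hgrad R ?f\<bar> \<le> norm (\<phi> \<theta>) * norm (hgrad R ?f)" by (rule Cauchy_Schwarz_ineq2)
      also have "\<dots> \<le> B * G" using \<phi>B g \<delta> by (intro mult_mono) auto
      finally show ?thesis using lam by (simp add: u_def J'_def U_def)
    qed
    \<comment> \<open>Links the two forms of the first-order change: the chart derivative of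
      \<open>\<phi>\<close> paired with the gradient of \<open>R\<close>, and the metric pairing
      with the gradient of \<open>J'\<close>.\<close>
    have du: "chart_deriv (ch \<theta>) \<phi> \<theta> (Y (ch \<theta>)) \<bullet> hgrad R ?f = g \<theta> (mgrad A g u \<theta>) Y"
      if "Y \<in> tangent_space A \<theta>" for Y \<theta>
      using metric_mgrad[OF C1 ch(1,2) that] chart_deriv_J'[OF \<phi> ch(1,2)] by (simp add: u_def)
    have N0: "N \<theta> \<ge> 0" for \<theta> unfolding N_def by (rule tnorm_nonneg[OF tan])
    \<comment> \<open>Taking the gradient itself as the direction bounds its squared norm by
      \<open>B * N \<theta> * G\<close>, and one factor cancels.\<close>
    have NU: "N \<theta> \<le> U" for \<theta>
    proof -
      have "N \<theta> * N \<theta> = chart_deriv (ch \<theta>) \<phi> \<theta> (mgrad A g u \<theta> (ch \<theta>)) \<bullet> hgrad R ?f"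
        by (simp add: du[OF tan] N_def tnorm_square[OF tan] power2_eq_square[symmetric])
      also have "\<dots> \<le> norm (chart_deriv (ch \<theta>) \<phi> \<theta> (mgrad A g u \<theta> (ch \<theta>))) * norm (hgrad R ?f)"
        by (rule norm_cauchy_schwarz)
      also have "\<dots> \<le> (B * N \<theta>) * G"
        using ch(3)[OF tan] g N0 \<delta> by (intro mult_mono) (auto simp: N_def)
      finally have "N \<theta> * N \<theta> \<le> N \<theta> * (B * G)" by (simp add: mult_ac)
      then have "N \<theta> \<le> B * G" using N0[of \<theta>] G \<delta> by (cases "N \<theta> = 0") (auto simp: mult_le_cancel_left)
      then show ?thesis using U by simp
    qed
    have sD: "\<bar>s \<theta>\<bar> < D" for \<theta>
    proof -
      have "\<bar>s \<theta>\<bar> \<le> \<eta> * (2 * U)" using mult_mono[OF \<alpha>(2) uU[of \<theta>]] \<alpha> by (simp add: s_def abs_mult)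
      then show ?thesis using \<eta> by simp
    qed
    have Xt: "X \<theta> \<in> tangent_space A \<theta>" for \<theta> unfolding X_def by (rule scale_tvec_in_tangent_space[OF tan])
    have tX: "tnorm g \<theta> (X \<theta>) = \<beta> * N \<theta>" for \<theta>
      using \<beta> by (simp add: X_def tnorm_scale[OF tan] N_def)
    have tD: "tnorm g \<theta> (X \<theta>) < D" for \<theta>
    proof -
      have "\<beta> * N \<theta> \<le> \<eta> * U" using mult_mono[OF \<beta>(2) NU[of \<theta>]] \<eta>0 N0 by simp
      also have "\<dots> \<le> \<eta> * (2 * U)" using \<eta>0 U by simp
      finally show ?thesis using \<eta> by (simp add: tX)
    qed
    have uc: "continuous_on UNIV u" unfolding u_def J'_def by (intro continuous_intros \<phi>c)
    have sc: "continuous_on UNIV s" unfolding s_def by (intro continuous_intros uc)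
    have Xc: "continuous_on (fst c) (\<lambda>\<theta>. X \<theta> c)" if "c \<in> A" for c
      unfolding X_def scale_tvec_def by (intro continuous_intros continuous_on_mgrad_coords[OF C1 that])
    have Nc: "continuous_on UNIV (\<lambda>\<theta>. (N \<theta>)\<^sup>2)" unfolding N_def by (rule continuous_on_tnorm_mgrad[OF C1])
    have sC: "\<bar>s \<theta>\<bar> < C" and tC: "tnorm g \<theta> (X \<theta>) < C" for \<theta>
      using sD[of \<theta>] tD[of \<theta>] D by auto
    let ?T = "pgd_step A g \<phi> R lam Ret \<alpha> \<beta> \<nu>"
    have T: "?T (r, \<theta>) = Ret (r, \<theta>) (r * s \<theta>, X \<theta>)" for r \<theta>
      by (simp add: pgd_step_def s_def X_def u_def mult_ac)
    define y where "y \<theta> = Ret (1, \<theta>) (s \<theta>, X \<theta>)" for \<theta>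
    have yc: "continuous_on UNIV y" unfolding y_def by (rule continuous_on_ret[OF sc sC Xt Xc tC])
    have push: "(\<integral>\<theta>. F \<theta> \<partial>\<nu>') = (\<integral>\<theta>. (fst (y \<theta>))\<^sup>2 * F (snd (y \<theta>)) \<partial>\<nu>)" if "continuous_on UNIV F" for F :: "'p \<Rightarrow> real"
      unfolding y_def by (rule projection_cone_step[OF sc sC Xt Xc tC T \<mu> pr that])
    have est: "\<bar>(fst (y \<theta>))\<^sup>2 - 1 - 2 * s \<theta>\<bar> \<le> B * ((s \<theta>)\<^sup>2 + (tnorm g \<theta> (X \<theta>))\<^sup>2)"
      "norm ((fst (y \<theta>))\<^sup>2 *\<^sub>R \<phi> (snd (y \<theta>)) - \<phi> \<theta> - (2 * s \<theta>) *\<^sub>R \<phi> \<theta>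
        - chart_deriv (ch \<theta>) \<phi> \<theta> (X \<theta> (ch \<theta>))) \<le> B * ((s \<theta>)\<^sup>2 + (tnorm g \<theta> (X \<theta>))\<^sup>2)" for \<theta>
      using ch(4)[OF Xt, of "s \<theta>" \<theta>] sD[of \<theta>] tD[of \<theta>] D unfolding y_def by auto
    have wc: "continuous_on UNIV (\<lambda>\<theta>. (fst (y \<theta>))\<^sup>2)" by (intro continuous_intros yc)
    have s1: "\<bar>s \<theta>\<bar> \<le> 1" and t1: "tnorm g \<theta> (X \<theta>) \<le> 1" and t0: "0 \<le> tnorm g \<theta> (X \<theta>)" for \<theta>
      using sD[of \<theta>] tD[of \<theta>] D tnorm_nonneg[OF Xt] by auto
    have "measure \<nu>' (space \<nu>') = (\<integral>\<theta>. (fst (y \<theta>))\<^sup>2 \<partial>\<nu>)" using push[of "\<lambda>_. 1"] by simp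
    also have "\<dots> \<le> (\<integral>\<theta>. 3 + 2 * B \<partial>\<nu>)"
    proof (intro integral_mono int wc)
      fix \<theta>
      have "(s \<theta>)\<^sup>2 \<le> 1" "(tnorm g \<theta> (X \<theta>))\<^sup>2 \<le> 1"
        using s1[of \<theta>] t1[of \<theta>] t0[of \<theta>] by (auto simp: abs_square_le_1)
      then have "B * ((s \<theta>)\<^sup>2 + (tnorm g \<theta> (X \<theta>))\<^sup>2) \<le> B * 2" using \<delta> by (intro mult_left_mono) auto
      then show "(fst (y \<theta>))\<^sup>2 \<le> 3 + 2 * B" using est(1)[of \<theta>] s1[of \<theta>] by linarith
    qed simp
    also have "\<dots> = (3 + 2 * B) * measure \<nu> (space \<nu>)" by simp
    also have "\<dots> \<le> M1" unfolding M1_def using mass \<delta> by (intro mult_left_mono) auto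
    finally have mass': "measure \<nu>' (space \<nu>') \<le> M1" .
    have K: "?f \<in> K" "hintegral \<nu>' \<phi> \<in> K"
      unfolding K_def using \<nu> mass mass' M1
      by (auto intro!: hintegral_in_closure_convex_hull compact_UNIV \<phi>c)
    define P where "P \<theta> = 4 * \<alpha> * \<bar>u \<theta>\<bar>\<^sup>2 + \<beta> * (N \<theta>)\<^sup>2" for \<theta>
    have Pc: "continuous_on UNIV P" unfolding P_def
      by (intro continuous_on_add continuous_on_mult continuous_on_const continuous_on_power continuous_on_rabs uc Nc)
    have tc: "continuous_on UNIV (\<lambda>\<theta>. (tnorm g \<theta> (X \<theta>))\<^sup>2)"
      unfolding tX power_mult_distrib by (intro continuous_on_mult continuous_on_const Nc)
    have first: "2 * s \<theta> * J' \<phi> R lam \<nu> \<theta> + chart_deriv (ch \<theta>) \<phi> \<theta> (X \<theta> (ch \<theta>)) \<bullet> hgrad R ?f = - P \<theta>" for \<theta>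
    proof -
      have "chart_deriv (ch \<theta>) \<phi> \<theta> (X \<theta> (ch \<theta>)) \<bullet> hgrad R ?f = - \<beta> * (N \<theta>)\<^sup>2"
        unfolding du[OF Xt] by (simp add: X_def metric_scale[OF tan tan] N_def tnorm_square[OF tan])
      then show ?thesis by (simp add: P_def s_def u_def power2_eq_square)
    qed
    have step: "J \<phi> R lam \<nu>' \<le> J \<phi> R lam \<nu> - (\<integral>\<theta>. P \<theta> \<partial>\<nu>) + Q * (\<integral>\<theta>. (s \<theta>)\<^sup>2 + (tnorm g \<theta> (X \<theta>))\<^sup>2 \<partial>\<nu>)"
      unfolding Q_def
      by (rule J_reweighting_step[OF compact_UNIV \<phi>c \<phi>B \<nu> mass wc continuous_on_snd[OF yc] push sc s1 tc t0 t1
            est ch(3)[OF Xt] g less_imp_le[OF lam] first Pc L(1) L(2)[OF K]])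
    have "(\<integral>\<theta>. (s \<theta>)\<^sup>2 + (tnorm g \<theta> (X \<theta>))\<^sup>2 \<partial>\<nu>) \<le> (\<integral>\<theta>. \<eta> * P \<theta> \<partial>\<nu>)"
    proof (intro integral_mono int)
      show "continuous_on UNIV (\<lambda>\<theta>. (s \<theta>)\<^sup>2 + (tnorm g \<theta> (X \<theta>))\<^sup>2)"
        by (intro continuous_on_add continuous_on_power sc tc)
      show "continuous_on UNIV (\<lambda>\<theta>. \<eta> * P \<theta>)" by (intro continuous_on_mult continuous_on_const Pc)
      fix \<theta>
      \<comment> \<open>The squared displacements are the two terms of \<open>P \<theta>\<close>
        multiplied by one further step-size each, and both step-sizes are at most
        \<open>\<eta>\<close>.\<close>
      have "\<alpha> * (4 * \<alpha> * (u \<theta>)\<^sup>2) \<le> \<eta> * (4 * \<alpha> * (u \<theta>)\<^sup>2)" using \<alpha> by (intro mult_right_mono) auto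
      moreover have "\<beta> * (\<beta> * (N \<theta>)\<^sup>2) \<le> \<eta> * (\<beta> * (N \<theta>)\<^sup>2)" using \<beta> by (intro mult_right_mono) auto
      ultimately show "(s \<theta>)\<^sup>2 + (tnorm g \<theta> (X \<theta>))\<^sup>2 \<le> \<eta> * P \<theta>"
        by (simp add: tX s_def P_def power2_eq_square algebra_simps)
    qed
    then have "Q * (\<integral>\<theta>. (s \<theta>)\<^sup>2 + (tnorm g \<theta> (X \<theta>))\<^sup>2 \<partial>\<nu>) \<le> Q * (\<eta> * (\<integral>\<theta>. P \<theta> \<partial>\<nu>))"
      using Q by (intro mult_left_mono) auto
    also have "\<dots> = (\<eta> * Q) * (\<integral>\<theta>. P \<theta> \<partial>\<nu>)" by simp
    also have "\<dots> \<le> 1 / 2 * (\<integral>\<theta>. P \<theta> \<partial>\<nu>)"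
      using \<alpha> \<beta> \<eta>(2) by (intro mult_right_mono Bochner_Integration.integral_nonneg) (auto simp: P_def)
    finally show ?thesis using step by (simp add: P_def u_def N_def)
  qed
  then show ?thesis using \<eta>0 by blast
qed

end

section \<open>Geometric rate by iterating the descent\<close>

theorem corollary3p5:
  fixes A :: "('p::{t2_space, second_countable_topology}, real^'d) chart set"
    and g :: "('p, real^'d) metric_tensor"
    and \<phi> :: "'p \<Rightarrow> 'f::{real_inner, banach}"
    and R :: "'f \<Rightarrow> real"
    and lam J0 \<kappa>0 a b :: real
    and r :: "'m::finite \<Rightarrow> real"
    and \<theta> :: "'m \<Rightarrow> 'p"
    and nc :: "'m \<Rightarrow> ('p, real^'d) chart"
    and \<nu>s :: "'p measure"
    and Ret :: "('p, real^'d) cone_map"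
  assumes "smoothness_assumption A g \<phi> R lam"
    and "convex_on UNIV R"
    and "sparse_minimizer \<phi> R lam r \<theta> \<nu>s"
    and "\<And>i. normal_chart A g (\<theta> i) (nc i)"
    and "a > 0" and "b > 0"
    and "nondegenerate a b \<phi> R lam r \<theta> nc \<nu>s"
    and "J0 > Jstar \<phi> R lam" and "\<kappa>0 > 0"
    and "sharpness A g \<phi> R lam J0 \<kappa>0"
    and "cone_retraction A g Ret"
  shows "\<exists>\<eta>max>0. \<forall>\<alpha> \<beta> \<mu> \<nu>.
    \<alpha> > 0 \<longrightarrow> \<beta> > 0 \<longrightarrow> pgd_sequence A g \<phi> R lam Ret \<alpha> \<beta> \<mu> \<nu> \<longrightarrow>
    J \<phi> R lam (\<nu> 0) \<le> J0 \<longrightarrow> max \<alpha> \<beta> \<le> \<eta>max \<longrightarrow>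
    (\<forall>k. J \<phi> R lam (\<nu> k) - Jstar \<phi> R lam
         \<le> (J \<phi> R lam (\<nu> 0) - Jstar \<phi> R lam) * (1 - \<kappa>0 * min \<alpha> \<beta>) ^ k)"
proof -
  have sm: "compact_riemannian_manifold A g" "lam > 0" "\<And>f. R f \<ge> 0" "C2_loc_lipschitz_map A \<phi>"
    "C2_loc_lipschitz_on UNIV R" "\<And>b. bounded (hgrad R ` {f. R f \<le> b})"
    using assms(1) by (auto simp: smoothness_assumption_def)
  have "\<exists>C f. cone_retraction_data A g Ret C f"
    using assms(11) unfolding cone_retraction_def Let_def
  proof (elim exE conjE, goal_cases)
    case (1 C f)
    show ?case
      by (rule exI[of _ C], rule exI[of _ f], intro cone_retraction_data.intro riemannian.intro sm(1)
          cone_retraction_data_axioms.intro) (use 1 in blast)+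
  qed
  then obtain C f where "cone_retraction_data A g Ret C f" by (elim exE)
  then interpret cone_retraction_data A g Ret C f .
  let ?J = "J \<phi> R lam" and ?Js = "Jstar \<phi> R lam"
  let ?D = "\<lambda>\<alpha> \<beta> \<nu>. (\<integral>\<theta>. (4 * \<alpha> * \<bar>J' \<phi> R lam \<nu> \<theta>\<bar>\<^sup>2
      + \<beta> * (tnorm g \<theta> (mgrad A g (J' \<phi> R lam \<nu>) \<theta>))\<^sup>2) \<partial>\<nu>)"
  obtain \<eta> where \<eta>: "\<eta> > 0" and descent: "\<forall>\<alpha> \<beta> \<mu> \<nu> \<nu>'. 0 < \<alpha> \<longrightarrow> \<alpha> \<le> \<eta> \<longrightarrow> 0 < \<beta> \<longrightarrow> \<beta> \<le> \<eta> \<longrightarrow>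
    sets \<mu> = sets Omega \<longrightarrow> is_projection \<mu> \<nu> \<longrightarrow>
    is_projection (distr \<mu> Omega (pgd_step A g \<phi> R lam Ret \<alpha> \<beta> \<nu>)) \<nu>' \<longrightarrow>
    ?J \<nu> \<le> J0 \<longrightarrow> ?J \<nu>' \<le> ?J \<nu> - 1/2 * ?D \<alpha> \<beta> \<nu>"
    using pgd_descent[where R = R, OF sm(4,2,3,5,6), of J0] by (elim exE conjE)
  \<comment> \<open>The bound by \<open>J0\<close> is carried through the induction because the
    one-step descent and the sharpness inequality are both restricted to that sublevel set.\<close>
  have "?J (\<nu> k) - ?Js \<le> (?J (\<nu> 0) - ?Js) * (1 - \<kappa>0 * min \<alpha> \<beta>) ^ k \<and> ?J (\<nu> k) \<le> J0"
    if \<alpha>\<beta>: "\<alpha> > 0" "\<beta> > 0" "max \<alpha> \<beta> \<le> min \<eta> (1 / \<kappa>0)"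
      and seq: "pgd_sequence A g \<phi> R lam Ret \<alpha> \<beta> \<mu> \<nu>" and J0: "?J (\<nu> 0) \<le> J0" for \<alpha> \<beta> \<mu> \<nu> k
  proof (induction k)
    case 0
    then show ?case using J0 by simp
  next
    case (Suc k)
    have pr: "is_projection (\<mu> k) (\<nu> k)" for k using seq by (simp add: pgd_sequence_def)
    have mu: "\<mu> (Suc k) = distr (\<mu> k) Omega (pgd_step A g \<phi> R lam Ret \<alpha> \<beta> (\<nu> k))" for k
      using seq by (simp add: pgd_sequence_def)
    have sets: "sets (\<mu> k) = sets Omega"
      using seq by (cases k) (auto simp: mu, auto simp: pgd_sequence_def P2_def)
    let ?q = "1 - \<kappa>0 * min \<alpha> \<beta>"
    have desc: "?J (\<nu> (Suc k)) \<le> ?J (\<nu> k) - 1/2 * ?D \<alpha> \<beta> (\<nu> k)"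
      using descent[rule_format, of \<alpha> \<beta> "\<mu> k" "\<nu> k" "\<nu> (Suc k)"] \<alpha>\<beta> sets pr[of k] pr[of "Suc k"] Suc
      by (simp add: mu)
    have sharp: "1/2 * ?D \<alpha> \<beta> (\<nu> k) \<ge> \<kappa>0 * min \<alpha> \<beta> * (?J (\<nu> k) - ?Js)"
      using assms(10) \<alpha>\<beta> pr[of k] Suc unfolding sharpness_def is_projection_def by blast
    \<comment> \<open>The cap \<open>1 / \<kappa>0\<close> on the step-sizes keeps the contraction
      factor nonnegative, so the induction hypothesis may be multiplied by it.\<close>
    have "min \<alpha> \<beta> \<le> 1 / \<kappa>0" using \<alpha>\<beta> by auto
    then have q: "?q \<ge> 0" using assms(9) by (simp add: field_simps)
    have "?J (\<nu> (Suc k)) - ?Js \<le> ?q * (?J (\<nu> k) - ?Js)"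
      using desc sharp by (simp add: algebra_simps)
    also have "\<dots> \<le> ?q * ((?J (\<nu> 0) - ?Js) * ?q ^ k)" using Suc q by (intro mult_left_mono) auto
    finally have "?J (\<nu> (Suc k)) - ?Js \<le> (?J (\<nu> 0) - ?Js) * ?q ^ Suc k" by (simp add: mult_ac)
    \<comment> \<open>A nonnegative decrease keeps the next iterate in the sublevel set of
      \<open>J0\<close>.\<close>
    moreover have "?D \<alpha> \<beta> (\<nu> k) \<ge> 0" using \<alpha>\<beta> by (intro Bochner_Integration.integral_nonneg) auto
    ultimately show ?case using desc Suc by linarith
  qed
  then show ?thesis using \<eta> assms(9) by (intro exI[of _ "min \<eta> (1 / \<kappa>0)"]) auto
qed

end
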